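(* Let $k\ge2$, and let $\mathcal{H}$ be an affine hyperplane in $\mathbb{R}^k$ with normal vector $\boldsymbol{\alpha}=(1,\alpha_2,\ldots,\alpha_k)$, where the coordinates are ordered so that $\alpha_2,\ldots,\alpha_\ell$ are non-zero and $\alpha_{\ell+1}=\cdots=\alpha_k=0$ (so $\ell=1+\#\{2\le i\le k:\alpha_i\ne0\}$); in particular $\alpha_2\cdots\alpha_\ell\ne0$. Assume $\omega:=\omega(\alpha_2,\ldots,\alpha_k)<\infty$. Let $\mu_0$ be a probability measure on $\mathcal{H}$ of the form described in the context. Let $\mathbf{y}\in\mathbb{R}^k$, let $b_1,\ldots,b_k:\mathbb{R}\to[0,1]$ be non-zero smooth bump functions supported on $[-2,2]$, and for $n\in\mathbb{N}$ and $d_1,\ldots,d_k\in(0,1/(2n)]$ (which may depend on $n$) define \[ A_n^*(\mathbf{x})=\sum_{\mathbf{a}\in\mathbb{Z}^k}\prod_{j=1}^k b_j\!\left(\frac{x_j-(a_j+y_j)/n}{d_j}\right). \] Assume that, for some fixed $\varpi>\omega$, \[ \max\{d_j:1\le j\le\ell\}\gg n^{-1-1/\varpi}. \] Then $\mu_0(A_n^* )\sim\lambda(A_n^* )$ as $n\to\infty$, where $\mu_0(A_n^* )=\int_{[0,1]^k}A_n^*\,d\mu_0$ and $\lambda(A_n^* )=\int_{[0,1]^k}A_n^*(\mathbf{x})\,d\mathbf{x}$.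
   Context: The simultaneous exponent of $\mathbf{x}\in\mathbb{R}^d$ is $\omega(\mathbf{x})=\sup\{w:\max_i\|nx_i\|<n^{-w}\text{ for infinitely many }n\in\mathbb{N}\}$, where $\|\cdot\|$ is the distance to the nearest integer. Construction of $\mu_0$: fix a box $\mathcal{B}=[-B_1,B_1]\times\cdots\times[-B_{k-1},B_{k-1}]\subset\mathbb{R}^{k-1}$, small positive constants $r_1,\ldots,r_{k-1}$, and non-zero smooth bump functions $\beta_1,\ldots,\beta_{k-1}:\mathbb{R}\to[0,1]$ supported on $[-2,2]$. Let $\nu$ be the probability measure on the hyperplane $\{x_k=0\}\cong\mathbb{R}^{k-1}$ with density proportional to the convolution $1_{\mathcal{B}}*g$, where $g(x_1,\ldots,x_{k-1})=\prod_{i<k}\beta_i(x_i/r_i)$. Then $\mu_0$ is the image of $\nu$ under a rotation of $\mathbb{R}^k$ taking $\{x_k=0\}$ to the hyperplane through the origin parallel to $\mathcal{H}$, followed by a translation onto $\mathcal{H}$. Implied constants may depend on $\boldsymbol{\alpha},\mathcal{B},r_1,\ldots,r_{k-1}$, $\varpi$ and the bump functions.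
   Formalization: Since the support of μ_0 may miss [0,1]^k, which makes the literal claim false, μ_0(A_n^* ) is taken with μ_0 reduced modulo Z^k (A_n^* is periodic); the integral of A_n^* over [0,1]^k against μ_0 itself is treated when μ_0([0,1]^k)=1. *)

theory Defs
  imports "HOL-Analysis.Analysis" "HOL-Library.Landau_Symbols"
begin

text \<open>
  Coordinates of \<open>\<real>\<^sup>k\<close> are indexed by a finite linearly ordered type \<open>'k\<close> with
  \<open>k = CARD('k)\<close>. The position of a coordinate lies in \<open>{1..k}\<close>; \<open>x\<^sub>j\<close> is the coordinate of
  \<open>x\<close> at position \<open>j\<close>.
\<close>

definition pos :: "'k::{finite,linorder} \<Rightarrow> nat" where
  "pos i = card {j. j \<le> i}"

definition simultaneous_exponent :: "'i set \<Rightarrow> ('i \<Rightarrow> real) \<Rightarrow> ereal" where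
  "simultaneous_exponent I x =
     Sup {ereal w | w. infinite {n::nat. n \<ge> 1 \<and>
       Max ((\<lambda>i. infdist (real n * x i) \<int>) ` I) < real n powr (- w)}}"

definition smooth_bump :: "(real \<Rightarrow> real) \<Rightarrow> bool" where
  "smooth_bump f \<longleftrightarrow>
     (\<forall>m x. (deriv ^^ m) f field_differentiable at x) \<and>
     (\<forall>x. f x \<in> {0..1}) \<and> (\<forall>x. x \<notin> {-2..2} \<longrightarrow> f x = 0) \<and> (\<exists>x. f x \<noteq> 0)"

text \<open>
  \<open>\<real>\<^bsup>k-1\<^esup>\<close> is the space of (extensional) functions on \<open>base_coords\<close>, with Lebesgue measure
  \<open>base_lborel\<close>; \<open>embed_base\<close> identifies it with the hyperplane \<open>x\<^sub>k = 0\<close>. In the definitions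
  below, the values of \<open>B\<close>, \<open>r\<close>, \<open>\<beta>\<close> at the last coordinate are irrelevant.
\<close>

definition base_coords :: "'k::{finite,linorder} set" where
  "base_coords = {i. pos i < CARD('k)}"

definition base_lborel :: "('k::{finite,linorder} \<Rightarrow> real) measure" where
  "base_lborel = (\<Pi>\<^sub>M i\<in>base_coords. lborel)"

definition embed_base :: "('k::{finite,linorder} \<Rightarrow> real) \<Rightarrow> (real, 'k) vec" where
  "embed_base u = (\<chi> i. if i \<in> base_coords then u i else 0)"

definition base_box :: "('k::{finite,linorder} \<Rightarrow> real) \<Rightarrow> ('k \<Rightarrow> real) set" where
  "base_box B = (\<Pi>\<^sub>E i\<in>base_coords. {- B i..B i})"

definition base_bump ::
  "('k::{finite,linorder} \<Rightarrow> real) \<Rightarrow> ('k \<Rightarrow> real \<Rightarrow> real) \<Rightarrow> ('k \<Rightarrow> real) \<Rightarrow> real" where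
  "base_bump r \<beta> u = (\<Prod>i\<in>base_coords. \<beta> i (u i / r i))"

definition base_convolution ::
  "(('k::{finite,linorder} \<Rightarrow> real) \<Rightarrow> real) \<Rightarrow> (('k \<Rightarrow> real) \<Rightarrow> real) \<Rightarrow> ('k \<Rightarrow> real) \<Rightarrow> real" where
  "base_convolution f g u =
     (LINT t|base_lborel. f t * g (\<lambda>i\<in>base_coords. u i - t i))"

definition base_density ::
  "('k::{finite,linorder} \<Rightarrow> real) \<Rightarrow> ('k \<Rightarrow> real) \<Rightarrow> ('k \<Rightarrow> real \<Rightarrow> real) \<Rightarrow> ('k \<Rightarrow> real) \<Rightarrow> real" where
  "base_density B r \<beta> = base_convolution (indicator (base_box B)) (base_bump r \<beta>)"

definition base_measure ::
  "('k::{finite,linorder} \<Rightarrow> real) \<Rightarrow> ('k \<Rightarrow> real) \<Rightarrow> ('k \<Rightarrow> real \<Rightarrow> real) \<Rightarrow> (real, 'k) vec measure" where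
  "base_measure B r \<beta> =
     distr (density base_lborel
              (\<lambda>u. ennreal (base_density B r \<beta> u / (LINT t|base_lborel. base_density B r \<beta> t))))
       borel embed_base"

definition smoothed_count ::
  "('k::finite \<Rightarrow> real \<Rightarrow> real) \<Rightarrow> real ^ 'k \<Rightarrow> (nat \<Rightarrow> 'k \<Rightarrow> real) \<Rightarrow> nat \<Rightarrow> real ^ 'k \<Rightarrow> real" where
  "smoothed_count b y d n x =
     (\<Sum>\<^sub>\<infinity>a\<in>(UNIV :: (int ^ 'k) set).
        \<Prod>j\<in>UNIV. b j ((x $ j - (real_of_int (a $ j) + y $ j) / real n) / d n j))"

text \<open>
  A measure on \<open>\<real>\<^sup>k\<close> is regarded as a measure on the unit cube by reduction modulo \<open>\<int>\<^sup>k\<close>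
  (the functions \<open>smoothed_count b y d n\<close> with \<open>n \<ge> 1\<close> are \<open>\<int>\<^sup>k\<close>-periodic).
\<close>

definition reduce_mod_one :: "(real ^ 'k::finite) measure \<Rightarrow> (real ^ 'k) measure" where
  "reduce_mod_one \<mu> = distr \<mu> borel (\<lambda>x. \<chi> i. frac (x $ i))"

end

theory Submission imports Defs begin

text \<open>
  Fix a coordinate \<open>j0\<close> with \<open>d n j0\<close> maximal among the first \<open>l\<close> coordinates and put \<open>\<delta> j = n * d n j\<close>. By
  periodicity, \<open>smoothed_count b y d n x\<close> is a product over \<open>j\<close> of the \<open>1\<close>-periodizations of
  \<open>b j (\<cdot> / \<delta> j)\<close>, evaluated at \<open>n * x $ j - y $ j\<close>. Only the factor at \<open>j0\<close> is expanded into a Fourier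
  series. The product of the other factors (the weight) is invariant under the displacements of the
  hyperplane that move one coordinate \<open>i \<noteq> j0\<close> by \<open>1 / n\<close> and compensate in the coordinate \<open>j0\<close>.

  The zero frequency gives the main term, because averaging the displacement over a unit cube replaces the
  weight by its mean. For a frequency \<open>q \<noteq> 0\<close> such a displacement multiplies the integrand by
  \<open>echar (- q * \<alpha> $ i / \<alpha> $ j0)\<close>, so iterated differencing of the smooth density gains a power of
  \<open>n * \<parallel>q * \<alpha> $ i / \<alpha> $ j0\<parallel>\<close>. The exponent hypothesis bounds this from below by a power of \<open>n\<close> for some \<open>i\<close> as
  long as \<open>\<bar>q\<bar> \<le> n powr \<kappa>\<close> with \<open>1 / varpi < \<kappa> < 1 / \<omega>\<close>; beyond that range the coefficients of the
  factor at \<open>j0\<close>, whose scale is \<open>\<delta> j0 \<ge> c * n powr (- 1 / varpi)\<close>, are negligible.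
\<close>

subsection \<open>Iterated differences\<close>

text \<open>Only the largest scale among the first \<open>l\<close> coordinates is bounded below;
  the other \<open>\<delta> j\<close> may tend to 0 at any speed. Their Fourier series admit no
  useful truncation, and the main term may be arbitrarily small, so every error must be relative to
  it. Hence all estimates are uniform in the weight and carry the factor \<open>mean m\<close>: the
  mass of the weight is controlled by averaging over displacements, never by its supremum. The pivot
  \<open>j0\<close> may change with \<open>n\<close>, so each admissible pivot gets its own
  constant, and the exponent hypothesis, stated for the normalisation with first coordinate 1, is
  transferred to every vector of ratios \<open>\<alpha> $ i / \<alpha> $ j0\<close>. Differences
  replace derivatives throughout: they are what displacements produce, they survive products, linear
  substitutions and convolutions, and they also give the decay of the bump coefficients. The orders
  \<open>N\<close> (differences of the density) and \<open>M\<close> (coefficient decay) are chosen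
  to make each relative error a constant times \<open>1 / n\<close>.\<close>

definition fdiff :: "'a::ab_group_add \<Rightarrow> ('a \<Rightarrow> 'b::ab_group_add) \<Rightarrow> 'a \<Rightarrow> 'b" where
  "fdiff h f x = f (x + h) - f x"

lemma fdiff_pow_Suc: "(fdiff h ^^ Suc N) f x = (fdiff h ^^ N) f (x + h) - (fdiff h ^^ N) f x"
  by (simp add: fdiff_def)

lemma fdiff_pow_eq_0:
  fixes f :: "'a::real_normed_vector \<Rightarrow> 'b::ab_group_add"
  assumes "\<And>x. norm x > K \<Longrightarrow> f x = 0" and "norm x > K + real N * norm h"
  shows "(fdiff h ^^ N) f x = 0"
  using assms(2)
proof (induction N arbitrary: x)
  case 0
  then show ?case using assms(1) by simp
next
  case (Suc N)
  have "norm x \<le> norm (x + h) + norm h"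
    by (metis norm_triangle_ineq4 add_diff_cancel_right')
  moreover have "norm x > K + real N * norm h + norm h"
    using Suc.prems by (simp add: algebra_simps)
  moreover have "norm h \<ge> 0" by simp
  ultimately have "norm (x + h) > K + real N * norm h" "norm x > K + real N * norm h"
    by linarith+
  then show ?case using Suc.IH unfolding fdiff_pow_Suc by simp
qed

text \<open>The induction runs over the whole chain of derivatives: differencing every
  \<open>F m\<close> gives a chain again, and the mean value inequality turns the bound on
  \<open>F (Suc N)\<close> into \<open>C * \<bar>h\<bar>\<close> for the differenced
  \<open>F N\<close>.\<close>

lemma fdiff_pow_le_deriv:
  fixes F :: "nat \<Rightarrow> real \<Rightarrow> real"
  assumes "\<And>m x. (F m has_real_derivative F (Suc m) x) (at x)" and "\<And>x. \<bar>F N x\<bar> \<le> C"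
  shows "\<bar>(fdiff h ^^ N) (F 0) x\<bar> \<le> C * \<bar>h\<bar> ^ N"
  using assms
proof (induction N arbitrary: F C x)
  case 0
  then show ?case by simp
next
  case (Suc N)
  define G where "G m = fdiff h (F m)" for m
  have der: "(G m has_real_derivative G (Suc m) x) (at x)" for m x
    unfolding G_def fdiff_def
    by (intro derivative_intros DERIV_shift[THEN iffD1] Suc.prems)
  have bd: "\<bar>G N x\<bar> \<le> C * \<bar>h\<bar>" for x
  proof -
    have "norm (F N (x + h) - F N x) \<le> C * norm (x + h - x)"
      by (rule field_differentiable_bound[where S = UNIV and f' = "F (Suc N)"])
        (use Suc.prems in auto)
    then show ?thesis by (simp add: G_def fdiff_def)
  qed
  have "\<bar>(fdiff h ^^ N) (G 0) x\<bar> \<le> (C * \<bar>h\<bar>) * \<bar>h\<bar> ^ N"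
    by (rule Suc.IH[OF der bd])
  then show ?case
    by (simp add: G_def funpow_swap1 mult.assoc)
qed

lemma fdiff_pow_shift: "(fdiff w ^^ N) (\<lambda>x. f (x + z)) x = (fdiff w ^^ N) f (x + z)"
proof (induction N arbitrary: x)
  case (Suc N)
  then show ?case unfolding fdiff_pow_Suc by (simp add: algebra_simps)
qed simp

lemma fdiff_pow_add: 
  "(fdiff w ^^ N) (\<lambda>x. f x + g x) x = (fdiff w ^^ N) f x + (fdiff w ^^ N) g x"
proof (induction N arbitrary: x)
  case (Suc N)
  then show ?case unfolding fdiff_pow_Suc by (simp add: algebra_simps)
qed simp

text \<open>A discrete Leibniz rule: one difference of a product splits into two products, one of
  which contains a translate of \<open>f\<close>. As the bounds hold at every point, translates
  satisfy them too, and the two halves per step account for \<open>2 ^ N\<close>.\<close>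

lemma fdiff_pow_mult:
  fixes f g :: "'a::ab_group_add \<Rightarrow> real"
  assumes "\<And>i x. i \<le> N \<Longrightarrow> \<bar>(fdiff w ^^ i) f x\<bar> \<le> A * s ^ i"
    and "\<And>i x. i \<le> N \<Longrightarrow> \<bar>(fdiff w ^^ i) g x\<bar> \<le> B * s ^ i"
  shows "\<bar>(fdiff w ^^ N) (\<lambda>x. f x * g x) x\<bar> \<le> 2 ^ N * A * B * s ^ N"
  using assms
proof (induction N arbitrary: f g A B x)
  case 0
  have "\<bar>f x\<bar> \<le> A" "\<bar>g x\<bar> \<le> B"
    using "0.prems"(1)[of 0 x] "0.prems"(2)[of 0 x] by simp_all
  then show ?case by (simp add: abs_mult mult_mono')
next
  case (Suc N)
  have fd: "(fdiff w ^^ Suc i) h = (fdiff w ^^ i) (fdiff w h)" for i and h :: "'a \<Rightarrow> real"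
    by (simp add: funpow_swap1)
  have eq: "fdiff w (\<lambda>x. f x * g x) = (\<lambda>x. fdiff w f x * g x + f (x + w) * fdiff w g x)"
    by (auto simp: fdiff_def algebra_simps)
  have f': "\<bar>(fdiff w ^^ i) (fdiff w f) x\<bar> \<le> (A * s) * s ^ i" if "i \<le> N" for i x
    using Suc.prems(1)[of "Suc i" x] that fd[of i f] by (simp add: mult.assoc)
  have g': "\<bar>(fdiff w ^^ i) (fdiff w g) x\<bar> \<le> (B * s) * s ^ i" if "i \<le> N" for i x
    using Suc.prems(2)[of "Suc i" x] that fd[of i g] by (simp add: mult.assoc)
  have fs: "\<bar>(fdiff w ^^ i) (\<lambda>x. f (x + w)) x\<bar> \<le> A * s ^ i" if "i \<le> N" for i x
    using Suc.prems(1)[of i "x + w"] that by (simp add: fdiff_pow_shift)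
  have 1: "\<bar>(fdiff w ^^ N) (\<lambda>x. fdiff w f x * g x) x\<bar> \<le> 2 ^ N * (A * s) * B * s ^ N"
    by (rule Suc.IH) (use f' Suc.prems(2) in auto)
  have 2: "\<bar>(fdiff w ^^ N) (\<lambda>x. f (x + w) * fdiff w g x) x\<bar> \<le> 2 ^ N * A * (B * s) * s ^ N"
    by (rule Suc.IH) (use g' fs in auto)
  show ?case
    unfolding fd eq fdiff_pow_add using 1 2 by (simp add: algebra_simps abs_le_iff)
qed

text \<open>Stands in for "smooth with bounded derivatives of every order". The step
  \<open>w\<close> is unrestricted in size and direction, so no partial derivatives are involved,
  and the notion passes through products, linear maps and integrals over a parameter.\<close>

definition fdiff_bounded :: "('a::real_normed_vector \<Rightarrow> real) \<Rightarrow> bool" where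
  "fdiff_bounded f \<longleftrightarrow> (\<forall>N. \<exists>C. \<forall>w x. \<bar>(fdiff w ^^ N) f x\<bar> \<le> C * norm w ^ N)"

lemma fdiff_boundedE:
  assumes "fdiff_bounded f"
  obtains C where "C > 0" "\<And>w x i. i \<le> N \<Longrightarrow> \<bar>(fdiff w ^^ i) f x\<bar> \<le> C * norm w ^ i"
proof -
  obtain c where c: "\<And>i w x. \<bar>(fdiff w ^^ i) f x\<bar> \<le> c i * norm w ^ i"
    using assms unfolding fdiff_bounded_def by metis
  define C where "C = (\<Sum>i\<le>N. \<bar>c i\<bar>) + 1"
  show thesis
  proof
    show "C > 0" unfolding C_def by (simp add: add_nonneg_pos sum_nonneg)
    fix w x i assume "i \<le> N"
    then have "c i \<le> C" unfolding C_def
      using member_le_sum[of i "{..N}" "\<lambda>i. \<bar>c i\<bar>"] by (simp add: abs_le_iff)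
    then show "\<bar>(fdiff w ^^ i) f x\<bar> \<le> C * norm w ^ i"
      by (meson c order_trans mult_right_mono norm_ge_zero zero_le_power)
  qed
qed

lemma fdiff_bounded_mult:
  assumes "fdiff_bounded f" "fdiff_bounded g"
  shows "fdiff_bounded (\<lambda>x. f x * g x)"
  unfolding fdiff_bounded_def
proof
  fix N
  obtain A where A: "\<And>w x i. i \<le> N \<Longrightarrow> \<bar>(fdiff w ^^ i) f x\<bar> \<le> A * norm w ^ i"
    using fdiff_boundedE[OF assms(1)] by metis
  obtain B where B: "\<And>w x i. i \<le> N \<Longrightarrow> \<bar>(fdiff w ^^ i) g x\<bar> \<le> B * norm w ^ i"
    using fdiff_boundedE[OF assms(2)] by metis
  show "\<exists>C. \<forall>w x. \<bar>(fdiff w ^^ N) (\<lambda>x. f x * g x) x\<bar> \<le> C * norm w ^ N"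
    using fdiff_pow_mult[OF A B] by blast
qed

lemma fdiff_bounded_1: "fdiff_bounded (\<lambda>x. 1)"
  unfolding fdiff_bounded_def
proof
  fix N
  have "(fdiff w ^^ N) (\<lambda>x. 1::real) x = (if N = 0 then 1 else 0)" for w x :: 'a
    by (induction N arbitrary: x) (simp_all add: fdiff_def)
  then show "\<exists>C. \<forall>w x. \<bar>(fdiff w ^^ N) (\<lambda>x::'a. 1::real) x\<bar> \<le> C * norm w ^ N"
    by (intro exI[of _ 1]) simp
qed

lemma fdiff_bounded_prod:
  assumes "\<And>i. i \<in> A \<Longrightarrow> fdiff_bounded (f i)"
  shows "fdiff_bounded (\<lambda>x. \<Prod>i\<in>A. f i x)"
  using assms
  by (induction A rule: infinite_finite_induct) (auto intro: fdiff_bounded_1 fdiff_bounded_mult)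

lemma fdiff_pow_linear:
  assumes "linear L"
  shows "(fdiff w ^^ N) (\<lambda>x. f (L x)) x = (fdiff (L w) ^^ N) f (L x)"
proof (induction N arbitrary: x)
  case (Suc N)
  then show ?case unfolding fdiff_pow_Suc by (simp add: linear_add[OF assms])
qed simp

lemma fdiff_bounded_linear:
  assumes "fdiff_bounded f" "bounded_linear L"
  shows "fdiff_bounded (\<lambda>x. f (L x))"
  unfolding fdiff_bounded_def
proof
  fix N
  obtain C where C: "C > 0" "\<And>w x. \<bar>(fdiff w ^^ N) f x\<bar> \<le> C * norm w ^ N"
    using fdiff_boundedE[OF assms(1)] by (metis order_refl)
  obtain K where K: "\<And>x. norm (L x) \<le> norm x * K"
    using bounded_linear.bounded[OF assms(2)] by blast
  have "\<bar>(fdiff w ^^ N) (\<lambda>x. f (L x)) x\<bar> \<le> (C * K ^ N) * norm w ^ N" for w x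
  proof -
    have "\<bar>(fdiff w ^^ N) (\<lambda>x. f (L x)) x\<bar> \<le> C * norm (L w) ^ N"
      by (simp add: fdiff_pow_linear[OF bounded_linear.linear[OF assms(2)]] C)
    also have "\<dots> \<le> C * (norm w * K) ^ N"
      using C K by (intro mult_left_mono power_mono) auto
    finally show ?thesis by (simp add: power_mult_distrib mult_ac)
  qed
  then show "\<exists>C. \<forall>w x. \<bar>(fdiff w ^^ N) (\<lambda>x. f (L x)) x\<bar> \<le> C * norm w ^ N" by blast
qed

lemma fdiff_bounded_shift:
  assumes "fdiff_bounded f"
  shows "fdiff_bounded (\<lambda>x. f (x + z))"
  using assms unfolding fdiff_bounded_def by (simp add: fdiff_pow_shift) metis

subsection \<open>Smooth bumps\<close>

lemma smooth_bump_deriv: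
  assumes "smooth_bump f"
  shows "((deriv ^^ m) f has_real_derivative (deriv ^^ Suc m) f x) (at x)"
  using assms unfolding smooth_bump_def
  by (simp add: DERIV_deriv_iff_field_differentiable)

lemma smooth_bump_continuous:
  assumes "smooth_bump f"
  shows "continuous_on A ((deriv ^^ m) f)"
  using smooth_bump_deriv[OF assms] 
  by (meson DERIV_continuous continuous_at_imp_continuous_on)

lemma smooth_bump_deriv_eq_0:
  assumes "smooth_bump f" "\<bar>x\<bar> > 2"
  shows "(deriv ^^ m) f x = 0"
  using assms(2)
proof (induction m arbitrary: x)
  case 0
  then have "x \<notin> {-2..2}" by auto
  then show ?case using assms(1) unfolding smooth_bump_def by auto
next
  case (Suc m)
  have op: "open {x::real. \<bar>x\<bar> > 2}"
    by (intro open_Collect_less continuous_intros)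
  have "((deriv ^^ m) f has_real_derivative 0) (at x)"
  proof (rule has_field_derivative_transform_within_open[where f = "\<lambda>x. 0" and S = "{x::real. \<bar>x\<bar> > 2}"])
    show "0 = (deriv ^^ m) f y" if "y \<in> {x. 2 < \<bar>x\<bar>}" for y using Suc.IH[of y] that by simp
  qed (use op Suc.prems in auto)
  then show ?case using DERIV_unique smooth_bump_deriv[OF assms(1)] by blast
qed

lemma smooth_bump_deriv_bounded:
  assumes "smooth_bump f"
  obtains C where "C > 0" "\<And>x. \<bar>(deriv ^^ m) f x\<bar> \<le> C"
proof -
  have "compact ((deriv ^^ m) f ` {-2..2})"
    by (intro compact_continuous_image smooth_bump_continuous assms) auto
  then obtain C where C: "C > 0" "\<And>x. x \<in> {-2..2} \<Longrightarrow> \<bar>(deriv ^^ m) f x\<bar> \<le> C"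
    using compact_imp_bounded bounded_pos by (metis image_eqI real_norm_def)
  have "\<bar>(deriv ^^ m) f x\<bar> \<le> C" for x
    using C smooth_bump_deriv_eq_0[OF assms, of x m]
    by (cases "\<bar>x\<bar> > 2") (auto simp: abs_le_iff not_less)
  then show thesis using that C by blast
qed

lemma smooth_bump_fdiff_bounded:
  assumes "smooth_bump f"
  shows "fdiff_bounded f"
  unfolding fdiff_bounded_def
proof
  fix N
  obtain C where C: "\<And>x. \<bar>(deriv ^^ N) f x\<bar> \<le> C"
    using smooth_bump_deriv_bounded[OF assms] by metis
  have "\<bar>(fdiff w ^^ N) f x\<bar> \<le> C * norm w ^ N" for w x
    using fdiff_pow_le_deriv[of "\<lambda>m. (deriv ^^ m) f", OF smooth_bump_deriv[OF assms] C] by simp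
  then show "\<exists>C. \<forall>w x. \<bar>(fdiff w ^^ N) f x\<bar> \<le> C * norm w ^ N" by blast
qed

lemma smooth_bump_props:
  assumes "smooth_bump f"
  shows "continuous_on A f" "f \<in> borel_measurable borel" "0 \<le> f x" "f x \<le> 1" "\<bar>x\<bar> > 2 \<Longrightarrow> f x = 0"
proof -
  show c: "continuous_on A f" for A using smooth_bump_continuous[OF assms, of A 0] by simp
  show "f \<in> borel_measurable borel" by (rule borel_measurable_continuous_onI[OF c])
  show "0 \<le> f x" "f x \<le> 1" using assms by (auto simp: smooth_bump_def)
  show "f x = 0" if "\<bar>x\<bar> > 2" using smooth_bump_deriv_eq_0[OF assms that, of 0] by simp
qed

lemma smooth_bump_scaled_integrable:
  assumes "smooth_bump f" "\<delta> > 0"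
  shows "integrable lborel (\<lambda>t. f (t / \<delta>))"
proof -
  have "integrable lborel (\<lambda>t. indicator {- 2 * \<delta>..2 * \<delta>} t *\<^sub>R f (t / \<delta>))"
    by (rule borel_integrable_compact)
      (use assms(2) in \<open>auto intro!: continuous_intros
          continuous_on_compose2[OF smooth_bump_props(1)[OF assms(1), of UNIV]]\<close>)
  moreover have "(\<lambda>t. indicator {- 2 * \<delta>..2 * \<delta>} t *\<^sub>R f (t / \<delta>)) = (\<lambda>t. f (t / \<delta>))"
  proof
    fix t
    show "indicator {- 2 * \<delta>..2 * \<delta>} t *\<^sub>R f (t / \<delta>) = f (t / \<delta>)"
    proof (cases "t \<in> {- 2 * \<delta>..2 * \<delta>}")
      case False
      then have "2 < \<bar>t / \<delta>\<bar>" using assms(2) by (auto simp: abs_if field_simps)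
      then show ?thesis using smooth_bump_props(5)[OF assms(1)] False by simp
    qed simp
  qed
  ultimately show ?thesis by (simp only:)
qed

text \<open>The zero set is closed, so vanishing almost everywhere would mean vanishing everywhere,
  whereas a bump is non-zero somewhere.\<close>

lemma smooth_bump_integral_pos:
  assumes "smooth_bump f"
  shows "(LINT t|lborel. f t) > 0"
proof -
  have int: "integrable lborel f" using smooth_bump_scaled_integrable[OF assms, of 1] by simp
  have "(LINT t|lborel. f t) \<noteq> 0"
  proof
    assume "(LINT t|lborel. f t) = 0"
    then have ae: "AE t in lborel. f t = 0"
      using integral_nonneg_eq_0_iff_AE[OF int] smooth_bump_props(3)[OF assms] by auto
    have "closed {t. f t = 0}"
      by (intro closed_Collect_eq continuous_intros smooth_bump_props(1) assms) 
    then have "x \<in> {t. f t = 0}" for x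
      by (rule mem_closed_if_AE_lebesgue) (use ae in \<open>auto intro: AE_completion\<close>)
    then show False using assms unfolding smooth_bump_def by blast
  qed
  moreover have "(LINT t|lborel. f t) \<ge> 0"
    using smooth_bump_props(3)[OF assms] by simp
  ultimately show ?thesis by linarith
qed

lemma smooth_bump_scaled_integral:
  assumes "\<delta> > 0"
  shows "(LINT t|lborel. f (t / \<delta>)) = \<delta> * (LINT t|lborel. f t :: real)"
  using lborel_integral_real_affine[of "inverse \<delta>" f 0] assms by (simp add: field_simps)

subsection \<open>Fourier series of periodic functions\<close>

definition echar :: "real \<Rightarrow> complex" where
  "echar t = cis (2 * pi * t)"

lemma echar_add: "echar (s + t) = echar s * echar t"
  by (simp add: echar_def cis_mult algebra_simps)

lemma echar_diff: "echar (s - t) = echar s * echar (- t)"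
  using echar_add[of s "- t"] by simp

lemma norm_echar [simp]: "cmod (echar t) = 1"
  by (simp add: echar_def)

lemma echar_0 [simp]: "echar 0 = 1"
  by (simp add: echar_def)

lemma echar_of_int [simp]: "echar (of_int m) = 1"
  by (simp add: echar_def)

lemma echar_int_mult [simp]: "echar (of_int m * of_int k) = 1"
  using echar_of_int[of "m * k"] by simp

lemma echar_half: "echar (1 / 2) = - 1" "echar (- 1 / 2) = - 1"
  by (simp_all add: echar_def complex_eq_iff)

lemma continuous_on_echar [continuous_intros]:
  "continuous_on A f \<Longrightarrow> continuous_on A (\<lambda>x. echar (f x))"
  unfolding echar_def by (intro continuous_intros)

lemma measurable_echar [measurable]: "echar \<in> borel_measurable borel"
  by (intro borel_measurable_continuous_onI continuous_intros)

text \<open>A weak form of Jordan's inequality. Up to \<open>pi / 3\<close> the difference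
  \<open>sin x - x / 2\<close> increases since \<open>cos\<close> is at least 1/2; beyond that
  monotonicity of \<open>sin\<close> suffices.\<close>

lemma sin_ge_half:
  assumes "0 \<le> x" "x \<le> pi / 2"
  shows "x / 2 \<le> sin x"
proof (cases "x \<le> pi / 3")
  case True
  have "sin 0 - 0 / 2 \<le> sin x - x / 2"
  proof (rule DERIV_nonneg_imp_nondecreasing[OF assms(1)], intro exI conjI)
    fix t assume t: "0 \<le> t" "t \<le> x"
    show "((\<lambda>t. sin t - t / 2) has_real_derivative cos t - 1 / 2) (at t)"
      by (auto intro!: derivative_eq_intros)
    have "cos (pi / 3) \<le> cos t"
      by (rule cos_monotone_0_pi_le) (use t True pi_gt_zero in auto)
    then show "0 \<le> cos t - 1 / 2" by (simp add: cos_60)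
  qed
  then show ?thesis by simp
next
  case False
  \<comment> \<open>The square of 1.7 is 2.89, so \<open>sin x\<close> is at least 0.85, which beats
    half of the upper bound 1.6 for \<open>pi / 2\<close>.\<close>
  have "sqrt 3 \<ge> sqrt (1.7\<^sup>2)" by (intro real_sqrt_le_mono) (simp add: power2_eq_square)
  then have "sqrt 3 \<ge> 1.7" by simp
  moreover have "sin (pi / 3) \<le> sin x"
    by (rule sin_monotone_2pi_le) (use assms False in auto)
  ultimately have "1.7 \<le> 2 * sin x" by (simp add: sin_60)
  moreover have "x \<le> 1.6" using assms(2) pi_approx(2) by simp
  ultimately show ?thesis by linarith
qed

text \<open>The chord is \<open>2 * \<bar>sin (pi * u)\<bar>\<close> with
  \<open>u = s - of_int m\<close>, and \<open>sin_ge_half\<close> makes it at least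
  \<open>pi * \<bar>u\<bar>\<close>; replacing \<open>pi\<close> by 1 leaves the plain distance to
  an integer.\<close>

lemma echar_minus_1_ge:
  fixes m :: int
  assumes "\<bar>s - of_int m\<bar> \<le> 1 / 2"
  shows "\<bar>s - of_int m\<bar> \<le> cmod (echar s - 1)"
proof -
  define u where "u = s - of_int m"
  have "echar s = echar u" unfolding u_def echar_diff
    using echar_of_int[of "- m"] by (simp del: echar_of_int)
  also have "\<dots> = exp (\<i> * of_real (2 * pi * u))"
    by (simp add: echar_def cis_conv_exp)
  finally have "cmod (echar s - 1) = 2 * \<bar>sin (pi * u)\<bar>"
    using dist_exp_i_1[of "2 * pi * u"] by simp
  also have "\<bar>sin (pi * u)\<bar> = \<bar>sin (pi * \<bar>u\<bar>)\<bar>"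
    by (cases "u \<ge> 0") auto
  also have "2 * \<bar>sin (pi * \<bar>u\<bar>)\<bar> \<ge> pi * \<bar>u\<bar>"
    using sin_ge_half[of "pi * \<bar>u\<bar>"] assms by (simp add: u_def mult.commute)
  finally have "pi * \<bar>u\<bar> \<le> cmod (echar s - 1)" .
  moreover have "1 * \<bar>u\<bar> \<le> pi * \<bar>u\<bar>"
    using pi_gt3 by (intro mult_right_mono) auto
  ultimately show ?thesis by (simp add: u_def)
qed

lemma periodic_int:
  assumes "\<And>t. f (t + 1) = f (t::real)"
  shows "f (t + of_int k) = f t"
proof (induction k rule: int_induct[of _ 0])
  case (step1 i)
  then show ?case using assms[of "t + of_int i"] by (simp add: algebra_simps)
next
  case (step2 i)
  then show ?case using assms[of "t + of_int (i - 1)"] by (simp add: algebra_simps)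
qed simp

text \<open>Cut the window from \<open>h\<close> to \<open>h + 1\<close> at the integer
  \<open>\<lfloor>h\<rfloor> + 1\<close> and move the right piece back by one period; the two pieces
  then fill a window between consecutive integers.\<close>

lemma integral_periodic_shift:
  fixes f :: "real \<Rightarrow> complex"
  assumes [measurable]: "f \<in> borel_measurable borel" and per: "\<And>t. f (t + 1) = f t"
    and bd: "\<And>t. cmod (f t) \<le> C"
  shows "(LINT t|lborel. indicator {0..<1} t *\<^sub>R f (t + h)) = (LINT t|lborel. indicator {0..<1} t *\<^sub>R f t)"
proof -
  let ?I = "\<lambda>a b. LINT t|lborel. indicator {a..<b} t *\<^sub>R f t"
  define k where "k = \<lfloor>h\<rfloor>"
  have k: "of_int k \<le> h" "h < of_int k + 1" unfolding k_def by linarith+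
  have int: "integrable lborel (\<lambda>t. indicator {a..<b} t *\<^sub>R f t)" for a b
  proof (rule integrableI_bounded_set_indicator[where B = C])
    have "bounded {a..<b}" by (rule bounded_subset[OF bounded_closed_interval[of a b]]) auto
    then show "emeasure lborel {a..<b} < \<infinity>" by (rule emeasure_bounded_finite)
  qed (auto simp: bd)
  have shift: "(LINT t|lborel. g t) = (LINT t|lborel. g (s + t))" for g :: "real \<Rightarrow> complex" and s
    using lborel_integral_real_affine[of 1 g s] by simp
  have "(LINT t|lborel. indicator {0..<1} t *\<^sub>R f (t + h))
      = ?I h (h+1)"
    by (subst (2) shift[of _ h]) (auto intro!: Bochner_Integration.integral_cong simp: indicator_def algebra_simps)
  also have "\<dots> = (LINT t|lborel. indicator {h..<of_int k + 1} t *\<^sub>R f t + indicator {of_int k + 1..<h + 1} t *\<^sub>R f t)"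
    by (intro Bochner_Integration.integral_cong) (use k in \<open>auto simp: indicator_def\<close>)
  also have "\<dots> = ?I h (of_int k + 1) + ?I (of_int k + 1) (h + 1)"
    by (intro Bochner_Integration.integral_add int)
  also have "?I (of_int k + 1) (h + 1) = ?I (of_int k) h"
    by (subst shift[of _ 1]) (auto intro!: Bochner_Integration.integral_cong simp: indicator_def per add.commute[of 1])
  also have "?I h (of_int k + 1) + ?I (of_int k) h
      = (LINT t|lborel. indicator {h..<of_int k + 1} t *\<^sub>R f t + indicator {of_int k..<h} t *\<^sub>R f t)"
    by (intro Bochner_Integration.integral_add[symmetric] int)
  also have "\<dots> = ?I (of_int k) (of_int k + 1)"
    by (intro Bochner_Integration.integral_cong) (use k in \<open>auto simp: indicator_def\<close>)
  also have "\<dots> = ?I 0 1"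
    by (subst shift[of _ "of_int k"]) (auto intro!: Bochner_Integration.integral_cong simp: indicator_def periodic_int[of f, OF per] add.commute[of "of_int k"])
  finally show ?thesis .
qed

definition fourier_coeff :: "(real \<Rightarrow> complex) \<Rightarrow> int \<Rightarrow> complex" where
  "fourier_coeff f q = (LINT t|lborel. indicator {0..<1} t *\<^sub>R (f t * echar (- (of_int q * t))))"

text \<open>A shift by half a wavelength changes the sign of the character. Averaging the
  coefficient with its shifted copy thus replaces \<open>f\<close> by half of a difference of
  \<open>f\<close>.\<close>

lemma fourier_coeff_half_shift:
  fixes f :: "real \<Rightarrow> complex"
  assumes [measurable]: "f \<in> borel_measurable borel" and per: "\<And>t. f (t + 1) = f t"
    and bd: "\<And>t. cmod (f t) \<le> C" and "m \<noteq> 0"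
  shows "cmod (fourier_coeff f m)
     \<le> (LINT t|lborel. indicator {0..<1} t *\<^sub>R cmod (f t - f (t + 1 / (2 * of_int m)))) / 2"
proof -
  define h :: real where "h = 1 / (2 * of_int m)"
  define F where "F t = f t * echar (- (of_int m * t))" for t
  have mh: "of_int m * h = 1 / 2" using \<open>m \<noteq> 0\<close> by (simp add: h_def)
  have F[measurable]: "F \<in> borel_measurable borel" unfolding F_def by measurable
  have Fper: "F (t + 1) = F t" for t
  proof -
    have "echar (- (of_int m * (t + 1))) = echar (- (of_int m * t)) * echar (of_int (- m))"
      by (subst echar_add[symmetric]) (simp add: algebra_simps)
    then show ?thesis unfolding F_def by (simp add: per del: of_int_minus)
  qed
  have Fsh: "F (t + h) = - (f (t + h) * echar (- (of_int m * t)))" for t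
  proof -
    have "echar (- (of_int m * (t + h))) = echar (- (of_int m * t)) * echar (- 1 / 2)"
      by (subst echar_add[symmetric]) (simp add: distrib_left mh)
    then show ?thesis unfolding F_def using echar_half(2) by simp
  qed
  have Fbd: "cmod (F t) \<le> C" for t by (simp add: F_def norm_mult bd)
  have int: "integrable lborel (\<lambda>t. indicator {0..<1::real} t *\<^sub>R g t)"
    if [measurable]: "g \<in> borel_measurable borel" and "\<And>t. cmod (g t) \<le> C" for g :: "real \<Rightarrow> complex"
    by (rule integrableI_bounded_set_indicator[where B = C]) (auto simp: that)
  have "2 * fourier_coeff f m = (LINT t|lborel. indicator {0..<1} t *\<^sub>R F t) + (LINT t|lborel. indicator {0..<1} t *\<^sub>R F (t + h))"
    using integral_periodic_shift[of F C h] Fper Fbd F by (simp add: fourier_coeff_def F_def[symmetric])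
  also have "\<dots> = (LINT t|lborel. indicator {0..<1} t *\<^sub>R F t + indicator {0..<1} t *\<^sub>R F (t + h))"
    by (intro Bochner_Integration.integral_add[symmetric] int) (auto simp: Fbd)
  also have "cmod \<dots> \<le> (LINT t|lborel. cmod (indicator {0..<1} t *\<^sub>R F t + indicator {0..<1} t *\<^sub>R F (t + h)))"
    by (rule integral_norm_bound)
  also have "\<dots> = (LINT t|lborel. indicator {0..<1} t *\<^sub>R cmod (f t - f (t + h)))"
  proof (intro Bochner_Integration.integral_cong refl)
    fix t
    have "F t + F (t + h) = (f t - f (t + h)) * echar (- (of_int m * t))"
      unfolding Fsh by (simp add: F_def algebra_simps)
    then have "cmod (F t + F (t + h)) = cmod (f t - f (t + h))" by (simp add: norm_mult)
    then show "cmod (indicator {0..<1} t *\<^sub>R F t + indicator {0..<1} t *\<^sub>R F (t + h)) = indicator {0..<1} t *\<^sub>R cmod (f t - f (t + h))"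
      by (auto simp: indicator_def)
  qed
  finally show ?thesis by (simp add: norm_mult h_def)
qed

text \<open>The half shift bound tends to 0 by dominated convergence as soon as \<open>f\<close> is
  continuous almost everywhere, so no approximation by smooth functions is involved. Countably many
  discontinuities are allowed because the quotient in Chernoff's argument can have them.\<close>

lemma riemann_lebesgue_periodic:
  fixes f :: "real \<Rightarrow> complex" and m :: "nat \<Rightarrow> int"
  assumes [measurable]: "f \<in> borel_measurable borel" and per: "\<And>t. f (t + 1) = f t"
    and bd: "\<And>t. cmod (f t) \<le> C" 
    and cont: "countable {t. \<not> isCont f t}"
    and m: "\<And>n. m n \<noteq> 0" "(\<lambda>n. 1 / (2 * real_of_int (m n))) \<longlonglongrightarrow> 0"
  shows "(\<lambda>n. fourier_coeff f (m n)) \<longlonglongrightarrow> 0"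
proof -
  let ?h = "\<lambda>n. 1 / (2 * real_of_int (m n))"
  have "(\<lambda>n. LINT t|lborel. indicator {0..<1} t *\<^sub>R cmod (f t - f (t + ?h n))) \<longlonglongrightarrow> (LINT t::real|lborel. 0)"
  proof (rule integral_dominated_convergence[where w = "\<lambda>t. indicator {0..<1} t *\<^sub>R (2 * C)"])
    show "integrable lborel (\<lambda>t::real. indicator {0..<1} t *\<^sub>R (2 * C))"
      by (rule integrableI_bounded_set_indicator[where B = "\<bar>2 * C\<bar>"]) auto
    have "AE t in lborel. t \<notin> {t. \<not> isCont f t}"
      by (intro AE_not_in countable_imp_null_set_lborel cont)
    then show "AE t in lborel. (\<lambda>n. indicator {0..<1} t *\<^sub>R cmod (f t - f (t + ?h n))) \<longlonglongrightarrow> 0"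
    proof eventually_elim
      case (elim t)
      have "(\<lambda>n. t + ?h n) \<longlonglongrightarrow> t + 0" by (intro tendsto_intros m)
      then have "(\<lambda>n. f (t + ?h n)) \<longlonglongrightarrow> f t"
        using elim isCont_tendsto_compose[of t f] by simp
      then have "(\<lambda>n. indicator {0..<1} t *\<^sub>R cmod (f t - f (t + ?h n))) \<longlonglongrightarrow> indicator {0..<1} t *\<^sub>R cmod (f t - f t)"
        by (intro tendsto_intros)
      then show ?case by simp
    qed
    show "AE t in lborel. norm (indicator {0..<1} t *\<^sub>R cmod (f t - f (t + ?h n))) \<le> indicator {0..<1} t *\<^sub>R (2 * C)" for n
    proof (rule AE_I2)
      fix t
      have "cmod (f t - f (t + ?h n)) \<le> C + C"
        by (intro order_trans[OF norm_triangle_ineq4] add_mono bd)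
      then show "norm (indicator {0..<1} t *\<^sub>R cmod (f t - f (t + ?h n))) \<le> indicator {0..<1} t *\<^sub>R (2 * C)"
        by (auto simp: indicator_def)
    qed
  qed measurable
  then have lim: "(\<lambda>n. (LINT t|lborel. indicator {0..<1} t *\<^sub>R cmod (f t - f (t + ?h n))) / 2) \<longlonglongrightarrow> 0"
    by (simp add: tendsto_divide_zero)
  show ?thesis
    by (rule Lim_null_comparison[OF _ lim])
      (use fourier_coeff_half_shift[OF assms(1) per bd m(1)] in auto)
qed

lemma sum_int_symmetric_Suc:
  fixes f :: "int \<Rightarrow> 'a::comm_monoid_add"
  shows "(\<Sum>m\<in>{- int (Suc N)..int (Suc N)}. f m) = f (- int (Suc N)) + f (int (Suc N)) + (\<Sum>m\<in>{- int N..int N}. f m)"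
proof -
  have "{- int (Suc N)..int (Suc N)} = insert (- int (Suc N)) (insert (int (Suc N)) {- int N..int N})"
    by auto
  then show ?thesis by (simp add: add.assoc)
qed

text \<open>A constant does not differ from its half shift, so orthogonality of the characters is an
  instance of that bound.\<close>

lemma fourier_coeff_1: "fourier_coeff (\<lambda>t. 1) m = (if m = 0 then 1 else 0)"
proof (cases "m = 0")
  case False
  have "cmod (fourier_coeff (\<lambda>t. 1) m) \<le> 0"
    using fourier_coeff_half_shift[of "\<lambda>t. 1" 1 m] False by simp
  then show ?thesis using False by simp
qed (simp add: fourier_coeff_def)

lemma fourier_coeff_integrable:
  fixes f :: "real \<Rightarrow> complex"
  assumes [measurable]: "f \<in> borel_measurable borel" and "\<And>t. cmod (f t) \<le> C"
  shows "integrable lborel (\<lambda>t. indicator {0..<1} t *\<^sub>R (f t * echar (- (of_int q * t))))"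
  by (rule integrableI_bounded_set_indicator[where B = C]) (auto simp: norm_mult assms)

text \<open>
  Chernoff's argument: dividing \<open>\<phi> - \<phi> t0\<close> by \<open>echar (t - t0) - 1\<close> turns the partial sum of the
  Fourier series at \<open>t0\<close> into a telescoping one.
\<close>

lemma fourier_series_converges:
  fixes \<phi> :: "real \<Rightarrow> real"
  assumes per: "\<And>t. \<phi> (t + 1) = \<phi> t"
    and lip: "\<And>s t. \<bar>s - t\<bar> \<le> 1 / 2 \<Longrightarrow> \<bar>\<phi> s - \<phi> t\<bar> \<le> L * \<bar>s - t\<bar>"
  shows "(\<lambda>N. \<Sum>m\<in>{- int N..int N}. fourier_coeff (\<lambda>t. of_real (\<phi> t)) m * echar (of_int m * t0))
    \<longlonglongrightarrow> of_real (\<phi> t0)"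
proof -
  have "0 \<le> L * \<bar>1 / 2 - 0\<bar>" by (rule order_trans[OF abs_ge_zero lip]) simp
  then have L: "L \<ge> 0" by simp
  have cont: "isCont \<phi> t" for t
    unfolding isCont_def LIM_def
  proof safe
    fix e :: real assume "e > 0"
    define d where "d = min (1/2) (e / (L + 1))"
    have "d > 0" using \<open>e > 0\<close> L by (simp add: d_def)
    moreover have "dist (\<phi> x) (\<phi> t) < e" if "dist x t < d" for x
    proof -
      have "\<bar>\<phi> x - \<phi> t\<bar> \<le> L * \<bar>x - t\<bar>" by (rule lip) (use that in \<open>simp add: d_def dist_real_def\<close>)
      also have "\<dots> \<le> L * (e / (L + 1))" using that L by (intro mult_left_mono) (simp_all add: d_def dist_real_def)
      also have "\<dots> < e" using L \<open>e > 0\<close> by (simp add: field_simps)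
      finally show ?thesis by (simp add: dist_real_def)
    qed
    ultimately show "\<exists>s>0. \<forall>x. x \<noteq> t \<and> dist x t < s \<longrightarrow> dist (\<phi> x) (\<phi> t) < e" by blast
  qed
  have [measurable]: "\<phi> \<in> borel_measurable borel"
    using cont by (intro borel_measurable_continuous_onI continuous_at_imp_continuous_on) auto
  define g where "g t = (of_real (\<phi> t) - of_real (\<phi> t0)) / (echar (t - t0) - 1)" for t
  have [measurable]: "g \<in> borel_measurable borel" unfolding g_def by measurable
  have lip0: "\<bar>\<phi> t - \<phi> t0\<bar> \<le> L * cmod (echar (t - t0) - 1)" for t
  proof -
    define k where "k = round (t - t0)"
    have k: "\<bar>t - t0 - of_int k\<bar> \<le> 1 / 2" using of_int_round_abs_le[of "t - t0"] by (simp add: k_def abs_minus_commute)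
    have "\<bar>\<phi> t - \<phi> t0\<bar> = \<bar>\<phi> t - \<phi> (t0 + of_int k)\<bar>" by (simp add: periodic_int[of \<phi>, OF per])
    also have "\<dots> \<le> L * \<bar>t - t0 - of_int k\<bar>" using lip[of t "t0 + of_int k"] k by (simp add: algebra_simps)
    also have "\<dots> \<le> L * cmod (echar (t - t0) - 1)" by (intro mult_left_mono echar_minus_1_ge k L)
    finally show ?thesis .
  qed
  have gbd: "cmod (g t) \<le> L" for t
  proof (cases "echar (t - t0) = 1")
    case False
    have "cmod (of_real (\<phi> t) - of_real (\<phi> t0)) \<le> L * cmod (echar (t - t0) - 1)"
      using lip0[of t] by (simp flip: of_real_diff)
    then show ?thesis using False by (simp add: g_def norm_divide field_simps)
  qed (simp add: g_def L)
  \<comment> \<open>Where \<open>echar (t - t0) = 1\<close> the quotient \<open>g t\<close> has the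
    default value 0; \<open>lip0\<close> forces \<open>\<phi> t = \<phi> t0\<close> there, so the
    identity holds at those points as well.\<close>
  have geq: "of_real (\<phi> t) - of_real (\<phi> t0) = g t * (echar (t - t0) - 1)" for t
    using lip0[of t] by (cases "echar (t - t0) = 1") (auto simp: g_def)
  have gper: "g (t + 1) = g t" for t
    using echar_add[of "t - t0" 1] echar_of_int[of 1] by (simp add: g_def per) (simp add: algebra_simps)
  \<comment> \<open>Only translates of \<open>t0\<close> by integers can be exceptional: there
    \<open>g\<close> takes the default value, which need not be the limit.\<close>
  have "{t. \<not> isCont g t} \<subseteq> (\<lambda>k::int. t0 + of_int k) ` UNIV"
  proof
    fix t assume "t \<in> {t. \<not> isCont g t}"
    moreover have "isCont g t" if "echar (t - t0) \<noteq> 1"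
    proof -
      have "isCont (\<lambda>t. echar (t - t0)) t"
        using continuous_on_echar[of UNIV "\<lambda>t. t - t0"]
        by (simp add: continuous_on_eq_continuous_at continuous_on_diff continuous_on_id continuous_on_const)
      then show ?thesis unfolding g_def using that cont[of t] by (intro continuous_intros) auto
    qed
    ultimately have "echar (t - t0) = 1" by blast
    then have "t - t0 = of_int (round (t - t0))"
      using echar_minus_1_ge[of "t - t0" "round (t - t0)"] of_int_round_abs_le[of "t - t0"]
      by (simp add: abs_minus_commute)
    then have "t = t0 + of_int (round (t - t0))" by linarith
    then show "t \<in> (\<lambda>k::int. t0 + of_int k) ` UNIV" by blast
  qed
  then have cnt: "countable {t. \<not> isCont g t}" by (rule countable_subset) simp
  \<comment> \<open>The factor \<open>echar (of_int m * t0)\<close> absorbs the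
    \<open>echar (- t0)\<close> in \<open>coeff\<close>, so that the summands become exact
    differences \<open>G (m - 1) - G m\<close>.\<close>
  define G where "G m = echar (of_int m * t0) * fourier_coeff g m" for m
  \<comment> \<open>Expand \<open>\<phi> t = \<phi> t0 + g t * (echar t * echar (- t0) - 1)\<close>:
    multiplication by \<open>echar t\<close> lowers the index of a Fourier coefficient by
    one.\<close>
  have coeff: "fourier_coeff (\<lambda>t. of_real (\<phi> t)) m = of_real (\<phi> t0) * fourier_coeff (\<lambda>t. 1) m
    + echar (- t0) * fourier_coeff g (m - 1) - fourier_coeff g m" for m
  proof -
    let ?one = "\<lambda>t. indicator {0..<1} t *\<^sub>R (1 * echar (- (of_int m * t)))"
    let ?pre = "\<lambda>t. indicator {0..<1} t *\<^sub>R (g t * echar (- (of_int (m - 1) * t)))"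
    let ?cur = "\<lambda>t. indicator {0..<1} t *\<^sub>R (g t * echar (- (of_int m * t)))"
    have "fourier_coeff (\<lambda>t. of_real (\<phi> t)) m = (LINT t|lborel. 
        of_real (\<phi> t0) * ?one t
        + echar (- t0) * ?pre t
        - ?cur t)"
      unfolding fourier_coeff_def
    proof (intro Bochner_Integration.integral_cong refl)
      fix t
      have "echar (- (of_int (m - 1) * t)) = echar t * echar (- (of_int m * t))"
        by (subst echar_add[symmetric]) (simp add: algebra_simps)
      moreover have "of_real (\<phi> t) = of_real (\<phi> t0) + g t * (echar t * echar (- t0) - 1)"
        using geq[of t] by (simp add: echar_diff algebra_simps)
      ultimately have "of_real (\<phi> t) * echar (- (of_int m * t)) = of_real (\<phi> t0) * echar (- (of_int m * t))
        + echar (- t0) * (g t * echar (- (of_int (m - 1) * t))) - g t * echar (- (of_int m * t))"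
        by (simp only:) (simp add: algebra_simps)
      then show "indicator {0..<1} t *\<^sub>R (of_real (\<phi> t) * echar (- (of_int m * t))) =
        of_real (\<phi> t0) * ?one t
        + echar (- t0) * ?pre t
        - ?cur t"
        by (cases "t \<in> {0..<1}") simp_all
    qed
    also have "\<dots> = of_real (\<phi> t0) * fourier_coeff (\<lambda>t. 1) m
    + echar (- t0) * fourier_coeff g (m - 1) - fourier_coeff g m"
    proof -
      have I1: "integrable lborel (\<lambda>t. of_real (\<phi> t0) * ?one t)"
        by (intro integrable_mult_right fourier_coeff_integrable[where C = 1]) auto
      have I2: "integrable lborel (\<lambda>t. echar (- t0) * ?pre t)"
        by (intro integrable_mult_right fourier_coeff_integrable[where C = L] gbd) auto
      have I3: "integrable lborel (\<lambda>t. ?cur t)"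
        by (intro fourier_coeff_integrable[where C = L] gbd) auto
      show ?thesis
        unfolding fourier_coeff_def Bochner_Integration.integral_diff[OF Bochner_Integration.integrable_add[OF I1 I2] I3]
          Bochner_Integration.integral_add[OF I1 I2] integral_mult_right_zero ..
    qed
    finally show ?thesis .
  qed
  have tele: "(\<Sum>m\<in>{- int N..int N}. fourier_coeff (\<lambda>t. of_real (\<phi> t)) m * echar (of_int m * t0))
      = of_real (\<phi> t0) + G (- int N - 1) - G (int N)" for N
  proof -
    have summand: "fourier_coeff (\<lambda>t. of_real (\<phi> t)) m * echar (of_int m * t0)
      = (if m = 0 then of_real (\<phi> t0) else 0) + (G (m - 1) - G m)" for m
    proof -
      have "echar (of_int (m - 1) * t0) = echar (of_int m * t0) * echar (- t0)"
        by (subst echar_add[symmetric]) (simp add: algebra_simps)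
      then show ?thesis unfolding coeff fourier_coeff_1 G_def by (simp add: algebra_simps)
    qed
    have cancel: "a - b + (c - d) + (b - c) = a - d" for a b c d :: complex
      by simp
    have "(\<Sum>m\<in>{- int N..int N}. G (m - 1) - G m) = G (- int (Suc N)) - G (int N)"
    proof (induction N)
      case (Suc N)
      have "- int (Suc N) - 1 = - int (Suc (Suc N))" "int (Suc N) - 1 = int N" by simp_all
      then show ?case unfolding sum_int_symmetric_Suc Suc by (simp only: cancel)
    qed simp
    moreover have "- int (Suc N) = - int N - 1" by simp
    moreover have "(\<Sum>m\<in>{- int N..int N}. if m = 0 then complex_of_real (\<phi> t0) else 0) = of_real (\<phi> t0)"
      by (subst sum.delta) auto
    ultimately show ?thesis unfolding summand sum.distrib by (simp only: add_diff_eq)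
  qed
  have inv0: "(\<lambda>n. 1 / (2 * (real n + 1))) \<longlonglongrightarrow> 0"
    using tendsto_mult_right_zero[OF LIMSEQ_inverse_real_of_nat, of "1/2"]
    by (simp add: field_simps inverse_eq_divide)
  have "(\<lambda>n. 1 / (2 * real_of_int (- int n - 1))) \<longlonglongrightarrow> 0"
    using tendsto_minus[OF inv0] by (simp add: divide_minus_right[symmetric] del: divide_minus_right)
  then have 1: "(\<lambda>n. fourier_coeff g (- int n - 1)) \<longlonglongrightarrow> 0"
    by (intro riemann_lebesgue_periodic[where C = L] gper gbd cnt) auto
  \<comment> \<open>\<open>riemann_lebesgue_periodic\<close> excludes the frequency 0, hence the
    frequencies \<open>n + 1\<close>; the sequence is shifted back afterwards.\<close>
  have "(\<lambda>n. 1 / (2 * real_of_int (int n + 1))) \<longlonglongrightarrow> 0" using inv0 by (simp add: algebra_simps)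
  then have "(\<lambda>n. fourier_coeff g (int n + 1)) \<longlonglongrightarrow> 0"
    by (intro riemann_lebesgue_periodic[where C = L] gper gbd cnt) auto
  then have 2: "(\<lambda>n. fourier_coeff g (int n)) \<longlonglongrightarrow> 0"
    using LIMSEQ_imp_Suc[of "\<lambda>n. fourier_coeff g (int n)" 0] by (simp add: add.commute)
  have G0: "(\<lambda>n. G (m n)) \<longlonglongrightarrow> 0" if "(\<lambda>n. fourier_coeff g (m n)) \<longlonglongrightarrow> 0" for m :: "nat \<Rightarrow> int"
    using that by (subst tendsto_norm_zero_iff[symmetric]) (simp add: G_def norm_mult tendsto_norm_zero)
  have "(\<lambda>N. of_real (\<phi> t0) + G (- int N - 1) - G (int N)) \<longlonglongrightarrow> of_real (\<phi> t0) + 0 - 0"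
    by (intro tendsto_intros G0 1 2)
  then show ?thesis unfolding tele by simp
qed

subsection \<open>Periodization\<close>

text \<open>For functions vanishing off the interval from -1 to 1 this is the full sum over all
  integer translates; restricting the range makes it a finite sum for every
  \<open>f\<close>.\<close>

definition periodize :: "(real \<Rightarrow> 'a::comm_monoid_add) \<Rightarrow> real \<Rightarrow> 'a" where
  "periodize f t = (\<Sum>a | \<bar>t - of_int a\<bar> \<le> 1. f (t - of_int a))"

lemma finite_ints_near: "finite {a::int. \<bar>t - of_int a\<bar> \<le> (r::real)}"
  by (rule finite_subset[of _ "{\<lfloor>t - r\<rfloor>..\<lceil>t + r\<rceil>}"]) (auto, linarith+)

lemma periodize_eq:
  assumes "\<And>t. \<bar>t\<bar> > 1 \<Longrightarrow> f t = 0" "finite A" "\<And>a. \<bar>t - of_int a\<bar> \<le> 1 \<Longrightarrow> a \<in> A"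
  shows "periodize f t = (\<Sum>a\<in>A. f (t - of_int a))"
  unfolding periodize_def using assms by (intro sum.mono_neutral_left) (auto simp: not_le)

lemma periodize_periodic: "periodize f (t + 1) = periodize f t"
  unfolding periodize_def
  by (rule sum.reindex_bij_witness[of _ "\<lambda>a. a + 1" "\<lambda>a. a - 1"]) (auto simp: algebra_simps)

lemma periodize_nonneg: "(\<And>t. f t \<ge> 0) \<Longrightarrow> periodize f t \<ge> (0::real)"
  unfolding periodize_def by (intro sum_nonneg) auto

text \<open>Unfolding: after exchanging sum and integral, a point of the support is counted once for
  every integer that moves it into the window, and a half-open window of length \<open>n\<close>
  receives exactly \<open>n\<close> of them.\<close>

lemma integral_periodize:
  fixes f :: "real \<Rightarrow> 'a::{banach, second_countable_topology}"
  assumes f0: "\<And>t. \<bar>t\<bar> > 1 \<Longrightarrow> f t = 0" and int: "integrable lborel f"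
  shows "(LINT t|lborel. indicator {h..<h + real n} t *\<^sub>R periodize f t) = real n *\<^sub>R (LINT t|lborel. f t)"
proof -
  let ?l = "\<lambda>a t. indicator {h..<h + real n} t *\<^sub>R f (t - of_int a)"
  let ?r = "\<lambda>a t. indicator {h..<h + real n} (t + of_int a) *\<^sub>R f t"
  \<comment> \<open>The margin 2 contains every translate meeting the window and, for
    \<open>\<bar>t\<bar> \<le> 1\<close>, every integer \<open>a\<close> with
    \<open>t + of_int a\<close> in the window.\<close>
  define A where "A = {\<lfloor>h\<rfloor> - 2..\<lceil>h + real n\<rceil> + 2}"
  have intA: "integrable lborel (\<lambda>t. ?r a t)" for a :: int
    by (rule integrable_mult_indicator[of "{h - of_int a..<h - of_int a + real n}" lborel f, OF _ int, THEN Bochner_Integration.integrable_cong[OF refl, THEN iffD1, rotated]])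
      (auto simp: indicator_def algebra_simps)
  have shift: "(LINT t|lborel. g t) = (LINT t|lborel. g (t + s))" 
      "integrable lborel (\<lambda>t. g (t + s)) \<longleftrightarrow> integrable lborel g" for g :: "real \<Rightarrow> 'a" and s
    using lborel_integral_real_affine[of 1 g s] lborel_integrable_real_affine_iff[of 1 g s] by (simp_all add: add.commute)
  have intB: "integrable lborel (\<lambda>t. ?l a t)" for a :: int
    using shift(2)[of "\<lambda>t. ?l a t" "of_int a"] intA[of a] by simp
  have "(LINT t|lborel. indicator {h..<h + real n} t *\<^sub>R periodize f t)
      = (LINT t|lborel. (\<Sum>a\<in>A. ?l a t))"
  proof (intro Bochner_Integration.integral_cong refl)
    fix t
    have "periodize f t = (\<Sum>a\<in>A. f (t - of_int a))" if "t \<in> {h..<h + real n}"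
      using that by (intro periodize_eq f0) (auto simp: A_def, linarith+)
    then show "indicator {h..<h + real n} t *\<^sub>R periodize f t = (\<Sum>a\<in>A. ?l a t)"
      by (auto simp: indicator_def)
  qed
  also have "\<dots> = (\<Sum>a\<in>A. (LINT t|lborel. ?l a t))"
    by (intro Bochner_Integration.integral_sum intB)
  also have "\<dots> = (\<Sum>a\<in>A. (LINT t|lborel. ?r a t))"
  proof (intro sum.cong refl)
    fix a :: int
    show "(LINT t|lborel. ?l a t)
        = (LINT t|lborel. ?r a t)"
      by (subst shift(1)[of _ "of_int a"]) simp
  qed
  also have "\<dots> = (LINT t|lborel. (\<Sum>a\<in>A. ?r a t))"
    by (intro Bochner_Integration.integral_sum[symmetric] intA)
  also have "\<dots> = (LINT t|lborel. real n *\<^sub>R f t)"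
  proof (intro Bochner_Integration.integral_cong refl)
    fix t
    show "(\<Sum>a\<in>A. ?r a t) = real n *\<^sub>R f t"
    proof (cases "\<bar>t\<bar> > 1")
      case False
      have *: "{a\<in>A. t + of_int a \<in> {h..<h + real n}} = {\<lceil>h - t\<rceil>..<\<lceil>h - t\<rceil> + int n}"
        using False by (auto simp: A_def) linarith+
      have "(\<Sum>a\<in>A. indicat_real {h..<h + real n} (t + of_int a)) = (\<Sum>a\<in>A. if t + of_int a \<in> {h..<h + real n} then 1 else 0)"
        by (intro sum.cong) (auto simp: indicator_def)
      also have "\<dots> = real (card {a\<in>A. t + of_int a \<in> {h..<h + real n}})"
        by (subst sum.inter_filter[symmetric]) (auto simp: A_def)
      also have "\<dots> = real n" unfolding * by simp
      finally show ?thesis by (simp flip: scaleR_sum_left)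
    qed (simp add: f0)
  qed
  finally show ?thesis by simp
qed

text \<open>The points \<open>s\<close> and \<open>t\<close> need a common index set: the integers
  within 2 of \<open>s\<close> serve both, and there are at most five of them.\<close>

lemma periodize_lipschitz:
  fixes f :: "real \<Rightarrow> real"
  assumes f0: "\<And>t. \<bar>t\<bar> > 1 \<Longrightarrow> f t = 0" and lip: "\<And>s t. \<bar>f s - f t\<bar> \<le> L * \<bar>s - t\<bar>"
    and "\<bar>s - t\<bar> \<le> 1 / 2"
  shows "\<bar>periodize f s - periodize f t\<bar> \<le> 5 * L * \<bar>s - t\<bar>"
proof -
  define A where "A = {\<lceil>s - 2\<rceil>..\<lfloor>s + 2\<rfloor>}"
  have A: "a \<in> A" if "\<bar>s - of_int a\<bar> \<le> 2" for a
    using that unfolding A_def by simp linarith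
  have fin: "finite A" by (simp add: A_def)
  have near: "\<bar>s - of_int a\<bar> \<le> 2" if "\<bar>t - of_int a\<bar> \<le> 1" for a
    using that assms(3) abs_triangle_ineq[of "s - t" "t - of_int a"] by simp
  have card: "card A \<le> 5" unfolding A_def by simp linarith
  have "periodize f s = (\<Sum>a\<in>A. f (s - of_int a))" "periodize f t = (\<Sum>a\<in>A. f (t - of_int a))"
    using assms(3) near by (auto intro!: periodize_eq f0 A fin)
  then have "\<bar>periodize f s - periodize f t\<bar> = \<bar>\<Sum>a\<in>A. f (s - of_int a) - f (t - of_int a)\<bar>"
    by (simp add: sum_subtractf)
  also have "\<dots> \<le> (\<Sum>a\<in>A. L * \<bar>s - t\<bar>)"
    using lip by (intro order_trans[OF sum_abs] sum_mono) (metis add_diff_cancel_left' diff_add_cancel diff_diff_eq2)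
  also have "\<dots> \<le> 5 * (L * \<bar>s - t\<bar>)"
  proof -
    have "0 \<le> L * \<bar>s - t\<bar>" using lip[of s t] by linarith
    then show ?thesis using card by (simp add: mult_right_mono)
  qed
  finally show ?thesis by simp
qed

text \<open>Three integers around the floor cover the support, and the range of \<open>j\<close> no
  longer varies with \<open>t\<close>. Measurability and the bound 3 are read off from this
  form.\<close>

lemma periodize_floor:
  fixes f :: "real \<Rightarrow> 'a::comm_monoid_add"
  assumes "\<And>t. \<bar>t\<bar> > 1 \<Longrightarrow> f t = 0"
  shows "periodize f t = (\<Sum>j\<in>{-1..1}. f (t - of_int (\<lfloor>t\<rfloor> + j)))"
proof -
  have "periodize f t = (\<Sum>a\<in>{\<lfloor>t\<rfloor> - 1..\<lfloor>t\<rfloor> + 1}. f (t - of_int a))"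
    by (rule periodize_eq[OF assms]) (auto, linarith+)
  also have "\<dots> = (\<Sum>j\<in>{-1..1}. f (t - of_int (\<lfloor>t\<rfloor> + j)))"
    by (rule sum.reindex_bij_witness[of _ "\<lambda>j. \<lfloor>t\<rfloor> + j" "\<lambda>a. a - \<lfloor>t\<rfloor>"]) auto
  finally show ?thesis .
qed

lemma periodize_measurable:
  fixes f :: "real \<Rightarrow> real"
  assumes [measurable]: "f \<in> borel_measurable borel" and "\<And>t. \<bar>t\<bar> > 1 \<Longrightarrow> f t = 0"
  shows "periodize f \<in> borel_measurable borel"
proof -
  have "(\<lambda>t. \<Sum>j\<in>{-1..1::int}. f (t - of_int (\<lfloor>t\<rfloor> + j))) \<in> borel_measurable borel"
    by measurable
  then show ?thesis using periodize_floor[of f, OF assms(2)] by presburger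
qed

lemma periodize_le_3:
  fixes f :: "real \<Rightarrow> real"
  assumes "\<And>t. \<bar>t\<bar> > 1 \<Longrightarrow> f t = 0" "\<And>t. f t \<le> 1"
  shows "periodize f t \<le> 3"
proof -
  have "(\<Sum>j\<in>{-1..1::int}. f (t - of_int (\<lfloor>t\<rfloor> + j))) \<le> (\<Sum>j\<in>{-1..1::int}. 1)"
    by (intro sum_mono assms)
  then show ?thesis by (simp add: periodize_floor[of f, OF assms(1)])
qed

subsection \<open>Trigonometric approximation of periodized bumps\<close>

text \<open>The Fourier transform on the line of the bump at scale \<open>\<delta>\<close>. At
  integers \<open>q\<close> it is a Fourier coefficient of the periodized bump, see
  \<open>fourier_coeff_periodize\<close>.\<close>

definition bump_coeff :: "(real \<Rightarrow> real) \<Rightarrow> real \<Rightarrow> real \<Rightarrow> complex" where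
  "bump_coeff b \<delta> q = (LINT t|lborel. b (t / \<delta>) *\<^sub>R echar (- (q * t)))"

abbreviation periodic_bump :: "(real \<Rightarrow> real) \<Rightarrow> real \<Rightarrow> real \<Rightarrow> real" where
  "periodic_bump b \<delta> \<equiv> periodize (\<lambda>t. b (t / \<delta>))"

text \<open>Integration by parts in difference form: a translation by half a wavelength negates the
  character, so each difference multiplies the transform by -2.\<close>

lemma integral_fdiff_echar:
  fixes f :: "real \<Rightarrow> real"
  assumes "integrable lborel f" "q \<noteq> 0"
  shows "integrable lborel ((fdiff (1 / (2 * q)) ^^ M) f)"
    and "(LINT t|lborel. (fdiff (1 / (2 * q)) ^^ M) f t *\<^sub>R echar (- (q * t)))
      = (- 2) ^ M * (LINT t|lborel. f t *\<^sub>R echar (- (q * t)))"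
proof -
  let ?T = "\<lambda>F :: real \<Rightarrow> real. LINT t|lborel. F t *\<^sub>R echar (- (q * t))"
  define h where "h = 1 / (2 * q)"
  have int_echar: "integrable lborel (\<lambda>t. F t *\<^sub>R echar (- (q * t)))" if "integrable lborel F" for F :: "real \<Rightarrow> real"
  proof (rule Bochner_Integration.integrable_bound[OF that])
    have [measurable]: "F \<in> borel_measurable borel" using that by (simp add: borel_measurable_integrable)
    show "(\<lambda>t. F t *\<^sub>R echar (- (q * t))) \<in> borel_measurable lborel" by measurable
  qed auto
  have int_shift: "integrable lborel (\<lambda>t. F (t + h))" if "integrable lborel F" for F :: "real \<Rightarrow> real"
    using lborel_integrable_real_affine[OF that, of 1 h] by (simp add: add.commute)
  have step: "?T (fdiff h F) = - 2 * ?T F"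
    if F: "integrable lborel F" for F :: "real \<Rightarrow> real"
  proof -
    have "echar (- (q * (t + h))) = - echar (- (q * t))" for t
    proof -
      have "echar (- (q * (t + h))) = echar (- (q * t)) * echar (- 1 / 2)"
        using assms(2) by (subst echar_add[symmetric]) (simp add: h_def algebra_simps)
      then show ?thesis using echar_half(2) by simp
    qed
    then have "?T F = - (LINT t|lborel. F (t + h) *\<^sub>R echar (- (q * t)))"
      using lborel_integral_real_affine[of 1 "\<lambda>t. F t *\<^sub>R echar (- (q * t))" h] by (simp add: add.commute)
    moreover have "?T (fdiff h F)
        = (LINT t|lborel. F (t + h) *\<^sub>R echar (- (q * t))) - ?T F"
      unfolding fdiff_def scaleR_diff_left
      by (intro Bochner_Integration.integral_diff int_echar int_shift F)
    ultimately show ?thesis by simp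
  qed
  have "integrable lborel ((fdiff h ^^ M) f) \<and>
    ?T ((fdiff h ^^ M) f) = (- 2) ^ M * ?T f"
  proof (induction M)
    case (Suc M)
    have "integrable lborel (fdiff h ((fdiff h ^^ M) f))"
      unfolding fdiff_def[of h "(fdiff h ^^ M) f"] using Suc by (intro Bochner_Integration.integrable_diff int_shift) auto
    then show ?case using step[of "(fdiff h ^^ M) f"] Suc by simp
  qed (use assms in simp)
  then show "integrable lborel ((fdiff (1 / (2 * q)) ^^ M) f)"
    "(LINT t|lborel. (fdiff (1 / (2 * q)) ^^ M) f t *\<^sub>R echar (- (q * t)))
      = (- 2) ^ M * ?T f"
    unfolding h_def by auto
qed

lemma scaled_bump_eq_0:
  assumes "smooth_bump b" "0 < \<delta>" "\<delta> \<le> 1 / 2" "\<bar>t\<bar> > 1"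
  shows "b (t / \<delta>) = 0"
proof -
  have "2 * \<delta> < \<bar>t\<bar>" using assms by linarith
  then have "2 < \<bar>t / \<delta>\<bar>" using assms(2) by (simp add: abs_divide field_simps)
  then show ?thesis by (rule smooth_bump_props(5)[OF assms(1)])
qed

text \<open>The \<open>M\<close>-th difference with step \<open>1 / (2 * q)\<close> has size
  \<open>1 / (\<delta> * \<bar>q\<bar>) ^ M\<close> up to constants, because scaling the argument
  divides the step by \<open>\<delta>\<close>. It lives on an interval of length
  \<open>2 + 2 * M\<close>, and both facts are uniform in \<open>\<delta>\<close> and
  \<open>q\<close>.\<close>

lemma bump_coeff_decay:
  assumes "smooth_bump b"
  obtains C where "C > 0" "\<And>\<delta> q. 0 < \<delta> \<Longrightarrow> \<delta> \<le> 1 / 2 \<Longrightarrow> 1 \<le> \<bar>q\<bar> \<Longrightarrow> cmod (bump_coeff b \<delta> q) \<le> C / (\<delta> * \<bar>q\<bar>) ^ M"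
proof -
  obtain C where C: "C > 0" "\<And>w x. \<bar>(fdiff w ^^ M) b x\<bar> \<le> C * \<bar>w\<bar> ^ M"
    using fdiff_boundedE[OF smooth_bump_fdiff_bounded[OF assms], of M] by (metis order_refl real_norm_def)
  have "cmod (bump_coeff b \<delta> q) \<le> C * (2 + 2 * M) / (\<delta> * \<bar>q\<bar>) ^ M"
    if \<delta>: "0 < \<delta>" "\<delta> \<le> 1 / 2" and q: "1 \<le> \<bar>q\<bar>" for \<delta> q
  proof -
    define h where "h = 1 / (2 * q)"
    define f where "f t = b (t / \<delta>)" for t
    define B where "B = C * (\<bar>h\<bar> / \<delta>) ^ M"
    have f: "integrable lborel f" unfolding f_def by (rule smooth_bump_scaled_integrable[OF assms \<delta>(1)])
    have "q \<noteq> 0" using q by auto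
    have h1: "\<bar>h\<bar> \<le> 1" using q by (auto simp: h_def abs_divide divide_simps)
    have bd: "\<bar>(fdiff h ^^ M) f t\<bar> \<le> B" for t
    proof -
      have "linear (\<lambda>t. t / \<delta>)" by (auto intro!: linearI simp: add_divide_distrib)
      then have "(fdiff h ^^ M) f t = (fdiff (h / \<delta>) ^^ M) b (t / \<delta>)"
        unfolding f_def by (rule fdiff_pow_linear)
      then show ?thesis using C(2)[of "h / \<delta>" "t / \<delta>"] \<delta>(1) by (simp add: B_def abs_divide)
    qed
    have zero: "(fdiff h ^^ M) f t = 0" if "\<bar>t\<bar> > 1 + real M" for t
    proof (rule fdiff_pow_eq_0[where K = 1])
      have "real M * \<bar>h\<bar> \<le> real M" using h1 by (simp add: mult_left_le)
      then show "norm t > 1 + real M * norm h" using that by simp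
    qed (simp add: f_def scaled_bump_eq_0[OF assms \<delta>])
    have "2 ^ M * cmod (bump_coeff b \<delta> q) = cmod (LINT t|lborel. (fdiff h ^^ M) f t *\<^sub>R echar (- (q * t)))"
      using integral_fdiff_echar(2)[OF f \<open>q \<noteq> 0\<close>, of M]
      by (simp add: h_def bump_coeff_def f_def norm_mult norm_power)
    also have "\<dots> \<le> (LINT t|lborel. cmod ((fdiff h ^^ M) f t *\<^sub>R echar (- (q * t))))"
      by (rule integral_norm_bound)
    also have "\<dots> \<le> (LINT t|lborel. B * indicator {- (1 + real M)..1 + real M} t)"
    proof (rule integral_mono)
      show "integrable lborel (\<lambda>t. cmod ((fdiff h ^^ M) f t *\<^sub>R echar (- (q * t))))"
        using integral_fdiff_echar(1)[OF f \<open>q \<noteq> 0\<close>, of M] by (simp add: h_def)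
      fix t :: real
      show "cmod ((fdiff h ^^ M) f t *\<^sub>R echar (- (q * t))) \<le> B * indicator {- (1 + real M)..1 + real M} t"
        using bd[of t] zero[of t] by (auto simp: indicator_def not_le abs_le_iff)
    qed auto
    also have "\<dots> = B * (2 + 2 * M)" by simp
    \<comment> \<open>The factor \<open>1 / 2 ^ M\<close> is written as \<open>2 ^ M / 4 ^ M\<close>
      so that \<open>2 ^ M\<close> cancels against the left-hand side; \<open>4 ^ M\<close> is then
      estimated from below by 1.\<close>
    also have "B = 2 ^ M * (C / (\<delta> * \<bar>q\<bar>) ^ M / 4 ^ M)"
    proof -
      have "\<bar>h\<bar> / \<delta> = 2 / ((\<delta> * \<bar>q\<bar>) * 4)" by (simp add: h_def abs_divide abs_mult)
      then show ?thesis unfolding B_def by (simp only: power_divide power_mult_distrib[of _ 4]) simp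
    qed
    also have "2 ^ M * (C / (\<delta> * \<bar>q\<bar>) ^ M / 4 ^ M) * (2 + 2 * M) \<le> 2 ^ M * (C / (\<delta> * \<bar>q\<bar>) ^ M / 1) * (2 + 2 * M)"
    proof -
      have "0 \<le> C / (\<delta> * \<bar>q\<bar>) ^ M" using C \<delta> by simp
      then show ?thesis by (intro mult_left_mono mult_right_mono divide_left_mono) auto
    qed
    finally have "2 ^ M * cmod (bump_coeff b \<delta> q) \<le> 2 ^ M * (C * (2 + 2 * M) / (\<delta> * \<bar>q\<bar>) ^ M)"
      by simp
    then show ?thesis by (rule mult_left_le_imp_le) simp
  qed
  then show thesis using C by (intro that[of "C * (2 + 2 * M)"]) auto
qed

text \<open>The character of an integer frequency has period 1, so multiplying the periodization by
  it is the same as periodizing the product; unfolding then gives an integral over the line.\<close>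

lemma fourier_coeff_periodize:
  assumes "smooth_bump b" "0 < \<delta>" "\<delta> \<le> 1 / 2"
  shows "fourier_coeff (\<lambda>t. of_real (periodic_bump b \<delta> t)) q = bump_coeff b \<delta> (of_int q)"
proof -
  define F where "F t = b (t / \<delta>) *\<^sub>R echar (- (of_int q * t))" for t
  have F0: "F t = 0" if "\<bar>t\<bar> > 1" for t using scaled_bump_eq_0[OF assms that] by (simp add: F_def)
  have int: "integrable lborel F"
  proof (rule Bochner_Integration.integrable_bound[OF smooth_bump_scaled_integrable[OF assms(1,2)]])
    have [measurable]: "b \<in> borel_measurable borel" by (rule smooth_bump_props[OF assms(1)])
    show "F \<in> borel_measurable lborel" unfolding F_def by measurable
  qed (simp add: F_def)
  have "of_real (periodic_bump b \<delta> t) * echar (- (of_int q * t)) = periodize F t" for t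
    unfolding periodize_def F_def of_real_sum sum_distrib_right
  proof (intro sum.cong refl)
    fix a :: int
    have "echar (- (of_int q * (t - of_int a))) = echar (- (of_int q * t)) * echar (of_int q * of_int a)"
      by (subst echar_add[symmetric]) (simp add: algebra_simps)
    then show "complex_of_real (b ((t - of_int a) / \<delta>)) * echar (- (of_int q * t)) =
      b ((t - of_int a) / \<delta>) *\<^sub>R echar (- (of_int q * (t - of_int a)))"
      by (simp add: scaleR_conv_of_real)
  qed
  then have "fourier_coeff (\<lambda>t. of_real (periodic_bump b \<delta> t)) q = (LINT t|lborel. indicator {0..<0 + real 1} t *\<^sub>R periodize F t)"
    by (simp add: fourier_coeff_def)
  also have "\<dots> = bump_coeff b \<delta> (of_int q)"
    by (subst integral_periodize[OF F0 int]) (simp_all add: bump_coeff_def F_def[abs_def])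
  finally show ?thesis .
qed

lemma periodized_bump_lipschitz:
  assumes "smooth_bump b" "0 < \<delta>" "\<delta> \<le> 1 / 2"
  obtains L where "\<And>s t. \<bar>s - t\<bar> \<le> 1 / 2 \<Longrightarrow>
    \<bar>periodic_bump b \<delta> s - periodic_bump b \<delta> t\<bar> \<le> L * \<bar>s - t\<bar>"
proof -
  obtain C where C: "C > 0" "\<And>w x. \<bar>(fdiff w ^^ 1) b x\<bar> \<le> C * \<bar>w\<bar> ^ 1"
    using fdiff_boundedE[OF smooth_bump_fdiff_bounded[OF assms(1)], of 1] by (metis order_refl real_norm_def)
  have "\<bar>b (s / \<delta>) - b (t / \<delta>)\<bar> \<le> C / \<delta> * \<bar>s - t\<bar>" for s t
  proof -
    have "\<bar>s / \<delta> - t / \<delta>\<bar> = \<bar>s - t\<bar> / \<delta>"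
      using assms(2) by (simp add: diff_divide_distrib[symmetric])
    then show ?thesis
      using C(2)[of "s / \<delta> - t / \<delta>" "t / \<delta>"] by (simp add: fdiff_def)
  qed
  then have "\<bar>periodic_bump b \<delta> s - periodic_bump b \<delta> t\<bar> \<le> 5 * (C / \<delta>) * \<bar>s - t\<bar>"
    if "\<bar>s - t\<bar> \<le> 1 / 2" for s t
    using that by (intro periodize_lipschitz scaled_bump_eq_0[OF assms])
  then show thesis by (rule that)
qed

text \<open>The coefficients decay to order \<open>M + 2\<close>: two powers of the frequency pay
  for summing the tail, where \<open>1 / (N + 1)\<^sup>2 \<le> 1 / N - 1 / (N + 1)\<close>
  telescopes, and \<open>M\<close> powers remain as a gain in \<open>Q\<close>. The convergence
  theorem for Fourier series only identifies the limit.\<close>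

lemma periodized_bump_trig_approx:
  assumes "smooth_bump b"
  obtains C where "C > 0" "\<And>\<delta> Q t. 0 < \<delta> \<Longrightarrow> \<delta> \<le> 1 / 2 \<Longrightarrow> Q \<ge> 1 \<Longrightarrow>
     cmod (of_real (periodic_bump b \<delta> t) - (\<Sum>q\<in>{- int Q..int Q}. bump_coeff b \<delta> (of_int q) * echar (of_int q * t)))
     \<le> C / (\<delta> ^ (M + 2) * real Q ^ M)"
proof -
  obtain C where C: "C > 0" "\<And>\<delta> q. 0 < \<delta> \<Longrightarrow> \<delta> \<le> 1 / 2 \<Longrightarrow> 1 \<le> \<bar>q\<bar> \<Longrightarrow> cmod (bump_coeff b \<delta> q) \<le> C / (\<delta> * \<bar>q\<bar>) ^ (M + 2)"
    using bump_coeff_decay[OF assms] by metis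
  have "cmod (of_real (periodic_bump b \<delta> t) - (\<Sum>q\<in>{- int Q..int Q}. bump_coeff b \<delta> (of_int q) * echar (of_int q * t)))
     \<le> (2 * C) / (\<delta> ^ (M + 2) * real Q ^ M)"
    if \<delta>: "0 < \<delta>" "\<delta> \<le> 1 / 2" and Q: "Q \<ge> 1" for \<delta> Q t
  proof -
    define S where "S N = (\<Sum>q\<in>{- int N..int N}. bump_coeff b \<delta> (of_int q) * echar (of_int q * t))" for N
    define D where "D = 2 * C / (\<delta> ^ (M + 2) * real Q ^ M)"
    have D: "D \<ge> 0" using C \<delta> by (auto simp: D_def intro!: divide_nonneg_nonneg)
    have "cmod (S N - S Q) \<le> D * (1 / real Q - 1 / real N)" if "N \<ge> Q" for N
      using that
    proof (induction N rule: dec_induct)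
      case (step N)
      have N: "real N \<ge> 1" using step Q by simp
      have bd: "cmod (bump_coeff b \<delta> q) \<le> C / (\<delta> ^ (M + 2) * (real Q ^ M * (real N + 1)\<^sup>2))"
        if "\<bar>q\<bar> = real N + 1" for q
      proof -
        have "cmod (bump_coeff b \<delta> q) \<le> C / (\<delta> ^ (M + 2) * ((real N + 1) ^ M * (real N + 1)\<^sup>2))"
          using C(2)[OF \<delta>, of q] that by (simp only: power_mult_distrib power_add) (simp add: mult_ac)
        also have "\<dots> \<le> C / (\<delta> ^ (M + 2) * (real Q ^ M * (real N + 1)\<^sup>2))"
          using C \<delta> Q step.hyps
          by (intro divide_left_mono mult_left_mono mult_right_mono power_mono) (auto intro!: mult_pos_pos)
        finally show ?thesis .
      qed
      have "S (Suc N) - S Q = bump_coeff b \<delta> (of_int (- int (Suc N))) * echar (of_int (- int (Suc N)) * t)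
          + bump_coeff b \<delta> (of_int (int (Suc N))) * echar (of_int (int (Suc N)) * t) + (S N - S Q)"
        unfolding S_def sum_int_symmetric_Suc[of _ N] by (simp add: algebra_simps)
      also have "cmod \<dots> \<le> C / (\<delta> ^ (M + 2) * (real Q ^ M * (real N + 1)\<^sup>2)) + C / (\<delta> ^ (M + 2) * (real Q ^ M * (real N + 1)\<^sup>2))
          + D * (1 / real Q - 1 / real N)"
        by (intro order_trans[OF norm_triangle_ineq] add_mono step.IH)
          (simp_all only: norm_mult norm_echar mult_1_right, (rule bd, simp)+)
      also have "\<dots> = D * (1 / (real N + 1)\<^sup>2) + D * (1 / real Q - 1 / real N)"
        by (simp add: D_def)
      also have "\<dots> \<le> D * (1 / real N - 1 / (real N + 1)) + D * (1 / real Q - 1 / real N)"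
      proof -
        have "1 / real N - 1 / (real N + 1) = 1 / (real N * (real N + 1))"
          using N by (simp add: field_simps)
        moreover have "1 / (real N + 1)\<^sup>2 \<le> 1 / (real N * (real N + 1))"
          using N by (intro divide_left_mono) (auto simp: power2_eq_square)
        ultimately show ?thesis using D by (intro add_right_mono mult_left_mono) auto
      qed
      finally show ?case by (simp add: algebra_simps)
    qed simp
    moreover have "D * (1 / real Q - 1 / real N) \<le> D * 1" for N
    proof (intro mult_left_mono D)
      have "1 / real Q \<le> 1" "0 \<le> 1 / real N" using Q by simp_all
      then show "1 / real Q - 1 / real N \<le> 1" by linarith
    qed
    ultimately have le: "cmod (S N - S Q) \<le> D" if "N \<ge> Q" for N
      using that by (metis order_trans mult_1_right)
    obtain L where L: "\<And>s t. \<bar>s - t\<bar> \<le> 1 / 2 \<Longrightarrow>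
        \<bar>periodic_bump b \<delta> s - periodic_bump b \<delta> t\<bar> \<le> L * \<bar>s - t\<bar>"
      using periodized_bump_lipschitz[OF assms \<delta>] by metis
    have "S \<longlonglongrightarrow> of_real (periodic_bump b \<delta> t)"
      unfolding S_def using fourier_series_converges[of "periodic_bump b \<delta>" L t, OF periodize_periodic L]
      by (simp add: fourier_coeff_periodize[OF assms \<delta>])
    then have "(\<lambda>N. cmod (S N - S Q)) \<longlonglongrightarrow> cmod (of_real (periodic_bump b \<delta> t) - S Q)"
      by (intro tendsto_intros)
    then have "cmod (of_real (periodic_bump b \<delta> t) - S Q) \<le> D"
      by (rule LIMSEQ_le_const2) (use le in blast)
    then show ?thesis by (simp add: S_def D_def)
  qed
  then show thesis using C by (intro that[of "2 * C"]) auto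
qed

lemma bump_coeff_0:
  assumes "0 < \<delta>"
  shows "bump_coeff b \<delta> 0 = of_real (\<delta> * (LINT t|lborel. b t))"
  unfolding bump_coeff_def using smooth_bump_scaled_integral[OF assms, of b]
  by (simp add: scaleR_conv_of_real)

lemma bump_coeff_le:
  assumes "smooth_bump b" "0 < \<delta>"
  shows "cmod (bump_coeff b \<delta> q) \<le> \<delta> * (LINT t|lborel. b t)"
proof -
  have "cmod (bump_coeff b \<delta> q) \<le> (LINT t|lborel. cmod (b (t / \<delta>) *\<^sub>R echar (- (q * t))))"
    unfolding bump_coeff_def by (rule integral_norm_bound)
  also have "\<dots> = \<delta> * (LINT t|lborel. b t)"
    using smooth_bump_props(3)[OF assms(1)] by (simp add: smooth_bump_scaled_integral[OF assms(2)])
  finally show ?thesis .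
qed

subsection \<open>Diophantine exponents\<close>

lemma infdist_Ints_le: "infdist (x::real) \<int> \<le> \<bar>x - of_int m\<bar>"
  using infdist_le[of "of_int m" "\<int>" x] by (simp add: dist_real_def)

lemma infdist_Ints_le_half: "infdist (x::real) \<int> \<le> 1 / 2"
  using infdist_Ints_le[of x "round x"] of_int_round_abs_le[of x] by (simp add: abs_minus_commute)

abbreviation max_dist :: "'i set \<Rightarrow> ('i \<Rightarrow> real) \<Rightarrow> nat \<Rightarrow> real" where
  "max_dist I x n \<equiv> Max ((\<lambda>i. infdist (real n * x i) \<int>) ` I)"

lemma simultaneous_exponent_less_imp_finite:
  assumes "simultaneous_exponent I x < ereal w"
  shows "finite {n::nat. n \<ge> 1 \<and> max_dist I x n < real n powr (- w)}"
proof (rule ccontr)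
  assume "\<not> ?thesis"
  then have "ereal w \<le> simultaneous_exponent I x"
    unfolding simultaneous_exponent_def by (intro Sup_upper) blast
  then show False using assms by simp
qed

text \<open>Distances to the integers never exceed 1/2, so for \<open>w \<le> 0\<close> every
  \<open>n\<close> satisfies the inequality and such a \<open>w\<close> is admissible in the
  supremum.\<close>

lemma simultaneous_exponent_less_imp_pos:
  assumes "finite I" "I \<noteq> {}" "simultaneous_exponent I x < ereal w"
  shows "w > 0"
proof (rule ccontr)
  assume w: "\<not> w > 0"
  have "max_dist I x n < real n powr (- w)" if "n \<ge> 1" for n :: nat
  proof -
    have "max_dist I x n \<le> 1 / 2"
      using assms infdist_Ints_le_half by (subst Max_le_iff) auto
    also have "1 / 2 < (1::real)" by simp
    also have "1 \<le> real n powr (- w)" using that w by (intro ge_one_powr_ge_zero) auto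
    finally show ?thesis .
  qed
  then have "{n::nat. n \<ge> 1 \<and> max_dist I x n < real n powr (- w)} = {1..}"
    by auto
  then show False using simultaneous_exponent_less_imp_finite[OF assms(3)] infinite_Ici[of "1::nat"] by simp
qed

text \<open>Beyond finitely many exceptions the bound holds with constant 1, and a minimum over the
  exceptions takes care of the rest. The minimum is positive because a vanishing distance at
  \<open>n\<close> would vanish at all multiples of \<open>n\<close>, making the exceptions
  infinite.\<close>

lemma simultaneous_exponent_less_bound:
  assumes "finite I" "I \<noteq> {}" "simultaneous_exponent I x < ereal w"
  obtains c where "c > 0"
    "\<And>n::nat. n \<ge> 1 \<Longrightarrow> c * real n powr (- w) \<le> max_dist I x n"
proof -
  define D where "D n = max_dist I x n" for n :: nat
  define S where "S = {n::nat. n \<ge> 1 \<and> D n < real n powr (- w)}"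
  have fin: "finite S" unfolding S_def D_def by (rule simultaneous_exponent_less_imp_finite[OF assms(3)])
  have D_ge: "infdist (real n * x i) \<int> \<le> D n" if "i \<in> I" for n i
    unfolding D_def using assms that by (intro Max_ge) auto
  have D_pos: "D n > 0" if "n \<ge> 1" for n
  proof (rule ccontr)
    assume "\<not> D n > 0"
    then have "infdist (real n * x i) \<int> = 0" if "i \<in> I" for i
      using D_ge[OF that, of n] infdist_nonneg[of "real n * x i" "\<int>"] by linarith
    then have int: "real n * x i \<in> \<int>" if "i \<in> I" for i
      using that in_closed_iff_infdist_zero[OF closed_Ints, of "real n * x i"] Ints_0 by blast
    have "k * n \<in> S" if "k \<ge> 1" for k
    proof -
      have "real (k * n) * x i \<in> \<int>" if "i \<in> I" for i
        using Ints_mult[OF Ints_of_nat[of k] int[OF that]] by (simp add: mult.assoc)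
      then have "infdist (real (k * n) * x i) \<int> \<le> 0" if "i \<in> I" for i
        using that by (simp add: infdist_zero)
      then have "D (k * n) \<le> 0" unfolding D_def using assms by (subst Max_le_iff) auto
      moreover have "0 < real (k * n) powr (- w)" using that \<open>n \<ge> 1\<close> by simp
      ultimately have "D (k * n) < real (k * n) powr (- w)" by linarith
      then show ?thesis using that \<open>n \<ge> 1\<close> by (simp add: S_def)
    qed
    then have "(\<lambda>k. k * n) ` {1..} \<subseteq> S" by auto
    moreover have "inj_on (\<lambda>k. k * n) {1..}" using \<open>n \<ge> 1\<close> by (auto simp: inj_on_def)
    ultimately show False
      using fin infinite_Ici[of "1::nat"] by (meson finite_imageD finite_subset)
  qed
  define c where "c = Min (insert 1 ((\<lambda>n. D n / real n powr (- w)) ` S))"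
  have "c > 0" unfolding c_def using fin D_pos by (subst Min_gr_iff) (auto simp: S_def)
  moreover have "c * real n powr (- w) \<le> D n" if "n \<ge> 1" for n
  proof (cases "n \<in> S")
    case True
    then have "c \<le> D n / real n powr (- w)" unfolding c_def using fin by (intro Min_le) auto
    then show ?thesis using that by (simp add: field_simps)
  next
    case False
    have "c \<le> 1" unfolding c_def using fin by (intro Min_le) auto
    then have "c * real n powr (- w) \<le> 1 * real n powr (- w)" by (intro mult_right_mono) auto
    moreover have "real n powr (- w) \<le> D n" using False that by (simp add: S_def not_less)
    ultimately show ?thesis by linarith
  qed
  ultimately show thesis using that unfolding D_def by blast
qed

abbreviation far_from_ints :: "('k \<Rightarrow> real) \<Rightarrow> 'k \<Rightarrow> real \<Rightarrow> real \<Rightarrow> int \<Rightarrow> bool" where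
  "far_from_ints \<alpha> j0 c w q \<equiv>
     \<exists>i. i \<noteq> j0 \<and> (\<forall>m::int. c * \<bar>of_int q\<bar> powr (- w) \<le> \<bar>of_int q * \<alpha> i / \<alpha> j0 - of_int m\<bar>)"

text \<open>Changes the normalisation from coordinate \<open>p\<close> to the pivot
  \<open>j0\<close>. If all \<open>q * \<alpha> i / \<alpha> j0\<close> were very close to integers,
  the integer \<open>N\<close> close to \<open>q / \<alpha> j0\<close> would be a denominator of
  size at most \<open>K * \<bar>q\<bar>\<close> approximating all \<open>\<alpha> i\<close> too
  well.\<close>

lemma exponent_bound_ratio:
  fixes \<alpha> :: "'k::finite \<Rightarrow> real"
  assumes p: "\<alpha> p = 1" and j0: "\<alpha> j0 \<noteq> 0" and I: "I = UNIV - {p}" "I \<noteq> {}"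
    and w: "simultaneous_exponent I \<alpha> < ereal w"
  obtains c where "c > 0"
    "\<And>q::int. q \<noteq> 0 \<Longrightarrow> far_from_ints \<alpha> j0 c w q"
proof -
  have w0: "w > 0" by (rule simultaneous_exponent_less_imp_pos[OF _ I(2) w]) simp
  obtain c0 where c0: "c0 > 0"
    "\<And>n::nat. n \<ge> 1 \<Longrightarrow> c0 * real n powr (- w) \<le> max_dist I \<alpha> n"
    using simultaneous_exponent_less_bound[OF _ I(2) w] by auto
  define A where "A = 1 + (\<Sum>i\<in>UNIV. \<bar>\<alpha> i\<bar>)"
  define K where "K = 1 / \<bar>\<alpha> j0\<bar> + 1"
  have A: "\<bar>\<alpha> i\<bar> + 1 \<le> A" for i
    unfolding A_def using member_le_sum[of i UNIV "\<lambda>i. \<bar>\<alpha> i\<bar>"] by simp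
  have A1: "A \<ge> 1" using A[of j0] by simp
  have K: "K > 0" using j0 by (simp add: K_def add_pos_pos)
  \<comment> \<open>The first bound gives \<open>c * A < 1\<close>, which excludes
    \<open>N = 0\<close>; the second gives \<open>c * A < c0 * K powr (- w)\<close>, which
    contradicts the lower bound at \<open>\<bar>N\<bar>\<close>.\<close>
  define c where "c = min (1 / (2 * A)) (c0 * K powr (- w) / (2 * A))"
  have c: "c > 0" "c * A < 1" "c * A < c0 * K powr (- w)"
  proof -
    show "c > 0" using c0 A1 K by (simp add: c_def)
    have "c * A \<le> 1 / (2 * A) * A" unfolding c_def using A1 by (intro mult_right_mono) auto
    then show "c * A < 1" using A1 by simp
    have "c * A \<le> c0 * K powr (- w) / (2 * A) * A" unfolding c_def using A1 by (intro mult_right_mono) auto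
    also have "\<dots> < c0 * K powr (- w)" using A1 c0 K by simp
    finally show "c * A < c0 * K powr (- w)" .
  qed
  have "far_from_ints \<alpha> j0 c w q"
    if q: "q \<noteq> 0" for q :: int
  proof (rule ccontr)
    assume neg: "\<not> ?thesis"
    define \<eta> where "\<eta> = c * \<bar>of_int q\<bar> powr (- w)"
    have "1 \<le> \<bar>q\<bar>" using q by linarith
    then have q1: "1 \<le> \<bar>real_of_int q\<bar>" by linarith
    have "\<bar>real_of_int q\<bar> powr (- w) \<le> \<bar>real_of_int q\<bar> powr 0" using q1 w0 by (intro powr_mono) auto
    then have \<eta>: "0 < \<eta>" "\<eta> \<le> c" using c q by (auto simp: \<eta>_def)
    \<comment> \<open>For the pivot itself the number is the integer \<open>q\<close>. So the
      approximation is available for all \<open>i\<close>, in particular for \<open>p\<close>,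
      whether or not \<open>p = j0\<close>.\<close>
    have "\<exists>m::int. \<bar>of_int q * \<alpha> i / \<alpha> j0 - of_int m\<bar> < \<eta>" for i
    proof (cases "i = j0")
      case True
      then show ?thesis using j0 \<eta> by (intro exI[of _ q]) simp
    next
      case False
      then show ?thesis using neg by (auto simp: \<eta>_def not_le)
    qed
    then obtain m :: "'k \<Rightarrow> int" where m: "\<And>i. \<bar>of_int q * \<alpha> i / \<alpha> j0 - of_int (m i)\<bar> < \<eta>" by metis
    define N where "N = m p"
    have N: "\<bar>of_int q / \<alpha> j0 - of_int N\<bar> < \<eta>" using m[of p] p by (simp add: N_def)
    have near: "\<bar>of_int N * \<alpha> i - of_int (m i)\<bar> \<le> \<eta> * A" for i
    proof -
      have "of_int N * \<alpha> i - of_int (m i) = (of_int N - of_int q / \<alpha> j0) * \<alpha> i + (of_int q * \<alpha> i / \<alpha> j0 - of_int (m i))"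
        by (simp add: algebra_simps)
      then have "\<bar>of_int N * \<alpha> i - of_int (m i)\<bar> \<le> \<bar>of_int N - of_int q / \<alpha> j0\<bar> * \<bar>\<alpha> i\<bar> + \<bar>of_int q * \<alpha> i / \<alpha> j0 - of_int (m i)\<bar>"
        by (metis abs_mult abs_triangle_ineq)
      also have "\<dots> \<le> \<eta> * \<bar>\<alpha> i\<bar> + \<eta> * 1"
        using N m[of i] by (intro add_mono mult_right_mono) auto
      also have "\<dots> \<le> \<eta> * A" using mult_left_mono[OF A[of i], of \<eta>] \<eta> by (simp add: algebra_simps)
      finally show ?thesis .
    qed
    have "N \<noteq> 0"
    proof
      assume "N = 0"
      then have "\<bar>real_of_int q\<bar> < \<eta> * \<bar>\<alpha> j0\<bar>" using N j0 by (simp add: abs_divide field_simps)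
      also have "\<dots> \<le> c * A" using \<eta> A[of j0] by (intro mult_mono) auto
      finally show False using c q1 by linarith
    qed
    have "\<bar>real_of_int N\<bar> \<le> \<bar>of_int q / \<alpha> j0\<bar> + \<eta>" using N by linarith
    also have "\<bar>of_int q / \<alpha> j0\<bar> = \<bar>real_of_int q\<bar> / \<bar>\<alpha> j0\<bar>" by (rule abs_divide)
    also have "\<eta> \<le> 1"
    proof -
      have "c * 1 \<le> c * A" using c(1) A1 by (intro mult_left_mono) auto
      then show ?thesis using \<eta> c(2) by linarith
    qed
    also have "\<bar>real_of_int q\<bar> / \<bar>\<alpha> j0\<bar> + 1 \<le> K * \<bar>real_of_int q\<bar>"
      using q1 by (simp add: K_def distrib_right)
    finally have NK: "\<bar>real_of_int N\<bar> \<le> K * \<bar>real_of_int q\<bar>" by simp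
    define n where "n = nat \<bar>N\<bar>"
    have n: "n \<ge> 1" "real n = \<bar>real_of_int N\<bar>" using \<open>N \<noteq> 0\<close> by (auto simp: n_def)
    have "infdist (real n * \<alpha> i) \<int> \<le> \<eta> * A" for i
    proof (cases "N \<ge> 0")
      case True
      then show ?thesis using order_trans[OF infdist_Ints_le near[of i]] by (simp add: n)
    next
      case False
      have "infdist (real n * \<alpha> i) \<int> \<le> \<bar>real n * \<alpha> i - of_int (- m i)\<bar>" by (rule infdist_Ints_le)
      also have "\<dots> = \<bar>of_int N * \<alpha> i - of_int (m i)\<bar>" using False by (simp add: n)
      finally show ?thesis using near[of i] by simp
    qed
    then have "max_dist I \<alpha> n \<le> \<eta> * A"
      using I by (subst Max_le_iff) auto
    with c0(2)[OF n(1)] have "c0 * real n powr (- w) \<le> \<eta> * A" by linarith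
    moreover have "(K * \<bar>real_of_int q\<bar>) powr (- w) \<le> real n powr (- w)"
      using NK n w0 by (intro powr_mono2') auto
    then have "c0 * (K powr (- w) * \<bar>real_of_int q\<bar> powr (- w)) \<le> c0 * real n powr (- w)"
      using c0 K by (intro mult_left_mono) (auto simp: powr_mult)
    ultimately have "(c0 * K powr (- w)) * \<bar>real_of_int q\<bar> powr (- w) \<le> (c * A) * \<bar>real_of_int q\<bar> powr (- w)"
      by (simp add: \<eta>_def mult_ac)
    then have "c0 * K powr (- w) \<le> c * A" using q by (simp add: mult_le_cancel_right)
    then show False using c by simp
  qed
  then show thesis using that c by blast
qed

subsection \<open>Invariant measures on hyperplanes\<close>

lemma nn_integral_prod_vec:
  fixes F :: "'k::finite \<Rightarrow> real \<Rightarrow> ennreal"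
  assumes "\<And>i. F i \<in> borel_measurable borel"
  shows "(\<integral>\<^sup>+ x. (\<Prod>i\<in>UNIV. F i (x $ i)) \<partial>(lborel :: (real ^ 'k) measure)) = (\<Prod>i\<in>UNIV. \<integral>\<^sup>+ t. F i t \<partial>lborel)"
proof -
  define e :: "'k \<Rightarrow> real ^ 'k" where "e i = axis i 1" for i
  have inj: "inj e" by (auto simp: e_def inj_def axis_eq_axis)
  have Basis: "Basis = range e" by (auto simp: e_def Basis_vec_def)
  have "(\<integral>\<^sup>+ x. (\<Prod>b\<in>Basis. F (inv e b) (x \<bullet> b)) \<partial>(lborel :: (real ^ 'k) measure)) = (\<Prod>b\<in>Basis. \<integral>\<^sup>+ t. F (inv e b) t \<partial>lborel)"
    by (rule nn_integral_lborel_prod) (use assms in auto)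
  then show ?thesis
    unfolding Basis by (simp add: prod.reindex inj inv_f_f) (simp add: e_def cart_eq_inner_axis)
qed

text \<open>Abstracts the surface measure of a hyperplane with normal \<open>\<alpha>\<close>: the
  analysis sees it only through local finiteness and invariance under translations orthogonal to
  \<open>\<alpha>\<close>, hence needs no parametrization. The pivot \<open>j0\<close> is the
  coordinate solved for in terms of the others.\<close>

locale hyperplane_measure =
  fixes \<mu> :: "(real ^ 'k::finite) measure" and \<alpha> :: "real ^ 'k" and j0 :: 'k
  assumes sets_eq [measurable_cong, simp]: "sets \<mu> = sets borel"
    and finite_cball: "\<And>r. emeasure \<mu> (cball 0 r) < \<infinity>"
    and invariant: "\<And>s. \<alpha> \<bullet> s = 0 \<Longrightarrow> distr \<mu> borel (\<lambda>x. x + s) = \<mu>"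
    and coeff_nonzero: "\<alpha> $ j0 \<noteq> 0"
begin

lemma space_eq [simp]: "space \<mu> = UNIV"
  using sets_eq_imp_space_eq[OF sets_eq] by simp

sublocale sigma_finite_measure \<mu>
proof
  have "(\<Union>n. cball 0 (real n)) = (UNIV :: (real ^ 'k) set)"
    using real_arch_simple by (auto simp: mem_cball_0) 
  then show "\<exists>A. countable A \<and> A \<subseteq> sets \<mu> \<and> \<Union> A = space \<mu> \<and> (\<forall>a\<in>A. emeasure \<mu> a \<noteq> \<infinity>)"
    using finite_cball by (intro exI[of _ "range (\<lambda>n. cball 0 (real n))"]) (auto simp: less_top[symmetric])
qed

text \<open>The displacement along the hyperplane with the prescribed coordinates other than \<open>j0\<close>.\<close>

definition tilt :: "real ^ 'k \<Rightarrow> real ^ 'k" where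
  "tilt s = s - ((\<alpha> \<bullet> s) / \<alpha> $ j0) *\<^sub>R axis j0 1"

abbreviation move :: "nat \<Rightarrow> real ^ 'k \<Rightarrow> real ^ 'k" where
  "move n s \<equiv> (1 / real n) *\<^sub>R tilt s"

lemma tilt_orthogonal: "\<alpha> \<bullet> (c *\<^sub>R tilt s) = 0"
  using coeff_nonzero by (simp add: tilt_def inner_diff_right inner_axis)

lemma tilt_nth: "i \<noteq> j0 \<Longrightarrow> tilt s $ i = s $ i"
  by (simp add: tilt_def axis_def)

lemma tilt_axis_nth: "i \<noteq> j0 \<Longrightarrow> tilt (axis i 1) $ j0 = - (\<alpha> $ i / \<alpha> $ j0)"
  by (simp add: tilt_def inner_axis) (simp add: axis_def)

lemma bounded_linear_tilt: "bounded_linear tilt"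
  unfolding tilt_def[abs_def]
  by (intro bounded_linear_sub bounded_linear_ident bounded_linear_scaleR_const)
    (simp add: divide_inverse bounded_linear_mult_left bounded_linear_inner_right bounded_linear_compose[OF bounded_linear_mult_left])

lemma measurable_tilt [measurable]: "tilt \<in> borel_measurable borel"
  by (intro borel_measurable_continuous_onI linear_continuous_on bounded_linear_tilt)

lemma nn_integral_shift:
  assumes "f \<in> borel_measurable borel" "\<alpha> \<bullet> s = 0"
  shows "(\<integral>\<^sup>+ x. f (x + s) \<partial>\<mu>) = (\<integral>\<^sup>+ x. f x \<partial>\<mu>)"
proof -
  have "(\<integral>\<^sup>+ x. f x \<partial>\<mu>) = (\<integral>\<^sup>+ x. f x \<partial>(distr \<mu> borel (\<lambda>x. x + s)))"
    using invariant[OF assms(2)] by simp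
  also have "\<dots> = (\<integral>\<^sup>+ x. f (x + s) \<partial>\<mu>)" using assms(1) by (subst nn_integral_distr) auto
  finally show ?thesis ..
qed

lemma integral_shift:
  fixes f :: "real ^ 'k \<Rightarrow> complex"
  assumes "f \<in> borel_measurable borel" "\<alpha> \<bullet> s = 0"
  shows "(LINT x|\<mu>. f (x + s)) = (LINT x|\<mu>. f x)"
proof -
  have "(LINT x|\<mu>. f x) = (LINT x|distr \<mu> borel (\<lambda>x. x + s). f x)"
    using invariant[OF assms(2)] by simp
  also have "\<dots> = (LINT x|\<mu>. f (x + s))" using assms(1) by (subst integral_distr) auto
  finally show ?thesis ..
qed

text \<open>\<open>m i\<close> is the mean of \<open>\<psi> i\<close> over every unit window,
  whatever its starting point, as averaging over displacements requires. No smoothness is demanded: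
  the factors modelled by \<open>\<psi>\<close> may have arbitrarily small scales.\<close>

definition periodic_weight :: "('k \<Rightarrow> real \<Rightarrow> real) \<Rightarrow> ('k \<Rightarrow> real) \<Rightarrow> bool" where
  "periodic_weight \<psi> m \<longleftrightarrow> (\<forall>i. \<psi> i \<in> borel_measurable borel \<and> (\<forall>t. 0 \<le> \<psi> i t) \<and> (\<exists>B. \<forall>t. \<psi> i t \<le> B) \<and>
     (\<forall>t. \<psi> i (t + 1) = \<psi> i t) \<and> 0 \<le> m i \<and>
     (\<forall>h. (\<integral>\<^sup>+ t. indicator {0..<1} t * ennreal (\<psi> i (h + t)) \<partial>lborel) = ennreal (m i)))"

definition weight :: "('k \<Rightarrow> real \<Rightarrow> real) \<Rightarrow> nat \<Rightarrow> real ^ 'k \<Rightarrow> real" where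
  "weight \<psi> n x = (\<Prod>i\<in>UNIV - {j0}. \<psi> i (real n * x $ i))"

abbreviation mean :: "('k \<Rightarrow> real) \<Rightarrow> real" where
  "mean m \<equiv> (\<Prod>i\<in>UNIV - {j0}. m i)"

context
  fixes \<psi> m assumes w: "periodic_weight \<psi> m"
begin

lemma weight_measurable [measurable]: "weight \<psi> n \<in> borel_measurable borel"
proof -
  have [measurable]: "\<psi> i \<in> borel_measurable borel" for i using w by (simp add: periodic_weight_def)
  show ?thesis unfolding weight_def[abs_def] by measurable
qed

lemma weight_nonneg: "0 \<le> weight \<psi> n x"
  using w by (auto simp: weight_def periodic_weight_def intro!: prod_nonneg)

lemma weight_bounded: "\<exists>B. \<forall>x. weight \<psi> n x \<le> B"
proof -
  obtain B where B: "\<And>i t. \<psi> i t \<le> B i" using w unfolding periodic_weight_def by metis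
  have "weight \<psi> n x \<le> (\<Prod>i\<in>UNIV - {j0}. B i)" for x
    unfolding weight_def using B w by (intro prod_mono) (auto simp: periodic_weight_def)
  then show ?thesis by blast
qed

lemma mean_nonneg: "0 \<le> mean m"
  using w by (auto simp: periodic_weight_def intro!: prod_nonneg)

text \<open>The displacement raises \<open>n * x $ i\<close> by 1, a period of
  \<open>\<psi> i\<close>; its compensating part moves only the pivot coordinate, which the product
  omits.\<close>

lemma weight_shift_axis:
  assumes "n \<ge> 1" "i \<noteq> j0"
  shows "weight \<psi> n (x + move n (axis i 1)) = weight \<psi> n x"
  unfolding weight_def
proof (intro prod.cong refl)
  fix k assume "k \<in> UNIV - {j0}"
  then have "real n * (x + move n (axis i 1)) $ k = real n * x $ k + (if k = i then 1 else 0)"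
    using assms by (simp add: tilt_nth distrib_left axis_def)
  then show "\<psi> k (real n * (x + move n (axis i 1)) $ k) = \<psi> k (real n * x $ k)"
    using w by (simp add: periodic_weight_def)
qed

text \<open>A product of coordinate indicators, so that integrals over it factor by
  \<open>nn_integral_prod_vec\<close>. All coordinates of \<open>s\<close> are averaged so that
  \<open>lborel\<close> on the same space can be used; the pivot coordinate contributes a factor 1
  to the mean.\<close>

definition cube :: "real ^ 'k \<Rightarrow> ennreal" where
  "cube s = (\<Prod>i\<in>UNIV. indicator {0..<1} (s $ i))"

lemma measurable_cube [measurable]: "cube \<in> borel_measurable borel"
  unfolding cube_def[abs_def] by measurable

abbreviation cell :: "nat \<Rightarrow> real ^ 'k \<Rightarrow> real ^ 'k \<Rightarrow> ennreal" where
  "cell n x s \<equiv> cube s * ennreal (weight \<psi> n (x + (1 / real n) *\<^sub>R s))"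

lemma nn_integral_cube_weight:
  assumes "n \<ge> 1"
  shows "(\<integral>\<^sup>+ s. cell n x s \<partial>lborel) = ennreal (mean m)"
proof -
  have [measurable]: "\<psi> i \<in> borel_measurable borel" for i using w by (simp add: periodic_weight_def)
  define F where "F i t = indicator {0..<1} t * (if i = j0 then 1 else ennreal (\<psi> i (real n * x $ i + t)))" for i t
  have "cell n x s = (\<Prod>i\<in>UNIV. F i (s $ i))" for s
  proof -
    have "ennreal (weight \<psi> n (x + (1 / real n) *\<^sub>R s)) = (\<Prod>i\<in>UNIV - {j0}. ennreal (\<psi> i (real n * x $ i + s $ i)))"
      using w assms by (simp add: weight_def prod_ennreal periodic_weight_def distrib_left)
    also have "\<dots> = (\<Prod>i\<in>UNIV. if i = j0 then 1 else ennreal (\<psi> i (real n * x $ i + s $ i)))"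
      by (simp add: prod.remove[of UNIV j0])
    finally show ?thesis unfolding cube_def F_def prod.distrib by simp
  qed
  moreover have "F i \<in> borel_measurable borel" for i unfolding F_def[abs_def] by measurable
  ultimately have "(\<integral>\<^sup>+ s. cell n x s \<partial>lborel) = (\<Prod>i\<in>UNIV. \<integral>\<^sup>+ t. F i t \<partial>lborel)"
    by (simp add: nn_integral_prod_vec)
  also have "\<dots> = (\<Prod>i\<in>UNIV. if i = j0 then 1 else ennreal (m i))"
    using w by (intro prod.cong) (auto simp: F_def periodic_weight_def)
  also have "\<dots> = ennreal (mean m)"
    using w by (subst prod.remove[of UNIV j0]) (auto simp: prod_ennreal periodic_weight_def)
  finally show ?thesis .
qed

lemma cube_nth: "cube s \<noteq> 0 \<Longrightarrow> 0 \<le> s $ i \<and> s $ i < 1"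
  by (auto simp: cube_def indicator_def split: if_splits)

text \<open>
  Translating by \<open>tilt s / n\<close> and averaging over \<open>s\<close> in the unit cube replaces the weight by its mean,
  since the weight does not depend on the coordinate \<open>j0\<close>.
\<close>

lemma nn_integral_weight_eq:
  assumes [measurable]: "f \<in> borel_measurable borel" and n: "n \<ge> 1"
  shows "(\<integral>\<^sup>+ x. f x * ennreal (weight \<psi> n x) \<partial>\<mu>)
    = (\<integral>\<^sup>+ x. \<integral>\<^sup>+ s. f (x + move n s) * (cell n x s) \<partial>lborel \<partial>\<mu>)"
proof -
  interpret L: sigma_finite_measure "lborel :: (real ^ 'k) measure" by (rule sigma_finite_lborel)
  interpret P: pair_sigma_finite "lborel :: (real ^ 'k) measure" \<mu> ..
  have cube1: "(\<integral>\<^sup>+ s. cube s \<partial>(lborel :: (real ^ 'k) measure)) = 1"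
    unfolding cube_def by (subst nn_integral_prod_vec) auto
  \<comment> \<open>\<open>tilt s\<close> and \<open>s\<close> differ only in the pivot coordinate,
    which the weight does not see.\<close>
  have eq: "weight \<psi> n (x + move n s) = weight \<psi> n (x + (1 / real n) *\<^sub>R s)" for x s
    unfolding weight_def by (intro prod.cong) (auto simp: tilt_nth)
  have "(\<integral>\<^sup>+ x. f x * ennreal (weight \<psi> n x) \<partial>\<mu>)
      = (\<integral>\<^sup>+ s. cube s * (\<integral>\<^sup>+ x. f x * ennreal (weight \<psi> n x) \<partial>\<mu>) \<partial>lborel)"
    by (simp add: nn_integral_multc cube1)
  also have "\<dots> = (\<integral>\<^sup>+ s. \<integral>\<^sup>+ x. f (x + move n s) * (cell n x s) \<partial>\<mu> \<partial>lborel)"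
  proof (intro nn_integral_cong)
    fix s :: "real ^ 'k"
    have "cube s * (\<integral>\<^sup>+ x. f x * ennreal (weight \<psi> n x) \<partial>\<mu>)
        = cube s * (\<integral>\<^sup>+ x. f (x + move n s) * ennreal (weight \<psi> n (x + (1 / real n) *\<^sub>R s)) \<partial>\<mu>)"
      using nn_integral_shift[of "\<lambda>x. f x * ennreal (weight \<psi> n x)" "move n s"] tilt_orthogonal[of "1 / real n" s]
      by (simp add: eq)
    also have "\<dots> = (\<integral>\<^sup>+ x. f (x + move n s) * (cell n x s) \<partial>\<mu>)"
      by (subst nn_integral_cmult[symmetric]) (auto simp: mult_ac)
    finally show "cube s * (\<integral>\<^sup>+ x. f x * ennreal (weight \<psi> n x) \<partial>\<mu>) = \<dots>" .
  qed
  also have "\<dots> = (\<integral>\<^sup>+ x. \<integral>\<^sup>+ s. f (x + move n s) * (cell n x s) \<partial>lborel \<partial>\<mu>)"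
    by (rule P.Fubini'[symmetric]) measurable
  finally show ?thesis .
qed

text \<open>An upper envelope of \<open>f\<close> over all displacements is independent of
  \<open>s\<close>, so the inner average falls on the weight alone and yields its mean.\<close>

lemma nn_integral_weight_le:
  assumes "f \<in> borel_measurable borel" and [measurable]: "F \<in> borel_measurable borel" and n: "n \<ge> 1"
    and le: "\<And>x s. (\<And>i. 0 \<le> s $ i \<and> s $ i < 1) \<Longrightarrow> f (x + move n s) \<le> F x"
  shows "(\<integral>\<^sup>+ x. f x * ennreal (weight \<psi> n x) \<partial>\<mu>) \<le> (\<integral>\<^sup>+ x. F x \<partial>\<mu>) * ennreal (mean m)"
proof -
  have "(\<integral>\<^sup>+ x. f x * ennreal (weight \<psi> n x) \<partial>\<mu>)
    \<le> (\<integral>\<^sup>+ x. \<integral>\<^sup>+ s. F x * (cell n x s) \<partial>lborel \<partial>\<mu>)"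
    unfolding nn_integral_weight_eq[OF assms(1) n]
  proof (intro nn_integral_mono)
    fix x s
    show "f (x + move n s) * (cell n x s)
      \<le> F x * (cell n x s)"
      by (cases "cube s = 0") (auto intro!: mult_right_mono le dest: cube_nth)
  qed
  also have "\<dots> = (\<integral>\<^sup>+ x. F x * ennreal (mean m) \<partial>\<mu>)"
    by (intro nn_integral_cong) (simp add: nn_integral_cmult nn_integral_cube_weight[OF n])
  finally show ?thesis by (simp add: nn_integral_multc)
qed

lemma nn_integral_weight_ge:
  assumes "f \<in> borel_measurable borel" and [measurable]: "F \<in> borel_measurable borel" and n: "n \<ge> 1"
    and le: "\<And>x s. (\<And>i. 0 \<le> s $ i \<and> s $ i < 1) \<Longrightarrow> F x \<le> f (x + move n s)"
  shows "(\<integral>\<^sup>+ x. F x \<partial>\<mu>) * ennreal (mean m) \<le> (\<integral>\<^sup>+ x. f x * ennreal (weight \<psi> n x) \<partial>\<mu>)"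
proof -
  have "(\<integral>\<^sup>+ x. F x \<partial>\<mu>) * ennreal (mean m) = (\<integral>\<^sup>+ x. F x * ennreal (mean m) \<partial>\<mu>)"
    by (simp add: nn_integral_multc)
  also have "\<dots> = (\<integral>\<^sup>+ x. \<integral>\<^sup>+ s. F x * (cell n x s) \<partial>lborel \<partial>\<mu>)"
    by (intro nn_integral_cong) (simp add: nn_integral_cmult nn_integral_cube_weight[OF n])
  also have "\<dots> \<le> (\<integral>\<^sup>+ x. f x * ennreal (weight \<psi> n x) \<partial>\<mu>)"
    unfolding nn_integral_weight_eq[OF assms(1) n]
  proof (intro nn_integral_mono)
    fix x s
    show "F x * (cell n x s)
      \<le> f (x + move n s) * (cell n x s)"
      by (cases "cube s = 0") (auto intro!: mult_right_mono le dest: cube_nth)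
  qed
  finally show ?thesis .
qed

end

end

section \<open>Smooth densities integrated against weights and characters\<close>

locale hyperplane_density = hyperplane_measure \<mu> \<alpha> j0
  for \<mu> :: "(real ^ 'k::finite) measure" and \<alpha> j0 +
  fixes \<rho> :: "real ^ 'k \<Rightarrow> real" and K :: real
  assumes density_measurable [measurable]: "\<rho> \<in> borel_measurable borel"
    and density_nonneg: "\<And>x. 0 \<le> \<rho> x"
    and density_support: "\<And>x. norm x > K \<Longrightarrow> \<rho> x = 0"
    and density_smooth: "fdiff_bounded \<rho>"
    and density_integral: "(LINT x|\<mu>. \<rho> x) = 1"
begin

lemma tilt_bounded: "\<exists>T>0. \<forall>s. (\<forall>i. \<bar>s $ i\<bar> \<le> 1) \<longrightarrow> norm (tilt s) \<le> T"
proof -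
  obtain T where T: "T > 0" "\<And>s. norm (tilt s) \<le> norm s * T"
    using bounded_linear.pos_bounded[OF bounded_linear_tilt] by blast
  have "norm (tilt s) \<le> T * real CARD('k)" if "\<And>i. \<bar>s $ i\<bar> \<le> 1" for s
  proof -
    have "norm s \<le> (\<Sum>i\<in>UNIV. \<bar>s $ i\<bar>)" by (rule norm_le_l1_cart)
    also have "\<dots> \<le> (\<Sum>i\<in>(UNIV :: 'k set). 1)" by (intro sum_mono that)
    finally have "norm s \<le> real CARD('k)" by simp
    then have "norm s * T \<le> real CARD('k) * T" using T by (intro mult_right_mono) auto
    then show ?thesis using T(2)[of s] by (simp add: mult.commute)
  qed
  then show ?thesis using T by (intro exI[of _ "T * real CARD('k)"]) auto
qed

lemma integrable_supported:
  fixes f :: "real ^ 'k \<Rightarrow> 'b::{banach, second_countable_topology}"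
  assumes "f \<in> borel_measurable borel" "\<And>x. norm (f x) \<le> B" "\<And>x. norm x > R \<Longrightarrow> f x = 0"
  shows "integrable \<mu> f"
proof (rule integrableI_bounded_set[where A = "cball 0 R" and B = B])
  show "f \<in> borel_measurable \<mu>" using assms(1) by simp
qed (use assms finite_cball in \<open>auto simp: not_le\<close>)

abbreviation ball_weight :: "real \<Rightarrow> ('k \<Rightarrow> real \<Rightarrow> real) \<Rightarrow> nat \<Rightarrow> ennreal" where
  "ball_weight R \<psi> n \<equiv> \<integral>\<^sup>+ x. indicator (cball 0 R) x * ennreal (weight \<psi> n x) \<partial>\<mu>"

text \<open>The indicator of the ball enlarged by \<open>T\<close> is an envelope for all
  displacements, as these have norm at most \<open>T\<close>. The constant precedes the quantifiers
  over \<open>\<psi>\<close>, \<open>m\<close> and \<open>n\<close>, so the weight enters only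
  through its mean.\<close>

lemma weight_cball_le:
  "\<exists>C>0. \<forall>\<psi> m n. periodic_weight \<psi> m \<longrightarrow> n \<ge> 1 \<longrightarrow>
     ball_weight R \<psi> n \<le> ennreal (C * mean m)"
proof -
  obtain T where T: "T > 0" "\<And>s. (\<forall>i. \<bar>s $ i\<bar> \<le> 1) \<Longrightarrow> norm (tilt s) \<le> T"
    using tilt_bounded by blast
  define V where "V = measure \<mu> (cball 0 (R + T)) + 1"
  have V: "emeasure \<mu> (cball 0 (R + T)) \<le> ennreal V"
    using finite_cball[of "R + T"] by (subst emeasure_eq_ennreal_measure) (auto simp: V_def intro!: ennreal_leI)
  have "ball_weight R \<psi> n \<le> ennreal (V * mean m)"
    if w: "periodic_weight \<psi> m" and n: "n \<ge> 1" for \<psi> m n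
  proof -
    have "ball_weight R \<psi> n
        \<le> (\<integral>\<^sup>+ x. indicator (cball 0 (R + T)) x \<partial>\<mu>) * ennreal (mean m)"
    proof (rule nn_integral_weight_le[OF w _ _ n])
      fix x s :: "real ^ 'k" assume s: "\<And>i. 0 \<le> s $ i \<and> s $ i < 1"
      have "\<bar>s $ i\<bar> \<le> 1" for i using s[of i] by auto
      then have "norm (tilt s) \<le> T" using T(2) by blast
      moreover have "norm (move n s) \<le> norm (tilt s)"
        using n by (simp add: divide_le_eq mult_left_mono[of 1 "real n" "norm (tilt s)", simplified])
      ultimately have "norm x \<le> norm (x + move n s) + T"
        using norm_triangle_ineq4[of "x + move n s" "move n s"] by simp
      then show "indicator (cball 0 R) (x + move n s) \<le> (indicator (cball 0 (R + T)) x :: ennreal)"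
        by (auto simp: indicator_def)
    qed (auto intro!: borel_measurable_indicator)
    also have "\<dots> \<le> ennreal V * ennreal (mean m)" using V by (intro mult_right_mono) auto
    also have "\<dots> = ennreal (V * mean m)" by (simp add: V_def ennreal_mult mean_nonneg[OF w])
    finally show ?thesis .
  qed
  moreover have "V > 0" by (simp add: V_def add_nonneg_pos)
  ultimately show ?thesis by blast
qed

text \<open>Only \<open>f\<close> is replaced by its supremum; the weight is integrated, which
  retains the factor \<open>mean m\<close>.\<close>

lemma weighted_integral_norm_le:
  fixes f :: "real ^ 'k \<Rightarrow> complex"
  assumes w: "periodic_weight \<psi> m" and f [measurable]: "f \<in> borel_measurable borel"
    and A: "\<And>x. cmod (f x) \<le> A" and supp: "\<And>x. norm x > R \<Longrightarrow> f x = 0"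
    and C: "C > 0" "ball_weight R \<psi> n \<le> ennreal (C * mean m)"
  shows "cmod (LINT x|\<mu>. weight \<psi> n x *\<^sub>R f x) \<le> A * C * mean m"
proof -
  note [measurable] = weight_measurable[OF w]
  obtain B where B: "\<And>x. weight \<psi> n x \<le> B" using weight_bounded[OF w, of n] by blast
  have A0: "A \<ge> 0" using A[of 0] norm_ge_zero order_trans by blast
  have "integrable \<mu> (\<lambda>x. weight \<psi> n x *\<^sub>R f x)"
  proof (rule integrable_supported[where B = "B * A" and R = R])
    show "norm (weight \<psi> n x *\<^sub>R f x) \<le> B * A" for x
      using mult_mono[OF B A order_trans[OF weight_nonneg[OF w] B] norm_ge_zero] weight_nonneg[OF w] by simp
  qed (use supp in auto)
  then have "ennreal (cmod (LINT x|\<mu>. weight \<psi> n x *\<^sub>R f x)) \<le> (\<integral>\<^sup>+ x. ennreal (cmod (weight \<psi> n x *\<^sub>R f x)) \<partial>\<mu>)"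
    by (rule integral_norm_bound_ennreal)
  also have "\<dots> \<le> (\<integral>\<^sup>+ x. ennreal A * (indicator (cball 0 R) x * ennreal (weight \<psi> n x)) \<partial>\<mu>)"
  proof (intro nn_integral_mono)
    fix x
    show "ennreal (cmod (weight \<psi> n x *\<^sub>R f x)) \<le> ennreal A * (indicator (cball 0 R) x * ennreal (weight \<psi> n x))"
    proof (cases "norm x > R")
      case False
      have "cmod (weight \<psi> n x *\<^sub>R f x) \<le> A * weight \<psi> n x"
        using mult_right_mono[OF A weight_nonneg[OF w]] weight_nonneg[OF w] by (simp add: mult.commute)
      then show ?thesis using False A0 weight_nonneg[OF w]
        by (simp add: ennreal_mult[symmetric] ennreal_leI)
    qed (simp add: supp)
  qed
  also have "\<dots> = ennreal A * ball_weight R \<psi> n"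
  proof (rule nn_integral_cmult)
    have [measurable]: "cball 0 R \<in> sets (borel :: (real ^ 'k) measure)" by simp
    show "(\<lambda>x. indicator (cball 0 R) x * ennreal (weight \<psi> n x)) \<in> borel_measurable \<mu>" by measurable
  qed
  also have "\<dots> \<le> ennreal A * ennreal (C * mean m)"
    by (intro mult_left_mono C) auto
  also have "\<dots> = ennreal (A * C * mean m)"
    using A0 C mean_nonneg[OF w] by (simp add: ennreal_mult[symmetric] mult_ac)
  finally show ?thesis
    using A0 C mean_nonneg[OF w] by (simp add: ennreal_le_iff mult_nonneg_nonneg)
qed

lemma density_nn_integral: "(\<integral>\<^sup>+ x. ennreal (\<rho> x) \<partial>\<mu>) = 1"
proof -
  \<comment> \<open>A non-integrable function has integral 0 by convention, so the value 1 already
    implies integrability.\<close>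
  have "integrable \<mu> \<rho>" using density_integral not_integrable_integral_eq[of \<mu> \<rho>] by force
  then show ?thesis using density_nonneg density_integral by (simp add: nn_integral_eq_integral)
qed

lemma density_bounded: "\<exists>B. \<forall>x. \<rho> x \<le> B"
proof -
  obtain C where "\<And>w x i. i \<le> 0 \<Longrightarrow> \<bar>(fdiff w ^^ i) \<rho> x\<bar> \<le> C * norm w ^ i"
    using fdiff_boundedE[OF density_smooth, of 0] by metis
  from this[of 0] show ?thesis by (auto simp: abs_le_iff)
qed

lemma density_weight_integrable:
  assumes w: "periodic_weight \<psi> m"
  shows "integrable \<mu> (\<lambda>x. \<rho> x * weight \<psi> n x)"
proof -
  note [measurable] = weight_measurable[OF w]
  obtain B where B: "\<And>x. weight \<psi> n x \<le> B" using weight_bounded[OF w, of n] by blast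
  obtain D where D: "\<And>x. \<rho> x \<le> D" using density_bounded by blast
  show ?thesis
  proof (rule integrable_supported[where B = "D * B" and R = K])
    show "norm (\<rho> x * weight \<psi> n x) \<le> D * B" for x
      using mult_mono[OF D B order_trans[OF density_nonneg D] weight_nonneg[OF w]] weight_nonneg[OF w] density_nonneg by simp
  qed (use density_support in auto)
qed

text \<open>Displacements have norm at most \<open>T / n\<close>, so the Lipschitz density changes
  by at most \<open>\<epsilon> = L * T / n\<close>, and only inside \<open>B\<close>. The envelopes
  obtained by adding and subtracting \<open>\<epsilon> * indicator B\<close> give the two
  bounds.\<close>

lemma density_weight_integral:
  "\<exists>C>0. \<forall>\<psi> m n. periodic_weight \<psi> m \<longrightarrow> n \<ge> 1 \<longrightarrow>
     \<bar>(LINT x|\<mu>. \<rho> x * weight \<psi> n x) - mean m\<bar> \<le> C / real n * mean m"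
proof -
  obtain T where T: "T > 0" "\<And>s. (\<forall>i. \<bar>s $ i\<bar> \<le> 1) \<Longrightarrow> norm (tilt s) \<le> T"
    using tilt_bounded by blast
  obtain L where L: "L > 0" "\<And>w x. \<bar>(fdiff w ^^ 1) \<rho> x\<bar> \<le> L * norm w ^ 1"
    using fdiff_boundedE[OF density_smooth, of 1] by (metis order_refl)
  define V where "V = measure \<mu> (cball 0 (K + T))"
  define C where "C = L * T * V + 1"
  have C: "C > 0" using L T by (simp add: C_def V_def add_nonneg_pos)
  have "\<bar>(LINT x|\<mu>. \<rho> x * weight \<psi> n x) - mean m\<bar> \<le> C / real n * mean m"
    if w: "periodic_weight \<psi> m" and n: "n \<ge> 1" for \<psi> m n
  proof -
    note [measurable] = weight_measurable[OF w]
    define \<epsilon> where "\<epsilon> = L * T / real n"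
    have \<epsilon>: "\<epsilon> > 0" using L T n by (simp add: \<epsilon>_def)
    define B :: "(real ^ 'k) set" where "B = cball 0 (K + T)"
    have emB: "emeasure \<mu> B = ennreal V" unfolding B_def V_def
      using finite_cball[of "K + T"] by (intro emeasure_eq_ennreal_measure) auto
    have [measurable]: "B \<in> sets borel" by (simp add: B_def)
    have close: "\<bar>\<rho> (x + move n s) - \<rho> x\<bar> \<le> \<epsilon> * indicator B x"
      if s: "\<And>i. 0 \<le> s $ i \<and> s $ i < 1" for x s
    proof -
      have "\<bar>s $ i\<bar> \<le> 1" for i using s[of i] by auto
      then have t: "norm (tilt s) \<le> T" using T(2) by blast
      then have tn: "norm (move n s) \<le> T / real n" using n by (simp add: divide_right_mono)
      also have "T / real n \<le> T" using n T by (simp add: divide_le_eq)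
      finally have tT: "norm (move n s) \<le> T" .
      show ?thesis
      proof (cases "x \<in> B")
        case True
        have "\<bar>\<rho> (x + move n s) - \<rho> x\<bar> \<le> L * norm (move n s)"
          using L(2)[of "move n s" x] by (simp add: fdiff_def)
        also have "\<dots> \<le> L * (T / real n)" using L tn by (intro mult_left_mono) auto
        finally show ?thesis using True by (simp add: \<epsilon>_def)
      next
        case False
        then have "norm x > K + T" by (simp add: B_def)
        moreover have "norm x \<le> norm (x + move n s) + T"
          using tT norm_triangle_ineq4[of "x + move n s" "move n s"] by simp
        ultimately have "\<rho> (x + move n s) = 0" "\<rho> x = 0"
          using T by (auto intro!: density_support)
        then show ?thesis using False by simp
      qed
    qed
    define X where "X = (LINT x|\<mu>. \<rho> x * weight \<psi> n x)"
    have X: "(\<integral>\<^sup>+ x. ennreal (\<rho> x) * ennreal (weight \<psi> n x) \<partial>\<mu>) = ennreal X"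
      unfolding X_def using density_weight_integrable[OF w, of n] density_nonneg weight_nonneg[OF w]
      by (simp add: ennreal_mult[symmetric] nn_integral_eq_integral)
    have X0: "X \<ge> 0" unfolding X_def using density_nonneg weight_nonneg[OF w] by simp
    have m0: "mean m \<ge> 0" by (rule mean_nonneg[OF w])
    have V0: "V \<ge> 0" by (simp add: V_def)
    have "ennreal X \<le> (\<integral>\<^sup>+ x. ennreal (\<rho> x) + ennreal \<epsilon> * indicator B x \<partial>\<mu>) * ennreal (mean m)"
      unfolding X[symmetric]
    proof (rule nn_integral_weight_le[OF w _ _ n])
      fix x s :: "real ^ 'k" assume s: "\<And>i. 0 \<le> s $ i \<and> s $ i < 1"
      have "\<rho> (x + move n s) \<le> \<rho> x + \<epsilon> * indicator B x" using close[OF s, of x] by linarith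
      then have "ennreal (\<rho> (x + move n s)) \<le> ennreal (\<rho> x + \<epsilon> * indicator B x)" by (rule ennreal_leI)
      also have "\<dots> = ennreal (\<rho> x) + ennreal \<epsilon> * indicator B x"
        using density_nonneg[of x] \<epsilon> by (auto simp: indicator_def ennreal_plus)
      finally show "ennreal (\<rho> (x + move n s)) \<le> ennreal (\<rho> x) + ennreal \<epsilon> * indicator B x" .
    qed auto
    also have "(\<integral>\<^sup>+ x. ennreal (\<rho> x) + ennreal \<epsilon> * indicator B x \<partial>\<mu>) = ennreal (1 + \<epsilon> * V)"
      using \<epsilon> V0 by (subst nn_integral_add) (auto simp: density_nn_integral nn_integral_cmult emB ennreal_mult ennreal_plus)
    also have "\<dots> * ennreal (mean m) = ennreal ((1 + \<epsilon> * V) * mean m)"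
      using \<epsilon> V0 m0 by (simp add: ennreal_mult)
    finally have up: "X \<le> (1 + \<epsilon> * V) * mean m"
      using \<epsilon> V0 m0 by (subst (asm) ennreal_le_iff) auto
    have "ennreal (mean m) = (\<integral>\<^sup>+ x. ennreal (\<rho> x) \<partial>\<mu>) * ennreal (mean m)" by (simp add: density_nn_integral)
    \<comment> \<open>The lower envelope may be negative and is cut off at 0 by
      \<open>ennreal\<close>; adding \<open>\<epsilon> * indicator B\<close> back still dominates
      \<open>\<rho>\<close>.\<close>
    also have "\<dots> \<le> (\<integral>\<^sup>+ x. ennreal (\<rho> x - \<epsilon> * indicator B x) + ennreal \<epsilon> * indicator B x \<partial>\<mu>) * ennreal (mean m)"
    proof (intro mult_right_mono nn_integral_mono)
      fix x
      have "ennreal (\<rho> x) \<le> ennreal (max 0 (\<rho> x - \<epsilon> * indicator B x) + \<epsilon> * indicator B x)"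
        using \<epsilon> by (intro ennreal_leI) auto
      also have "\<dots> = ennreal (max 0 (\<rho> x - \<epsilon> * indicator B x)) + ennreal (\<epsilon> * indicator B x)"
        using \<epsilon> by (intro ennreal_plus) (auto simp: indicator_def)
      also have "ennreal (max 0 (\<rho> x - \<epsilon> * indicator B x)) = ennreal (\<rho> x - \<epsilon> * indicator B x)"
        by (auto simp: max_def ennreal_neg)
      also have "ennreal (\<epsilon> * indicator B x) = ennreal \<epsilon> * indicator B x" by (auto simp: indicator_def)
      finally show "ennreal (\<rho> x) \<le> ennreal (\<rho> x - \<epsilon> * indicator B x) + ennreal \<epsilon> * indicator B x" .
    qed auto
    also have "\<dots> = (\<integral>\<^sup>+ x. ennreal (\<rho> x - \<epsilon> * indicator B x) \<partial>\<mu>) * ennreal (mean m) + ennreal (\<epsilon> * V * mean m)"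
      using \<epsilon> V0 m0 by (subst nn_integral_add) (auto simp: nn_integral_cmult emB ennreal_mult distrib_right)
    also have "\<dots> \<le> ennreal X + ennreal (\<epsilon> * V * mean m)"
      unfolding X[symmetric]
    proof (intro add_right_mono nn_integral_weight_ge[OF w _ _ n] ennreal_leI)
      fix x s :: "real ^ 'k" assume s: "\<And>i. 0 \<le> s $ i \<and> s $ i < 1"
      show "\<rho> x - \<epsilon> * indicator B x \<le> \<rho> (x + move n s)" using close[OF s, of x] by linarith
    qed auto
    also have "\<dots> = ennreal (X + \<epsilon> * V * mean m)" using X0 \<epsilon> V0 m0 by simp
    finally have low: "mean m \<le> X + \<epsilon> * V * mean m"
      using X0 \<epsilon> V0 m0 by (subst (asm) ennreal_le_iff) auto
    have "\<bar>X - mean m\<bar> \<le> \<epsilon> * V * mean m" using up low by (simp add: abs_le_iff algebra_simps)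
    also have "\<dots> \<le> C / real n * mean m"
      using m0 n by (intro mult_right_mono) (auto simp: \<epsilon>_def C_def divide_right_mono)
    finally show ?thesis unfolding X_def .
  qed
  then show ?thesis using C by blast
qed

definition twisted :: "('k \<Rightarrow> real \<Rightarrow> real) \<Rightarrow> nat \<Rightarrow> real \<Rightarrow> (real ^ 'k \<Rightarrow> real) \<Rightarrow> complex" where
  "twisted \<psi> n \<theta> h = (LINT x|\<mu>. weight \<psi> n x *\<^sub>R (h x *\<^sub>R echar (\<theta> * (real n * x $ j0))))"

lemma twisted_integrable:
  assumes w: "periodic_weight \<psi> m" and [measurable]: "h \<in> borel_measurable borel"
    and "\<And>x. \<bar>h x\<bar> \<le> A" "\<And>x. norm x > R \<Longrightarrow> h x = 0"
  shows "integrable \<mu> (\<lambda>x. weight \<psi> n x *\<^sub>R (h x *\<^sub>R echar (\<theta> * (real n * x $ j0))))"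
proof -
  note [measurable] = weight_measurable[OF w]
  obtain B where B: "\<And>x. weight \<psi> n x \<le> B" using weight_bounded[OF w, of n] by blast
  show ?thesis
  proof (rule integrable_supported[where B = "B * A" and R = R])
    show "norm (weight \<psi> n x *\<^sub>R (h x *\<^sub>R echar (\<theta> * (real n * x $ j0)))) \<le> B * A" for x
      using mult_mono[OF B assms(3)[of x] order_trans[OF weight_nonneg[OF w] B] abs_ge_zero] weight_nonneg[OF w] by (simp add: abs_mult)
  qed (use assms in auto)
qed

text \<open>
  The translation by \<open>tilt (axis i 1) / n\<close> preserves the weight and rotates the twist; this is
  summation by parts in disguise.
\<close>

lemma twisted_fdiff:
  assumes w: "periodic_weight \<psi> m" and h[measurable]: "h \<in> borel_measurable borel"
    and bd: "\<And>x. \<bar>h x\<bar> \<le> A" and supp: "\<And>x. norm x > R \<Longrightarrow> h x = 0" and n: "n \<ge> 1" and i: "i \<noteq> j0"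
  shows "twisted \<psi> n \<theta> (fdiff (move n (axis i 1)) h)
    = (echar (\<theta> * \<alpha> $ i / \<alpha> $ j0) - 1) * twisted \<psi> n \<theta> h"
proof -
  note [measurable] = weight_measurable[OF w]
  define \<tau> where "\<tau> = move n (axis i 1)"
  define E where "E = echar (\<theta> * \<alpha> $ i / \<alpha> $ j0)"
  define F where "F x = weight \<psi> n x *\<^sub>R (h x *\<^sub>R echar (\<theta> * (real n * x $ j0)))" for x
  have [measurable]: "F \<in> borel_measurable borel" unfolding F_def by measurable
  have F: "E * F (x + \<tau>) = weight \<psi> n x *\<^sub>R (h (x + \<tau>) *\<^sub>R echar (\<theta> * (real n * x $ j0)))" for x
  proof -
    \<comment> \<open>The compensation in the pivot coordinate is the source of the phase
      \<open>\<theta> * \<alpha> $ i / \<alpha> $ j0\<close>.\<close>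
    have "real n * (x + \<tau>) $ j0 = real n * x $ j0 - \<alpha> $ i / \<alpha> $ j0"
      using n i by (simp add: \<tau>_def tilt_axis_nth algebra_simps)
    then have "\<theta> * (real n * (x + \<tau>) $ j0) + \<theta> * \<alpha> $ i / \<alpha> $ j0 = \<theta> * (real n * x $ j0)"
      by (simp only:) (simp add: right_diff_distrib)
    then have "echar (\<theta> * (real n * (x + \<tau>) $ j0)) * E = echar (\<theta> * (real n * x $ j0))"
      unfolding E_def echar_add[symmetric] by (simp only:)
    moreover have "weight \<psi> n (x + \<tau>) = weight \<psi> n x" unfolding \<tau>_def by (rule weight_shift_axis[OF w n i])
    ultimately show ?thesis by (simp add: F_def scaleR_conv_of_real mult_ac)
  qed
  have supp': "h (x + \<tau>) = 0" if "norm x > R + norm \<tau>" for x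
  proof (rule supp)
    show "norm (x + \<tau>) > R" using that norm_triangle_ineq4[of "x + \<tau>" \<tau>] by simp
  qed
  have int: "integrable \<mu> F" unfolding F_def by (rule twisted_integrable[OF w h bd supp])
  have int': "integrable \<mu> (\<lambda>x. E * F (x + \<tau>))"
    unfolding F by (rule twisted_integrable[OF w _ _ supp', where A = A]) (auto simp: bd)
  have "twisted \<psi> n \<theta> (fdiff \<tau> h) = (LINT x|\<mu>. E * F (x + \<tau>) - F x)"
    unfolding twisted_def F by (simp add: F_def fdiff_def scaleR_diff_left scaleR_diff_right)
  also have "\<dots> = (LINT x|\<mu>. E * F (x + \<tau>)) - (LINT x|\<mu>. F x)"
    by (rule Bochner_Integration.integral_diff[OF int' int])
  also have "(LINT x|\<mu>. E * F (x + \<tau>)) = E * (LINT x|\<mu>. F x)"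
    using integral_shift[of F \<tau>] tilt_orthogonal[of "1 / real n" "axis i 1"] by (simp add: \<tau>_def)
  finally show ?thesis by (simp add: \<tau>_def E_def twisted_def F_def algebra_simps)
qed

text \<open>Each of the \<open>N\<close> differences of the density gains a factor
  \<open>T / n\<close> in size and, by \<open>twisted_fdiff\<close>, multiplies the twisted integral
  by the character value minus 1. Supports grow by at most \<open>N * T\<close> in all, so one ball
  serves every step. The factor stays on the left-hand side because it may vanish.\<close>

lemma twisted_density_decay:
  "\<exists>C>0. \<forall>\<psi> m n i \<theta>. periodic_weight \<psi> m \<longrightarrow> n \<ge> 1 \<longrightarrow> i \<noteq> j0 \<longrightarrow>
     cmod (echar (\<theta> * \<alpha> $ i / \<alpha> $ j0) - 1) ^ N * cmod (twisted \<psi> n \<theta> \<rho>) \<le> C / real n ^ N * mean m"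
proof -
  obtain T where T: "T > 0" "\<And>s. (\<forall>i. \<bar>s $ i\<bar> \<le> 1) \<Longrightarrow> norm (tilt s) \<le> T"
    using tilt_bounded by blast
  obtain D where D: "D > 0" "\<And>w x j. j \<le> N \<Longrightarrow> \<bar>(fdiff w ^^ j) \<rho> x\<bar> \<le> D * norm w ^ j"
    using fdiff_boundedE[OF density_smooth, of N] by metis
  obtain C where C: "C > 0" "\<And>\<psi> m n. periodic_weight \<psi> m \<Longrightarrow> n \<ge> 1 \<Longrightarrow>
     ball_weight (K + real N * T) \<psi> n \<le> ennreal (C * mean m)"
    using weight_cball_le[of "K + real N * T"] by blast
  have "cmod (echar (\<theta> * \<alpha> $ i / \<alpha> $ j0) - 1) ^ N * cmod (twisted \<psi> n \<theta> \<rho>) \<le> (D * T ^ N * C) / real n ^ N * mean m"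
    if w: "periodic_weight \<psi> m" and n: "n \<ge> 1" and i: "i \<noteq> j0" for \<psi> m n i \<theta>
  proof -
    define \<tau> where "\<tau> = move n (axis i 1)"
    have "norm (tilt (axis i 1)) \<le> T" by (rule T(2)) (auto simp: axis_def)
    then have \<tau>n: "norm \<tau> \<le> T / real n" using n by (simp add: \<tau>_def divide_right_mono)
    also have "T / real n \<le> T" using n T by (simp add: divide_le_eq)
    finally have \<tau>T: "norm \<tau> \<le> T" .
    have meas: "(fdiff \<tau> ^^ j) \<rho> \<in> borel_measurable borel" for j
    proof (induction j)
      case (Suc j)
      have "(\<lambda>x. (fdiff \<tau> ^^ j) \<rho> (x + \<tau>) - (fdiff \<tau> ^^ j) \<rho> x) \<in> borel_measurable borel"
        using Suc by measurable
      then show ?case by (simp add: fdiff_def[abs_def])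
    qed simp
    have supp: "(fdiff \<tau> ^^ j) \<rho> x = 0" if "j \<le> N" "norm x > K + real N * T" for j x
    proof (rule fdiff_pow_eq_0[where K = K])
      have "real j * norm \<tau> \<le> real N * T" using that \<tau>T by (intro mult_mono) auto
      then show "norm x > K + real j * norm \<tau>" using that by simp
    qed (rule density_support)
    have pow: "twisted \<psi> n \<theta> ((fdiff \<tau> ^^ j) \<rho>) = (echar (\<theta> * \<alpha> $ i / \<alpha> $ j0) - 1) ^ j * twisted \<psi> n \<theta> \<rho>"
      if "j \<le> N" for j
      using that
    proof (induction j)
      case (Suc j)
      have "twisted \<psi> n \<theta> (fdiff \<tau> ((fdiff \<tau> ^^ j) \<rho>)) = (echar (\<theta> * \<alpha> $ i / \<alpha> $ j0) - 1) * twisted \<psi> n \<theta> ((fdiff \<tau> ^^ j) \<rho>)"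
        unfolding \<tau>_def
        by (rule twisted_fdiff[OF w meas[unfolded \<tau>_def] D(2)[of j] supp[unfolded \<tau>_def] n i]) (use Suc.prems in auto)
      then show ?case using Suc by simp
    qed simp
    have "cmod (twisted \<psi> n \<theta> ((fdiff \<tau> ^^ N) \<rho>)) \<le> (D * (T / real n) ^ N) * C * mean m"
      unfolding twisted_def
    proof (rule weighted_integral_norm_le[OF w _ _ _ C(1) C(2)[OF w n]])
      fix x
      have "\<bar>(fdiff \<tau> ^^ N) \<rho> x\<bar> \<le> D * norm \<tau> ^ N" by (rule D(2)) simp
      also have "\<dots> \<le> D * (T / real n) ^ N" using D \<tau>n by (intro mult_left_mono power_mono) auto
      finally show "cmod ((fdiff \<tau> ^^ N) \<rho> x *\<^sub>R echar (\<theta> * (real n * x $ j0))) \<le> D * (T / real n) ^ N" by simp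
    next
      show "(\<lambda>x. (fdiff \<tau> ^^ N) \<rho> x *\<^sub>R echar (\<theta> * (real n * x $ j0))) \<in> borel_measurable borel"
        using meas[of N] by measurable
    qed (use supp in auto)
    then show ?thesis unfolding pow[OF order_refl] by (simp add: norm_mult norm_power power_divide mult_ac)
  qed
  then show ?thesis using C D T by (intro exI[of _ "D * T ^ N * C"]) auto
qed

end

section \<open>Fourier expansion in the pivot coordinate\<close>

context hyperplane_density
begin

lemma integral_trig_polynomial:
  assumes w: "periodic_weight \<psi> m" and "finite S"
  shows "integrable \<mu> (\<lambda>x. (\<rho> x * weight \<psi> n x) *\<^sub>R (\<Sum>q\<in>S. c q * echar (of_int q * (real n * x $ j0 - y))))"
    and "(LINT x|\<mu>. (\<rho> x * weight \<psi> n x) *\<^sub>R (\<Sum>q\<in>S. c q * echar (of_int q * (real n * x $ j0 - y))))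
      = (\<Sum>q\<in>S. c q * echar (- (of_int q * y)) * twisted \<psi> n (of_int q) \<rho>)"
proof -
  obtain D where D: "\<And>x. \<rho> x \<le> D" using density_bounded by blast
  have int: "integrable \<mu> (\<lambda>x. weight \<psi> n x *\<^sub>R (\<rho> x *\<^sub>R echar (of_int q * (real n * x $ j0))))" for q :: int
    by (rule twisted_integrable[OF w, where A = D and R = K]) (use D density_nonneg density_support in auto)
  have eq: "(\<rho> x * weight \<psi> n x) *\<^sub>R (\<Sum>q\<in>S. c q * echar (of_int q * (real n * x $ j0 - y)))
    = (\<Sum>q\<in>S. (c q * echar (- (of_int q * y))) * (weight \<psi> n x *\<^sub>R (\<rho> x *\<^sub>R echar (of_int q * (real n * x $ j0)))))" for x
    unfolding scaleR_sum_right
  proof (intro sum.cong refl)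
    fix q :: int
    have "echar (of_int q * (real n * x $ j0 - y)) = echar (of_int q * (real n * x $ j0)) * echar (- (of_int q * y))"
      by (subst echar_add[symmetric]) (simp add: algebra_simps)
    then show "(\<rho> x * weight \<psi> n x) *\<^sub>R (c q * echar (of_int q * (real n * x $ j0 - y))) =
      c q * echar (- (of_int q * y)) * (weight \<psi> n x *\<^sub>R (\<rho> x *\<^sub>R echar (of_int q * (real n * x $ j0))))"
      by (simp add: scaleR_conv_of_real)
  qed
  show "integrable \<mu> (\<lambda>x. (\<rho> x * weight \<psi> n x) *\<^sub>R (\<Sum>q\<in>S. c q * echar (of_int q * (real n * x $ j0 - y))))"
    unfolding eq by (intro Bochner_Integration.integrable_sum integrable_mult_right int)
  show "(LINT x|\<mu>. (\<rho> x * weight \<psi> n x) *\<^sub>R (\<Sum>q\<in>S. c q * echar (of_int q * (real n * x $ j0 - y))))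
      = (\<Sum>q\<in>S. c q * echar (- (of_int q * y)) * twisted \<psi> n (of_int q) \<rho>)"
    unfolding eq
    by (subst Bochner_Integration.integral_sum) (intro integrable_mult_right int, simp only: twisted_def integral_mult_right_zero)
qed

lemma twisted_density_0: 
  assumes "periodic_weight \<psi> m"
  shows "twisted \<psi> n 0 \<rho> = of_real (LINT x|\<mu>. \<rho> x * weight \<psi> n x)"
  by (simp add: twisted_def scaleR_conv_of_real mult.commute flip: of_real_mult)

lemma bump_count_estimate:
  assumes b: "smooth_bump b" and w: "0 < w" "w < \<sigma>" and "c1 > 0" "c2 > 0"
    and dioph: "\<And>q::int. q \<noteq> 0 \<Longrightarrow>
      far_from_ints (($) \<alpha>) j0 c1 w q"
  shows "\<exists>C>0. \<forall>\<psi> m n y \<delta>. periodic_weight \<psi> m \<longrightarrow> n \<ge> 1 \<longrightarrow> 0 < \<delta> \<longrightarrow> \<delta> \<le> 1 / 2 \<longrightarrow> c2 * real n powr (- 1 / \<sigma>) \<le> \<delta> \<longrightarrow>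
    \<bar>(LINT x|\<mu>. \<rho> x * weight \<psi> n x * periodic_bump b \<delta> (real n * x $ j0 - y))
      - \<delta> * (LINT t|lborel. b t) * mean m\<bar> \<le> C / real n * (\<delta> * (LINT t|lborel. b t) * mean m)"
proof -
  define B where "B = (LINT t|lborel. b t)"
  have B: "B > 0" unfolding B_def by (rule smooth_bump_integral_pos[OF b])
  have \<sigma>: "\<sigma> > 0" using w by simp
  have "1 / \<sigma> < 1 / w" using w by (simp add: frac_less2)
  then obtain \<kappa> where \<kappa>: "1 / \<sigma> < \<kappa>" "\<kappa> < 1 / w" using dense by blast
  have \<kappa>0: "\<kappa> > 0" using \<kappa>(1) \<sigma> by (meson divide_pos_pos less_trans zero_less_one)
  have \<kappa>w: "\<kappa> * w < 1" using \<kappa>(2) w by (simp add: field_simps)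
  \<comment> \<open>There are at most \<open>2 * n powr \<kappa>\<close> non-zero frequencies, each
    contributing about \<open>n powr ((\<kappa> * w - 1) * N)\<close> relative to the main term;
    this \<open>N\<close> brings the total down to \<open>1 / n\<close>.\<close>
  obtain N :: nat where "(\<kappa> + 1) / (1 - \<kappa> * w) \<le> real N" using real_arch_simple by blast
  then have N: "\<kappa> + (\<kappa> * w - 1) * real N \<le> - 1" using \<kappa>w by (simp add: field_simps)
  \<comment> \<open>Relative to the main term the truncation error is of size
    \<open>1 / (\<delta> ^ (M + 3) * Q ^ M)\<close>. With \<open>\<delta>\<close> at least about
    \<open>n powr (- 1 / \<sigma>)\<close> and \<open>Q\<close> about
    \<open>n powr \<kappa>\<close>, this \<open>M\<close> makes it at most \<open>1 / n\<close> up
    to constants.\<close>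
  obtain M :: nat where "(3 / \<sigma> + 1) / (\<kappa> - 1 / \<sigma>) \<le> real M" using real_arch_simple by blast
  then have "3 / \<sigma> + 1 \<le> (\<kappa> - 1 / \<sigma>) * real M" using \<kappa> by (subst (asm) pos_divide_le_eq) (auto simp: mult.commute)
  then have M: "(1 / \<sigma>) * real (M + 3) - \<kappa> * real M \<le> - 1" by (simp add: algebra_simps add_divide_distrib)
  obtain C1 where C1: "C1 > 0" "\<And>\<psi> m n. periodic_weight \<psi> m \<Longrightarrow> n \<ge> 1 \<Longrightarrow>
     \<bar>(LINT x|\<mu>. \<rho> x * weight \<psi> n x) - mean m\<bar> \<le> C1 / real n * mean m"
    using density_weight_integral by blast
  obtain C2 where C2: "C2 > 0" "\<And>\<psi> m n i \<theta>. periodic_weight \<psi> m \<Longrightarrow> n \<ge> 1 \<Longrightarrow> i \<noteq> j0 \<Longrightarrow>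
     cmod (echar (\<theta> * \<alpha> $ i / \<alpha> $ j0) - 1) ^ N * cmod (twisted \<psi> n \<theta> \<rho>) \<le> C2 / real n ^ N * mean m"
    using twisted_density_decay[of N] by blast
  obtain C3 where C3: "C3 > 0" "\<And>\<delta> Q t. 0 < \<delta> \<Longrightarrow> \<delta> \<le> 1 / 2 \<Longrightarrow> Q \<ge> 1 \<Longrightarrow>
     cmod (of_real (periodic_bump b \<delta> t) - (\<Sum>q\<in>{- int Q..int Q}. bump_coeff b \<delta> (of_int q) * echar (of_int q * t)))
     \<le> C3 / (\<delta> ^ (M + 2) * real Q ^ M)"
    using periodized_bump_trig_approx[OF b, of M] by blast
  \<comment> \<open>The summands account for the zero frequency, the other frequencies and the
    truncation; in the last one \<open>1 + C1\<close> bounds the mass of the weighted density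
    relative to \<open>mean m\<close>.\<close>
  define C where "C = C1 + 2 * C2 / c1 ^ N + C3 * 2 ^ M / (B * c2 ^ (M + 3)) * (1 + C1)"
  have C: "C > 0" using C1 C2 C3 B assms by (simp add: C_def add_pos_pos)
  have "\<bar>(LINT x|\<mu>. \<rho> x * weight \<psi> n x * periodic_bump b \<delta> (real n * x $ j0 - y)) - \<delta> * B * mean m\<bar>
      \<le> C / real n * (\<delta> * B * mean m)"
    if wt: "periodic_weight \<psi> m" and n: "n \<ge> 1" and \<delta>: "0 < \<delta>" "\<delta> \<le> 1 / 2" and \<delta>n: "c2 * real n powr (- 1 / \<sigma>) \<le> \<delta>"
    for \<psi> m n y \<delta>
  proof -
    note [measurable] = weight_measurable[OF wt]
    have m0: "mean m \<ge> 0" by (rule mean_nonneg[OF wt])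
    have n0: "real n > 0" "real n \<ge> 1" using n by simp_all
    define c0 where "c0 = \<delta> * B"
    have c0: "c0 > 0" using \<delta> B by (simp add: c0_def)
    define X where "X = (LINT x|\<mu>. \<rho> x * weight \<psi> n x)"
    have X1: "\<bar>X - mean m\<bar> \<le> C1 / real n * mean m" unfolding X_def by (rule C1(2)[OF wt n])
    also have "\<dots> \<le> C1 * mean m" using m0 C1 n0 by (intro mult_right_mono) (simp_all add: divide_le_eq)
    finally have X2: "X \<le> (1 + C1) * mean m" by (simp add: algebra_simps abs_le_iff)
    define Q where "Q = nat \<lfloor>real n powr \<kappa>\<rfloor>"
    have "real n powr \<kappa> \<ge> 1" using n0 \<kappa>0 by (intro ge_one_powr_ge_zero) auto
    \<comment> \<open>Rounding down a number that is at least 1 loses at most a factor 2.\<close>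
    then have Q: "Q \<ge> 1" "real Q \<le> real n powr \<kappa>" "real n powr \<kappa> \<le> 2 * real Q"
    proof -
      define z where "z = real n powr \<kappa>"
      assume "real n powr \<kappa> \<ge> 1"
      then have z: "1 \<le> \<lfloor>z\<rfloor>" "real Q = of_int \<lfloor>z\<rfloor>" "real_of_int \<lfloor>z\<rfloor> \<ge> 1" by (auto simp: Q_def z_def)
      have "real Q \<ge> 1" unfolding z(2) by (rule z(3))
      then show "Q \<ge> 1" by simp
      show "real Q \<le> real n powr \<kappa>" unfolding z(2) z_def by (rule of_int_floor_le)
      show "real n powr \<kappa> \<le> 2 * real Q"
        using z(3) floor_correct[of z] unfolding z(2) z_def by linarith
    qed
    define \<phi> where "\<phi> = periodic_bump b \<delta>"
    have f0: "b (t / \<delta>) = 0" if "\<bar>t\<bar> > 1" for t by (rule scaled_bump_eq_0[OF b \<delta> that])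
    have [measurable]: "b \<in> borel_measurable borel" by (rule smooth_bump_props[OF b])
    have [measurable]: "\<phi> \<in> borel_measurable borel"
      unfolding \<phi>_def by (rule periodize_measurable[OF _ f0]) measurable
    have \<phi>bd: "\<bar>\<phi> t\<bar> \<le> 3" for t
      unfolding \<phi>_def using periodize_le_3[of "\<lambda>t. b (t / \<delta>)" t, OF f0] periodize_nonneg[of "\<lambda>t. b (t / \<delta>)" t]
        smooth_bump_props(3,4)[OF b] by simp
    define P where "P t = (\<Sum>q\<in>{- int Q..int Q}. bump_coeff b \<delta> (of_int q) * echar (of_int q * t))" for t
    define E where "E = C3 / (\<delta> ^ (M + 2) * real Q ^ M)"
    have PE: "cmod (of_real (\<phi> t) - P t) \<le> E" for t
      unfolding \<phi>_def P_def E_def by (rule C3(2)[OF \<delta> Q(1)])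
    have E: "E \<le> c0 * (C3 * 2 ^ M / (B * c2 ^ (M + 3))) / real n"
    proof -
      \<comment> \<open>One power of \<open>\<delta>\<close> is moved into \<open>c0\<close>, which
        turns the absolute error into one relative to the main term; this is why
        \<open>M + 2\<close> becomes \<open>M + 3\<close>.\<close>
      have "E = c0 * (C3 / B) * ((1 / \<delta>) ^ (M + 3) * (1 / real Q) ^ M)"
        using \<delta> B by (simp add: E_def c0_def power_divide power_add field_simps eval_nat_numeral)
      also have "\<dots> \<le> c0 * (C3 / B) * ((real n powr (1 / \<sigma>) / c2) ^ (M + 3) * (2 * real n powr (- \<kappa>)) ^ M)"
      proof (intro mult_left_mono mult_mono power_mono)
        have "c2 \<le> \<delta> * real n powr (1 / \<sigma>)"
          using mult_right_mono[OF \<delta>n, of "real n powr (1 / \<sigma>)"] n0 by (simp add: mult.assoc flip: powr_add)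
        then show "1 / \<delta> \<le> real n powr (1 / \<sigma>) / c2" using \<delta> assms by (simp add: field_simps)
        show "1 / real Q \<le> 2 * real n powr (- \<kappa>)" using Q n0 by (simp add: powr_minus field_simps)
      qed (use c0 C3 B assms \<delta> in auto)
      also have "(real n powr (1 / \<sigma>) / c2) ^ (M + 3) * (2 * real n powr (- \<kappa>)) ^ M
          = 2 ^ M / c2 ^ (M + 3) * (real n powr ((1 / \<sigma>) * real (M + 3)) * real n powr (- \<kappa> * real M))"
        using n0 by (simp only: power_divide power_mult_distrib powr_powr[symmetric] powr_realpow powr_gt_zero) simp
      also have "c0 * (C3 / B) * (2 ^ M / c2 ^ (M + 3) * (real n powr ((1 / \<sigma>) * real (M + 3)) * real n powr (- \<kappa> * real M)))
          \<le> c0 * (C3 / B) * (2 ^ M / c2 ^ (M + 3) * real n powr (- 1))"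
      proof (intro mult_left_mono)
        show "real n powr ((1 / \<sigma>) * real (M + 3)) * real n powr (- \<kappa> * real M) \<le> real n powr (- 1)"
          using n0 M by (subst powr_add[symmetric], intro powr_mono) auto
      qed (use c0 C3(1) B \<open>c2 > 0\<close> in auto)
      finally have "E \<le> c0 * (C3 / B) * (2 ^ M / c2 ^ (M + 3) * real n powr (- 1))" .
      then show ?thesis using n0 by (simp add: powr_minus_divide)
    qed
    have E0: "E \<ge> 0" using PE[of 0] norm_ge_zero order_trans by blast
    have intG: "integrable \<mu> (\<lambda>x. \<rho> x * weight \<psi> n x)" by (rule density_weight_integrable[OF wt])
    let ?u = "\<lambda>x. (\<rho> x * weight \<psi> n x) *\<^sub>R complex_of_real (\<phi> (real n * x $ j0 - y))"
    let ?v = "\<lambda>x. (\<rho> x * weight \<psi> n x) *\<^sub>R P (real n * x $ j0 - y)"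
    have int\<phi>: "integrable \<mu> (\<lambda>x. ?u x)"
    proof (rule Bochner_Integration.integrable_bound[OF integrable_mult_left[OF intG, of 3]])
      show "AE x in \<mu>. norm (?u x) \<le> norm (\<rho> x * weight \<psi> n x * 3)"
        using \<phi>bd by (intro AE_I2) (simp add: abs_mult[of _ 3] mult_left_mono)
    qed measurable
    define J where "J = (LINT x|\<mu>. \<rho> x * weight \<psi> n x * \<phi> (real n * x $ j0 - y))"
    define S where "S = (LINT x|\<mu>. ?v x)"
    have "of_real J - S = (LINT x|\<mu>. ?u x) - S"
      unfolding J_def by (subst integral_complex_of_real[symmetric]) (simp add: scaleR_conv_of_real)
    also have "\<dots> = (LINT x|\<mu>. ?u x - ?v x)"
      unfolding S_def by (rule Bochner_Integration.integral_diff[symmetric, OF int\<phi>])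
        (unfold P_def, rule integral_trig_polynomial(1)[OF wt], simp)
    also have "cmod \<dots> \<le> (LINT x|\<mu>. \<rho> x * weight \<psi> n x * E)"
    proof (rule Bochner_Integration.integral_norm_bound_integral)
      show "integrable \<mu> (\<lambda>x. ?u x - ?v x)"
        by (rule Bochner_Integration.integrable_diff[OF int\<phi>])
          (unfold P_def, rule integral_trig_polynomial(1)[OF wt], simp)
      show "integrable \<mu> (\<lambda>x. \<rho> x * weight \<psi> n x * E)" using intG by simp
      fix x
      show "cmod (?u x - ?v x)
        \<le> \<rho> x * weight \<psi> n x * E"
        using density_nonneg[of x] weight_nonneg[OF wt, of n x] PE[of "real n * x $ j0 - y"]
        by (simp add: scaleR_diff_right[symmetric] mult_left_mono del: scaleR_diff_right)
    qed
    also have "\<dots> = X * E" by (simp add: X_def)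
    also have "\<dots> \<le> (1 + C1) * mean m * E" using X2 E0 by (rule mult_right_mono)
    finally have JS: "cmod (of_real J - S) \<le> (1 + C1) * mean m * E" .
    let ?t = "\<lambda>q. bump_coeff b \<delta> (of_int q) * echar (- (of_int q * y)) * twisted \<psi> n (of_int q) \<rho>"
    define R where "R = (\<Sum>q\<in>{- int Q..int Q} - {0}. ?t q)"
    have "S = (\<Sum>q\<in>{- int Q..int Q}. ?t q)"
      unfolding S_def P_def by (rule integral_trig_polynomial(2)[OF wt]) simp
    \<comment> \<open>The zero frequency has coefficient \<open>\<delta> * B\<close> and an
      untwisted integral, so it contributes the main term up to the error in
      \<open>X\<close>.\<close>
    also have "\<dots> = of_real (c0 * X) + R"
      unfolding R_def by (subst sum.remove[of _ 0])
        (auto simp: bump_coeff_0[OF \<delta>(1)] twisted_density_0[OF wt] X_def c0_def B_def)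
    finally have SR: "S = of_real (c0 * X) + R" .
    have tw: "cmod (twisted \<psi> n (of_int q) \<rho>) \<le> C2 / c1 ^ N * real n powr ((\<kappa> * w - 1) * real N) * mean m"
      if q: "q \<in> {- int Q..int Q} - {0}" for q
    proof -
      have q1: "1 \<le> \<bar>real_of_int q\<bar>" "\<bar>real_of_int q\<bar> \<le> real Q" using q by auto
      obtain i where i: "i \<noteq> j0" "\<And>k::int. c1 * \<bar>of_int q\<bar> powr (- w) \<le> \<bar>of_int q * \<alpha> $ i / \<alpha> $ j0 - of_int k\<bar>"
        using dioph[of q] q by auto
      define z where "z = cmod (echar (of_int q * \<alpha> $ i / \<alpha> $ j0) - 1)"
      \<comment> \<open>Since \<open>\<bar>q\<bar>\<close> is at most
        \<open>n powr \<kappa>\<close>, the distance to the integers is at least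
        \<open>c1 * n powr (- (\<kappa> * w))\<close>. As \<open>\<kappa> * w < 1\<close>, this
        shrinks more slowly than \<open>1 / n\<close>, so every difference is a genuine
        gain.\<close>
      have "c1 * real n powr (- (\<kappa> * w)) = c1 * (real n powr \<kappa>) powr (- w)" by (simp add: powr_powr)
      also have "\<dots> \<le> c1 * \<bar>of_int q\<bar> powr (- w)"
        using q1 Q w assms by (intro mult_left_mono powr_mono2') auto
      also have "\<dots> \<le> \<bar>of_int q * \<alpha> $ i / \<alpha> $ j0 - of_int (round (of_int q * \<alpha> $ i / \<alpha> $ j0))\<bar>" by (rule i)
      also have "\<dots> \<le> z" unfolding z_def
        by (intro echar_minus_1_ge) (metis abs_minus_commute of_int_round_abs_le)
      finally have z: "c1 * real n powr (- (\<kappa> * w)) \<le> z" .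
      have "(c1 * real n powr (- (\<kappa> * w))) ^ N * cmod (twisted \<psi> n (of_int q) \<rho>) \<le> z ^ N * cmod (twisted \<psi> n (of_int q) \<rho>)"
        using z assms by (intro mult_right_mono power_mono) auto
      also have "\<dots> \<le> C2 / real n ^ N * mean m" unfolding z_def by (rule C2(2)[OF wt n i(1)])
      finally have *: "(c1 * real n powr (- (\<kappa> * w))) ^ N * cmod (twisted \<psi> n (of_int q) \<rho>) \<le> C2 / real n ^ N * mean m" .
      have "(c1 * real n powr (- (\<kappa> * w))) ^ N > 0" using n0 assms by simp
      then have "cmod (twisted \<psi> n (of_int q) \<rho>) \<le> C2 / real n ^ N * mean m / (c1 * real n powr (- (\<kappa> * w))) ^ N"
        using * by (subst pos_le_divide_eq) (simp_all add: mult.commute)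
      also have "\<dots> = C2 / c1 ^ N * (1 / (real n * real n powr (- (\<kappa> * w)))) ^ N * mean m"
        by (simp add: power_mult_distrib power_divide)
      also have "1 / (real n * real n powr (- (\<kappa> * w))) = real n powr (\<kappa> * w - 1)"
        using n0 by (simp add: powr_diff powr_minus field_simps)
      also have "(real n powr (\<kappa> * w - 1)) ^ N = real n powr ((\<kappa> * w - 1) * real N)"
        using n0 by (simp add: powr_powr[symmetric] powr_realpow)
      finally show ?thesis .
    qed
    have "cmod R \<le> (\<Sum>q\<in>{- int Q..int Q} - {0}. c0 * (C2 / c1 ^ N * real n powr ((\<kappa> * w - 1) * real N) * mean m))"
      unfolding R_def
    proof (rule sum_norm_le)
      fix q assume q: "q \<in> {- int Q..int Q} - {0}"
      show "cmod (?t q)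
        \<le> c0 * (C2 / c1 ^ N * real n powr ((\<kappa> * w - 1) * real N) * mean m)"
        unfolding norm_mult norm_echar mult_1_right c0_def B_def
        by (intro mult_mono tw[OF q] bump_coeff_le[OF b \<delta>(1)]) (use c0 in \<open>auto simp: c0_def B_def\<close>)
    qed
    also have "\<dots> = 2 * real Q * (c0 * (C2 / c1 ^ N * real n powr ((\<kappa> * w - 1) * real N) * mean m))"
      by (simp add: card_Diff_singleton)
    also have "\<dots> \<le> 2 * real n powr \<kappa> * (c0 * (C2 / c1 ^ N * real n powr ((\<kappa> * w - 1) * real N) * mean m))"
      using Q c0 C2 assms m0 by (intro mult_right_mono) auto
    also have "\<dots> = (2 * C2 / c1 ^ N) * (c0 * mean m) * (real n powr \<kappa> * real n powr ((\<kappa> * w - 1) * real N))"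
      by simp
    also have "\<dots> \<le> (2 * C2 / c1 ^ N) * (c0 * mean m) * (1 / real n)"
    proof (rule mult_left_mono)
      have "real n powr \<kappa> * real n powr ((\<kappa> * w - 1) * real N) \<le> real n powr (- 1)"
        using n0 N by (subst powr_add[symmetric], intro powr_mono) auto
      then show "real n powr \<kappa> * real n powr ((\<kappa> * w - 1) * real N) \<le> 1 / real n"
        using n0 by (simp add: powr_minus_divide)
    qed (use C2 assms c0 m0 in auto)
    finally have Rn: "cmod R \<le> (2 * C2 / c1 ^ N) * (c0 * mean m) * (1 / real n)" .
    have "\<bar>J - c0 * mean m\<bar> = cmod (of_real J - of_real (c0 * mean m))" by (simp only: norm_of_real flip: of_real_diff)
    also have "of_real J - of_real (c0 * mean m) = (of_real J - S) + (R + of_real (c0 * (X - mean m)))"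
      unfolding SR by (simp add: algebra_simps)
    also have "cmod \<dots> \<le> cmod (of_real J - S) + (cmod R + c0 * \<bar>X - mean m\<bar>)"
      using c0 by (intro order_trans[OF norm_triangle_ineq] add_mono order_refl) (simp_all add: norm_mult abs_mult del: of_real_mult)
    also have "\<dots> \<le> (1 + C1) * mean m * (c0 * (C3 * 2 ^ M / (B * c2 ^ (M + 3))) / real n)
        + ((2 * C2 / c1 ^ N) * (c0 * mean m) * (1 / real n) + c0 * (C1 / real n * mean m))"
      using C1 m0 c0 by (intro add_mono order_trans[OF JS] mult_left_mono E Rn X1) auto
    also have "\<dots> = C / real n * (c0 * mean m)"
      by (simp add: C_def add_divide_distrib algebra_simps)
    finally show ?thesis unfolding J_def \<phi>_def c0_def .
  qed
  then show ?thesis using C unfolding B_def by blast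
qed

end

subsection \<open>The measure on the hyperplane\<close>

lemma fdiff_bounded_continuous:
  assumes "fdiff_bounded f"
  shows "continuous_on UNIV f"
proof -
  obtain L where L: "L > 0" "\<And>w x. \<bar>(fdiff w ^^ 1) f x\<bar> \<le> L * norm w ^ 1"
    using fdiff_boundedE[OF assms, of 1] by (metis order_refl)
  have "dist (f y) (f x) \<le> L * dist y x" for x y
    using L(2)[of "y - x" x] by (simp add: fdiff_def dist_norm)
  then have "L-lipschitz_on UNIV f" using L(1) by (intro lipschitz_onI) auto
  then show ?thesis by (rule lipschitz_on_continuous_on)
qed

lemma fdiff_bounded_cmult: "fdiff_bounded f \<Longrightarrow> fdiff_bounded (\<lambda>x. c * f x)"
proof -
  assume f: "fdiff_bounded f"
  have eq: "(fdiff w ^^ N) (\<lambda>x. c * f x) x = c * (fdiff w ^^ N) f x" for w N x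
  proof (induction N arbitrary: x)
    case (Suc N)
    show ?case unfolding fdiff_pow_Suc Suc by (simp add: algebra_simps)
  qed simp
  show ?thesis unfolding fdiff_bounded_def
  proof
    fix N
    obtain C where C: "\<And>w x. \<bar>(fdiff w ^^ N) f x\<bar> \<le> C * norm w ^ N"
      using f unfolding fdiff_bounded_def by metis
    have "\<bar>(fdiff w ^^ N) (\<lambda>x. c * f x) x\<bar> \<le> (\<bar>c\<bar> * C) * norm w ^ N" for w x
      unfolding eq abs_mult mult.assoc by (intro mult_left_mono C) auto
    then show "\<exists>C. \<forall>w x. \<bar>(fdiff w ^^ N) (\<lambda>x. c * f x) x\<bar> \<le> C * norm w ^ N" by blast
  qed
qed

text \<open>Differences in \<open>x\<close> pass under the integral and fall on \<open>g\<close>, so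
  the rough factor may be an indicator. The map \<open>e\<close> lets the integration variable live
  in a different space from \<open>x\<close>.\<close>

lemma fdiff_bounded_convolution:
  fixes g :: "'a::euclidean_space \<Rightarrow> real"
  assumes g: "fdiff_bounded g" and [measurable]: "e \<in> borel_measurable M"
    and A [measurable]: "A \<in> sets M" and fin: "emeasure M A < \<infinity>"
  shows "fdiff_bounded (\<lambda>x. LINT t|M. indicator A t * g (x - e t))"
  unfolding fdiff_bounded_def
proof
  let ?c = "\<lambda>x. LINT t|M. indicator A t * g (x - e t)"
  fix N
  obtain C where C: "C > 0" "\<And>w x i. i \<le> N \<Longrightarrow> \<bar>(fdiff w ^^ i) g x\<bar> \<le> C * norm w ^ i"
    using fdiff_boundedE[OF g, of N] by metis
  have [measurable]: "g \<in> borel_measurable borel"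
    by (intro borel_measurable_continuous_onI fdiff_bounded_continuous g)
  have meas [measurable]: "(fdiff w ^^ i) g \<in> borel_measurable borel" for w i
  proof (induction i)
    case (Suc i)
    have "(\<lambda>x. (fdiff w ^^ i) g (x + w) - (fdiff w ^^ i) g x) \<in> borel_measurable borel"
      using Suc by measurable
    then show ?case by (simp add: fdiff_def[abs_def])
  qed simp
  have int: "integrable M (\<lambda>t. indicator A t * (fdiff w ^^ i) g (x - e t))" if "i \<le> N" for w x i
    using integrableI_bounded_set_indicator[OF A _ fin, of "\<lambda>t. (fdiff w ^^ i) g (x - e t)" "C * norm w ^ i"] C(2)[OF that]
    by (simp add: AE_I2)
  have eq: "(fdiff w ^^ i) ?c x = (LINT t|M. indicator A t * (fdiff w ^^ i) g (x - e t))"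
    if "i \<le> N" for w x i
    using that
  proof (induction i arbitrary: x)
    case (Suc i)
    show ?case unfolding fdiff_pow_Suc Suc.IH[OF Suc_leD[OF Suc.prems]]
      using Suc.prems
      by (subst Bochner_Integration.integral_diff[symmetric])
        (auto intro!: int Bochner_Integration.integral_cong simp: right_diff_distrib algebra_simps)
  qed simp
  have "\<bar>(fdiff w ^^ N) ?c x\<bar> \<le> (C * measure M A) * norm w ^ N" for w x
  proof -
    have "\<bar>LINT t|M. indicator A t * (fdiff w ^^ N) g (x - e t)\<bar> \<le> (LINT t|M. \<bar>indicator A t * (fdiff w ^^ N) g (x - e t)\<bar>)"
      by (rule integral_abs_bound)
    also have "\<dots> \<le> (LINT t|M. indicator A t * (C * norm w ^ N))"
    proof (rule integral_mono)
      show "integrable M (\<lambda>t. \<bar>indicator A t * (fdiff w ^^ N) g (x - e t)\<bar>)" by (intro integrable_abs int) simp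
      show "integrable M (\<lambda>t. indicator A t * (C * norm w ^ N))" using fin by (intro integrable_mult_left integrable_real_indicator A)
    qed (use C(2)[of N w] in \<open>auto simp: indicator_def\<close>)
    also have "\<dots> = (C * measure M A) * norm w ^ N" by (simp add: sets.Int_space_eq2[OF A])
    finally show ?thesis by (simp add: eq)
  qed
  then show "\<exists>C. \<forall>w x. \<bar>(fdiff w ^^ N) ?c x\<bar> \<le> C * norm w ^ N" by blast
qed

interpretation lborel_product: product_sigma_finite "\<lambda>i::'i. lborel :: real measure" ..

text \<open>Checked on boxes, where the product measure factors into one-dimensional translations;
  the restriction to \<open>base_coords\<close> keeps the shifted function extensional.\<close>

lemma base_lborel_shift:
  "distr base_lborel base_lborel (\<lambda>u. \<lambda>i\<in>base_coords. u i + w i) = (base_lborel :: ('k::{finite,linorder} \<Rightarrow> real) measure)"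
  unfolding base_lborel_def
proof (rule lborel_product.PiM_eqI)
  fix A :: "'k \<Rightarrow> real set" assume A: "\<And>i. i \<in> base_coords \<Longrightarrow> A i \<in> sets lborel"
  let ?M = "\<Pi>\<^sub>M i\<in>(base_coords :: 'k set). (lborel :: real measure)"
  let ?S = "\<lambda>u. \<lambda>i\<in>base_coords. u i + w i"
  have [measurable]: "?S \<in> ?M \<rightarrow>\<^sub>M ?M"
    by measurable
  have meas: "(\<lambda>t. t + w i) -` A i \<in> sets borel" if "i \<in> base_coords" for i
    using measurable_sets[of "\<lambda>t. t + w i" borel borel "A i"] A[OF that] by simp
  have sh: "emeasure lborel ((\<lambda>t. t + w i) -` A i) = emeasure lborel (A i)" if "i \<in> base_coords" for i
  proof -
    have "emeasure lborel (A i) = emeasure (distr lborel borel ((+) (w i))) (A i)" by (simp add: lborel_distr_plus)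
    also have "(+) (w i) = (\<lambda>t. t + w i)" by (auto simp: add.commute)
    also have "emeasure (distr lborel borel (\<lambda>t. t + w i)) (A i) = emeasure lborel ((\<lambda>t. t + w i) -` A i)"
      using A[OF that] by (subst emeasure_distr) auto
    finally show ?thesis ..
  qed
  have "emeasure (distr ?M ?M ?S) (\<Pi>\<^sub>E i\<in>base_coords. A i)
    = emeasure ?M (\<Pi>\<^sub>E i\<in>base_coords. (\<lambda>t. t + w i) -` A i)"
  proof (subst emeasure_distr)
    show "(\<Pi>\<^sub>E i\<in>base_coords. A i) \<in> sets ?M"
      by (rule sets_PiM_I_finite) (use A in auto)
    have "?S -` (\<Pi>\<^sub>E i\<in>base_coords. A i) \<inter> space ?M
        = (\<Pi>\<^sub>E i\<in>base_coords. (\<lambda>t. t + w i) -` A i)"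
      by (auto simp: space_PiM PiE_def Pi_def)
    then show "emeasure ?M (?S -` (\<Pi>\<^sub>E i\<in>base_coords. A i) \<inter> space ?M)
        = emeasure ?M (\<Pi>\<^sub>E i\<in>base_coords. (\<lambda>t. t + w i) -` A i)"
      by simp
  qed measurable
  also have "\<dots> = (\<Prod>i\<in>base_coords. emeasure lborel (A i))"
    by (subst lborel_product.emeasure_PiM) (auto intro!: prod.cong sh meas)
  finally show "emeasure (distr ?M ?M ?S) (\<Pi>\<^sub>E i\<in>base_coords. A i)
    = (\<Prod>i\<in>base_coords. emeasure lborel (A i))" .
qed auto

lemma space_base_lborel: "space base_lborel = extensional base_coords"
  by (simp add: base_lborel_def space_PiM PiE_def)

lemma sigma_finite_base_lborel: "sigma_finite_measure base_lborel"
  unfolding base_lborel_def by (rule lborel_product.sigma_finite) simp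

lemma measurable_base_component:
  "i \<in> base_coords \<Longrightarrow> (\<lambda>u. u i) \<in> borel_measurable base_lborel"
  unfolding base_lborel_def by measurable

lemma embed_base_nth: "embed_base u $ i = (if i \<in> base_coords then u i else 0)"
  by (simp add: embed_base_def)

lemma measurable_embed_base [measurable]: "embed_base \<in> borel_measurable base_lborel"
proof -
  have "(\<lambda>u. embed_base u \<bullet> axis i 1) \<in> borel_measurable base_lborel" for i :: 'a
    by (cases "i \<in> base_coords") (simp_all add: inner_axis embed_base_nth measurable_base_component)
  then show ?thesis
    by (subst borel_measurable_euclidean_space) (auto simp: Basis_vec_def)
qed

lemma emeasure_base_box:
  "emeasure base_lborel (\<Pi>\<^sub>E i\<in>base_coords. {a i..b i}) = (\<Prod>i\<in>base_coords. emeasure lborel {a i..b i})"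
  unfolding base_lborel_def by (rule lborel_product.emeasure_PiM) auto

lemma sets_base_box: "(\<Pi>\<^sub>E i\<in>base_coords. {a i..b i :: real}) \<in> sets base_lborel"
  unfolding base_lborel_def by (rule sets_PiM_I_finite) auto

lemma emeasure_base_box_finite: "emeasure base_lborel (\<Pi>\<^sub>E i\<in>base_coords. {a i..b i}) < \<infinity>"
  unfolding emeasure_base_box by (simp add: ennreal_prod_eq_top less_top[symmetric] emeasure_lborel_Icc_eq)

section \<open>The given measure as a smooth density on its hyperplane\<close>

locale rotated_base =
  fixes \<alpha> v :: "(real, 'k::{finite,linorder}) vec" and B r :: "'k \<Rightarrow> real" and \<beta> :: "'k \<Rightarrow> real \<Rightarrow> real"
    and R :: "((real, 'k) vec, 'k) vec"
  assumes card: "CARD('k) \<ge> 2"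
    and base: "\<And>i. i \<in> base_coords \<Longrightarrow> B i > 0 \<and> r i > 0 \<and> smooth_bump (\<beta> i)"
    and rot: "rotation_matrix R"
    and image: "(\<lambda>x. R *v x) ` {x. \<forall>j. pos j = CARD('k) \<longrightarrow> x $ j = 0} = {x. \<alpha> \<bullet> x = 0}"
begin

definition param :: "('k \<Rightarrow> real) \<Rightarrow> (real, 'k) vec" where
  "param u = R *v embed_base u + v"

text \<open>Surface measure without the density: the image of Lebesgue measure under a rigid motion.
  It has the invariance that \<open>hyperplane_measure\<close> asks for, and the density is carried
  separately by a function on the ambient space.\<close>

definition plane_measure :: "(real, 'k) vec measure" where
  "plane_measure = distr base_lborel borel param"

lemma not_base_coords: "(j :: 'k) \<notin> base_coords \<longleftrightarrow> pos j = CARD('k)"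
proof -
  have "pos j \<le> CARD('k)" unfolding pos_def by (intro card_mono) auto
  then show ?thesis by (auto simp: base_coords_def)
qed

lemma base_coords_nonempty: "(base_coords :: 'k set) \<noteq> {}"
proof
  assume e: "(base_coords :: 'k set) = {}"
  have "pos (Min (UNIV :: 'k set)) = card {Min (UNIV :: 'k set)}"
    unfolding pos_def by (intro arg_cong[where f = card]) (auto intro: antisym)
  then have "Min (UNIV :: 'k set) \<in> base_coords" using card by (simp add: base_coords_def)
  then show False using e by simp
qed

lemma orth: "transpose R ** R = mat 1" "orthogonal_matrix R"
  using rot by (auto simp: rotation_matrix_def orthogonal_matrix)

lemma norm_R: "norm (R *v x) = norm x"
  using orth(2) orthogonal_transformation_norm[of "(*v) R" x]
  by (simp add: orthogonal_transformation_matrix)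

lemma transpose_R: "transpose R *v (R *v x) = x"
  by (simp add: matrix_vector_mul_assoc orth)

lemma norm_transpose_R: "norm (transpose R *v x) = norm x"
proof -
  have "orthogonal_matrix (transpose R)" using orth(2) orthogonal_matrix_transpose by blast
  then show ?thesis using orthogonal_transformation_norm[of "(*v) (transpose R)" x]
    by (simp add: orthogonal_transformation_matrix)
qed

lemma measurable_param [measurable]: "param \<in> borel_measurable base_lborel"
proof -
  have [measurable]: "(\<lambda>x. R *v x) \<in> borel_measurable borel"
    by (intro borel_measurable_continuous_onI matrix_vector_mult_linear_continuous_on)
  show ?thesis unfolding param_def[abs_def] by measurable
qed

text \<open>Since \<open>R\<close> preserves norms, the parameters of points in a ball lie in a
  bounded box. A vector orthogonal to \<open>\<alpha>\<close> is the image under \<open>R\<close> of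
  some \<open>z\<close> vanishing at the last coordinate, so translating by it amounts to
  translating the parameters.\<close>

lemma hyperplane_measure_plane:
  assumes "\<alpha> $ j0 \<noteq> 0"
  shows "hyperplane_measure plane_measure \<alpha> j0"
proof
  show "sets plane_measure = sets borel" by (simp add: plane_measure_def)
  show "\<alpha> $ j0 \<noteq> 0" by fact
next
  fix \<rho> :: real
  define C where "C = \<rho> + norm v"
  define box where "box = (\<Pi>\<^sub>E i\<in>(base_coords :: 'k set). {- C..C})"
  have "param -` cball 0 \<rho> \<inter> space base_lborel \<subseteq> box"
  proof
    fix u assume u: "u \<in> param -` cball 0 \<rho> \<inter> space base_lborel"
    have "norm (embed_base u) = norm (param u - v)" by (simp add: param_def norm_R)
    also have "\<dots> \<le> C" using u norm_triangle_ineq4[of "param u" v] by (simp add: C_def)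
    finally have "\<bar>embed_base u $ i\<bar> \<le> C" for i using component_le_norm_cart order_trans by blast
    then have "\<bar>u i\<bar> \<le> C" if "i \<in> base_coords" for i using that by (metis embed_base_nth)
    then show "u \<in> box"
      using u by (fastforce simp: box_def space_base_lborel PiE_def Pi_def abs_le_iff)
  qed
  then have "emeasure base_lborel (param -` cball 0 \<rho> \<inter> space base_lborel) \<le> emeasure base_lborel box"
    by (rule emeasure_mono) (simp add: box_def sets_base_box)
  then show "emeasure plane_measure (cball 0 \<rho>) < \<infinity>"
    unfolding plane_measure_def using emeasure_base_box_finite[of "\<lambda>_. - C" "\<lambda>_. C"]
    by (subst emeasure_distr) (auto simp: box_def intro: le_less_trans)
next
  fix s assume "\<alpha> \<bullet> s = 0"
  then have "s \<in> (\<lambda>x. R *v x) ` {x. \<forall>j. pos j = CARD('k) \<longrightarrow> x $ j = 0}" unfolding image by simp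
  then obtain z where z: "s = R *v z" "\<And>j. j \<notin> base_coords \<Longrightarrow> z $ j = 0" using not_base_coords by blast
  define S where "S u = (\<lambda>i\<in>base_coords. u i + z $ i)" for u :: "'k \<Rightarrow> real"
  have [measurable]: "S \<in> base_lborel \<rightarrow>\<^sub>M base_lborel"
    unfolding S_def base_lborel_def by measurable
  have "param (S u) = param u + s" for u
  proof -
    have "embed_base (S u) = embed_base u + z"
      by (auto simp: vec_eq_iff embed_base_nth S_def z)
    then show ?thesis by (simp add: param_def z matrix_vector_right_distrib)
  qed
  then have "distr plane_measure borel (\<lambda>x. x + s) = distr base_lborel borel (param \<circ> S)"
    unfolding plane_measure_def by (subst distr_distr) (auto simp: comp_def)
  also have "\<dots> = distr (distr base_lborel base_lborel S) borel param"
    by (subst distr_distr) auto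
  also have "distr base_lborel base_lborel S = base_lborel"
    unfolding S_def by (rule base_lborel_shift)
  finally show "distr plane_measure borel (\<lambda>x. x + s) = plane_measure" by (simp add: plane_measure_def)
qed

text \<open>The bump of the base extended to the whole space, constant in the last coordinate, so
  that differences can be taken in every direction.\<close>

definition bump :: "(real, 'k) vec \<Rightarrow> real" where
  "bump x = (\<Prod>i\<in>base_coords. \<beta> i (x $ i / r i))"

lemma base_bump_eq: "base_bump r \<beta> u = bump (embed_base u)"
  by (simp add: base_bump_def bump_def embed_base_nth)

lemma bump_diff: "base_bump r \<beta> (\<lambda>i\<in>base_coords. u i - t i) = bump (embed_base u - embed_base t)"
  by (simp add: base_bump_def bump_def embed_base_nth)

lemma fdiff_bounded_bump: "fdiff_bounded bump"
  unfolding bump_def[abs_def]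
proof (rule fdiff_bounded_prod)
  fix i :: 'k assume i: "i \<in> base_coords"
  show "fdiff_bounded (\<lambda>x :: (real, 'k) vec. \<beta> i (x $ i / r i))"
  proof (rule fdiff_bounded_linear[of "\<beta> i" "\<lambda>x. x $ i / r i"])
    show "fdiff_bounded (\<beta> i)" using base[OF i] by (simp add: smooth_bump_fdiff_bounded)
    show "bounded_linear (\<lambda>x :: (real, 'k) vec. x $ i / r i)"
      using bounded_linear_compose[OF bounded_linear_divide[of "r i"] bounded_linear_vec_nth[of i]] by simp
  qed
qed

lemma bump_nonneg: "0 \<le> bump x"
  unfolding bump_def by (intro prod_nonneg smooth_bump_props(3)) (use base in auto)

lemma bump_le_1: "bump x \<le> 1"
  unfolding bump_def by (intro prod_le_1 conjI smooth_bump_props(3,4)) (use base in auto)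

lemma measurable_bump [measurable]: "bump \<in> borel_measurable borel"
  by (intro borel_measurable_continuous_onI fdiff_bounded_continuous fdiff_bounded_bump)

text \<open>The convolution with its outer variable moved to the ambient space; on the embedded base
  it is the unnormalised density by \<open>base_density_eq\<close>.\<close>

definition smoothed_box :: "(real, 'k) vec \<Rightarrow> real" where
  "smoothed_box x = (LINT t|base_lborel. indicator (base_box B) t * bump (x - embed_base t))"

lemma base_box [measurable]: "base_box B \<in> sets base_lborel"
  unfolding base_box_def by (rule sets_base_box)

lemma base_box_finite: "emeasure base_lborel (base_box B) < \<infinity>"
  unfolding base_box_def by (rule emeasure_base_box_finite)

lemma base_density_eq: "base_density B r \<beta> u = smoothed_box (embed_base u)"
  unfolding base_density_def base_convolution_def smoothed_box_def bump_diff by simp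

lemma fdiff_bounded_smoothed_box: "fdiff_bounded smoothed_box"
  unfolding smoothed_box_def[abs_def]
  by (rule fdiff_bounded_convolution[OF fdiff_bounded_bump measurable_embed_base base_box base_box_finite])

lemma smoothed_box_nonneg: "0 \<le> smoothed_box x"
  unfolding smoothed_box_def using bump_nonneg by (intro Bochner_Integration.integral_nonneg) auto

lemma measurable_smoothed_box [measurable]: "smoothed_box \<in> borel_measurable borel"
  by (intro borel_measurable_continuous_onI fdiff_bounded_continuous fdiff_bounded_smoothed_box)

lemma smoothed_box_support:
  assumes i: "i \<in> base_coords" and "\<bar>x $ i\<bar> > B i + 2 * r i"
  shows "smoothed_box x = 0"
proof -
  have 0: "indicator (base_box B) t * bump (x - embed_base t) = 0" for t
  proof (cases "t \<in> base_box B")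
    case True
    then have "\<bar>t i\<bar> \<le> B i" using i by (auto simp: base_box_def PiE_def Pi_def abs_le_iff)
    then have "2 * r i < \<bar>x $ i - t i\<bar>" using assms(2) by linarith
    then have "2 < \<bar>(x $ i - t i) / r i\<bar>" using base[OF i] by (simp add: abs_divide field_simps)
    then have "\<beta> i ((x - embed_base t) $ i / r i) = 0"
      using base[OF i] i by (simp add: embed_base_nth smooth_bump_props(5))
    then have "bump (x - embed_base t) = 0" unfolding bump_def using i by (intro prod_zero) auto
    then show ?thesis by simp
  qed simp
  show ?thesis unfolding smoothed_box_def 0 by simp
qed

definition total :: real where
  "total = (LINT u|base_lborel. base_density B r \<beta> u)"

abbreviation density_mass :: ennreal where
  "density_mass \<equiv> \<integral>\<^sup>+ u. ennreal (base_density B r \<beta> u) \<partial>base_lborel"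

text \<open>By Tonelli and translation invariance the mass of a convolution is the product of the
  masses, here the volume of the box and a product of one-dimensional bump integrals, all positive
  and finite. This makes division by \<open>total\<close> legitimate.\<close>

lemma nn_integral_density: "density_mass \<noteq> 0"
  "density_mass \<noteq> \<infinity>"
proof -
  let ?k = "\<lambda>u t. indicator (base_box B) t * ennreal (bump (embed_base u - embed_base t)) :: ennreal"
  interpret S: sigma_finite_measure "base_lborel :: ('k \<Rightarrow> real) measure" by (rule sigma_finite_base_lborel)
  interpret P: pair_sigma_finite "base_lborel :: ('k \<Rightarrow> real) measure" "base_lborel :: ('k \<Rightarrow> real) measure" ..
  define g :: ennreal where "g = (\<integral>\<^sup>+ u. ennreal (bump (embed_base u)) \<partial>base_lborel)"
  have "ennreal (base_density B r \<beta> u) = (\<integral>\<^sup>+ t. ?k u t \<partial>base_lborel)" for u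
  proof -
    have "integrable base_lborel (\<lambda>t. indicator (base_box B) t * bump (embed_base u - embed_base t))"
      using integrableI_bounded_set_indicator[OF base_box _ base_box_finite, of "\<lambda>t. bump (embed_base u - embed_base t)" 1] bump_nonneg bump_le_1
      by (simp add: AE_I2)
    then show ?thesis unfolding base_density_eq smoothed_box_def
      using bump_nonneg by (subst nn_integral_eq_integral[symmetric]) (auto intro!: nn_integral_cong simp: indicator_def)
  qed
  then have "density_mass
    = (\<integral>\<^sup>+ u. \<integral>\<^sup>+ t. ?k u t \<partial>base_lborel \<partial>base_lborel)"
    by simp
  also have "\<dots> = (\<integral>\<^sup>+ t. \<integral>\<^sup>+ u. ?k u t \<partial>base_lborel \<partial>base_lborel)"
    by (rule P.Fubini') measurable
  also have "\<dots> = (\<integral>\<^sup>+ t. indicator (base_box B) t * g \<partial>base_lborel)"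
  proof (intro nn_integral_cong)
    fix t :: "'k \<Rightarrow> real"
    define S where "S u = (\<lambda>i\<in>base_coords. u i + - t i)" for u :: "'k \<Rightarrow> real"
    have S: "S \<in> base_lborel \<rightarrow>\<^sub>M base_lborel"
      unfolding S_def base_lborel_def by measurable
    have "g = (\<integral>\<^sup>+ u. ennreal (bump (embed_base u)) \<partial>(distr base_lborel base_lborel S))"
      unfolding g_def S_def base_lborel_shift ..
    also have "\<dots> = (\<integral>\<^sup>+ u. ennreal (bump (embed_base (S u))) \<partial>base_lborel)"
      by (rule nn_integral_distr[OF S]) measurable
    also have "\<dots> = (\<integral>\<^sup>+ u. ennreal (bump (embed_base u - embed_base t)) \<partial>base_lborel)"
      using bump_diff[of _ t] by (simp add: base_bump_eq S_def)
    finally show "(\<integral>\<^sup>+ u. ?k u t \<partial>base_lborel) = indicator (base_box B) t * g"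
      by (simp add: nn_integral_cmult)
  qed
  also have "\<dots> = emeasure base_lborel (base_box B) * g" by (simp add: nn_integral_multc)
  finally have eq: "density_mass = emeasure base_lborel (base_box B) * g" .
  have "g = (\<integral>\<^sup>+ u. (\<Prod>i\<in>base_coords. ennreal (\<beta> i (u i / r i))) \<partial>base_lborel)"
    unfolding g_def using base smooth_bump_props(3)
    by (intro nn_integral_cong) (simp add: bump_def embed_base_nth prod_ennreal)
  also have "\<dots> = (\<Prod>i\<in>base_coords. \<integral>\<^sup>+ t. ennreal (\<beta> i (t / r i)) \<partial>lborel)"
    unfolding base_lborel_def
  proof (rule lborel_product.product_nn_integral_prod)
    fix i :: 'k assume i: "i \<in> base_coords"
    have "(\<lambda>t. \<beta> i (t / r i)) \<in> borel_measurable lborel"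
      by (rule borel_measurable_integrable, rule smooth_bump_scaled_integrable) (use base[OF i] in auto)
    then show "(\<lambda>t. ennreal (\<beta> i (t / r i))) \<in> borel_measurable lborel"
      by (rule measurable_compose[OF _ measurable_ennreal])
  qed simp
  also have "\<dots> = (\<Prod>i\<in>base_coords. ennreal (r i * (LINT t|lborel. \<beta> i t)))"
  proof (intro prod.cong refl)
    fix i :: 'k assume i: "i \<in> base_coords"
    show "(\<integral>\<^sup>+ t. ennreal (\<beta> i (t / r i)) \<partial>lborel) = ennreal (r i * (LINT t|lborel. \<beta> i t))"
      using base[OF i] smooth_bump_scaled_integrable[of "\<beta> i" "r i"] smooth_bump_props(3)[of "\<beta> i"] smooth_bump_scaled_integral[of "r i" "\<beta> i"]
      by (subst nn_integral_eq_integral) auto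
  qed
  finally have g: "g = (\<Prod>i\<in>base_coords. ennreal (r i * (LINT t|lborel. \<beta> i t)))" .
  have g0: "g \<noteq> 0" "g \<noteq> \<infinity>"
  proof -
    have "0 < r i * (LINT t|lborel. \<beta> i t)" if "i \<in> base_coords" for i
      using base[OF that] by (intro mult_pos_pos smooth_bump_integral_pos) auto
    then show "g \<noteq> 0" "g \<noteq> \<infinity>"
      unfolding g by (auto simp: ennreal_prod_eq_top ennreal_eq_0_iff not_le)
  qed
  have b0: "emeasure base_lborel (base_box B) \<noteq> 0"
  proof -
    have "0 < B i" if "i \<in> base_coords" for i using base[OF that] by simp
    then show ?thesis
      unfolding base_box_def emeasure_base_box by (force simp: emeasure_lborel_Icc_eq)
  qed
  show "density_mass \<noteq> 0" unfolding eq using g0 b0 by simp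
  show "density_mass \<noteq> \<infinity>"
    unfolding eq using g0 base_box_finite by (simp add: ennreal_mult_eq_top_iff)
qed

lemma measurable_base_density [measurable]: "base_density B r \<beta> \<in> borel_measurable base_lborel"
  unfolding base_density_eq[abs_def] by measurable

lemma base_density_nonneg: "0 \<le> base_density B r \<beta> u"
  by (simp add: base_density_eq smoothed_box_nonneg)

lemma total_pos: "total > 0"
proof -
  have "integrable base_lborel (base_density B r \<beta>)"
    using nn_integral_density(2) base_density_nonneg
    by (intro integrableI_nonneg) (auto simp: less_top[symmetric])
  then have "ennreal total = density_mass"
    unfolding total_def using base_density_nonneg by (subst nn_integral_eq_integral) auto
  then have "ennreal total \<noteq> 0" using nn_integral_density(1) by simp
  then show ?thesis by (simp add: ennreal_eq_0_iff not_le)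
qed

text \<open>A translate of one of the given bumps, normalised at a point \<open>t0\<close> where it
  does not vanish. The value at 0 is exactly 1 so that the cutoff does not alter the density on the
  hyperplane.\<close>

lemma cutoff_exists:
  "\<exists>cut K. fdiff_bounded cut \<and> (\<forall>t::real. 0 \<le> cut t) \<and> cut 0 = 1 \<and> (\<forall>t. \<bar>t\<bar> > K \<longrightarrow> cut t = 0)"
proof -
  obtain i :: 'k where i: "i \<in> base_coords" using base_coords_nonempty by blast
  have sb: "smooth_bump (\<beta> i)" using base[OF i] by simp
  then obtain t0 where t0: "\<beta> i t0 \<noteq> 0" unfolding smooth_bump_def by blast
  define cut where "cut t = (1 / \<beta> i t0) * \<beta> i (t + t0)" for t
  have "fdiff_bounded cut"
    unfolding cut_def[abs_def] by (intro fdiff_bounded_cmult fdiff_bounded_shift smooth_bump_fdiff_bounded sb)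
  moreover have "0 \<le> cut t" for t unfolding cut_def using smooth_bump_props(3)[OF sb] by simp
  moreover have "cut 0 = 1" using t0 by (simp add: cut_def)
  moreover have "cut t = 0" if "\<bar>t\<bar> > 2 + \<bar>t0\<bar>" for t
    unfolding cut_def using that smooth_bump_props(5)[OF sb, of "t + t0"] by simp
  ultimately show ?thesis by blast
qed

text \<open>
  The density is only determined on the hyperplane; a cutoff in the normal direction makes it
  compactly supported on the whole space.
\<close>

lemma plane_density_exists:
  "\<exists>\<rho> K. (\<forall>u. \<rho> (param u) = base_density B r \<beta> u / total) \<and> \<rho> \<in> borel_measurable borel \<and> (\<forall>x. 0 \<le> \<rho> x) \<and>
     (\<forall>x. norm x > K \<longrightarrow> \<rho> x = 0) \<and> fdiff_bounded \<rho>"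
proof -
  obtain cut Kc where cut: "fdiff_bounded cut" "\<And>t::real. 0 \<le> cut t" "cut 0 = 1" "\<And>t. \<bar>t\<bar> > Kc \<Longrightarrow> cut t = 0"
    using cutoff_exists by blast
  \<comment> \<open>The complement of \<open>base_coords\<close> is the normal direction before
    rotation; the cutoff acts there.\<close>
  define D where "D z = 1 / total * (smoothed_box z * (\<Prod>j\<in>- base_coords. cut (z $ j)))" for z :: "(real, 'k) vec"
  have "fdiff_bounded (\<lambda>z :: (real, 'k) vec. cut (z $ j))" for j
    using fdiff_bounded_linear[OF cut(1) bounded_linear_vec_nth] .
  then have D_smooth: "fdiff_bounded D"
    unfolding D_def[abs_def] by (intro fdiff_bounded_cmult fdiff_bounded_mult fdiff_bounded_smoothed_box fdiff_bounded_prod)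
  define \<rho> where "\<rho> x = D (transpose R *v (x + - v))" for x
  have smooth: "fdiff_bounded \<rho>"
    unfolding \<rho>_def[abs_def]
    using fdiff_bounded_shift[OF fdiff_bounded_linear[OF D_smooth matrix_vector_mul_bounded_linear[of "transpose R"]], of "- v"] .
  have on_plane: "\<rho> (param u) = base_density B r \<beta> u / total" for u
  proof -
    have "param u + - v = R *v embed_base u" by (simp add: param_def)
    then have "transpose R *v (param u + - v) = embed_base u" by (simp only: transpose_R)
    then show ?thesis by (simp add: \<rho>_def D_def base_density_eq embed_base_nth cut)
  qed
  have nonneg: "0 \<le> \<rho> x" for x
    unfolding \<rho>_def D_def using total_pos smoothed_box_nonneg cut(2) by (intro mult_nonneg_nonneg prod_nonneg) auto
  \<comment> \<open>Coordinatewise radii: when the norm exceeds their sum, some coordinate exceeds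
    its own radius, and that coordinate alone makes a factor of \<open>D\<close> vanish.\<close>
  define bd where "bd i = (if i \<in> base_coords then B i + 2 * r i else Kc)" for i
  have support: "\<rho> x = 0" if "norm x > (\<Sum>i\<in>UNIV. bd i) + norm v" for x
  proof -
    define z where "z = transpose R *v (x + - v)"
    have "norm x \<le> norm z + norm v"
      using norm_triangle_ineq[of "x + - v" v] unfolding z_def norm_transpose_R by simp
    then have "(\<Sum>i\<in>UNIV. bd i) < norm z" using that by linarith
    also have "\<dots> \<le> (\<Sum>i\<in>UNIV. \<bar>z $ i\<bar>)" by (rule norm_le_l1_cart)
    finally obtain i where i: "bd i < \<bar>z $ i\<bar>"
      by (meson not_le sum_mono)
    have "D z = 0"
    proof (cases "i \<in> base_coords")
      case True
      then show ?thesis using i smoothed_box_support[of i z] by (simp add: D_def bd_def)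
    next
      case False
      then have "cut (z $ i) = 0" using i cut(4) by (simp add: bd_def)
      then have "(\<Prod>j\<in>- base_coords. cut (z $ j)) = 0" using False by (intro prod_zero) auto
      then show ?thesis by (simp add: D_def)
    qed
    then show ?thesis by (simp add: \<rho>_def z_def)
  qed
  have "\<rho> \<in> borel_measurable borel"
    by (intro borel_measurable_continuous_onI fdiff_bounded_continuous smooth)
  then show ?thesis using on_plane nonneg support smooth by blast
qed

lemma integral_plane_measure:
  assumes [measurable]: "\<rho> \<in> borel_measurable borel" "f \<in> borel_measurable borel"
    and on_plane: "\<And>u. \<rho> (param u) = base_density B r \<beta> u / total"
  shows "(LINT x|distr (base_measure B r \<beta>) borel (\<lambda>x. R *v x + v). f x) = (LINT x|plane_measure. \<rho> x * f x :: real)"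
proof -
  have [measurable]: "(\<lambda>x. R *v x + v) \<in> borel_measurable borel"
    by (intro borel_measurable_continuous_onI continuous_intros matrix_vector_mult_linear_continuous_on)
  have "(LINT x|distr (base_measure B r \<beta>) borel (\<lambda>x. R *v x + v). f x) = (LINT x|base_measure B r \<beta>. f (R *v x + v))"
    by (subst integral_distr) (auto simp: base_measure_def)
  also have "\<dots> = (LINT u|density base_lborel (\<lambda>u. ennreal (base_density B r \<beta> u / total)). f (param u))"
    unfolding base_measure_def total_def[symmetric] by (subst integral_distr) (auto simp: param_def)
  also have "\<dots> = (LINT u|base_lborel. (base_density B r \<beta> u / total) *\<^sub>R f (param u))"
    using total_pos base_density_nonneg by (subst integral_density) (auto intro!: AE_I2)
  also have "\<dots> = (LINT x|plane_measure. \<rho> x * f x)"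
    unfolding plane_measure_def by (subst integral_distr) (auto simp: on_plane)
  finally show ?thesis .
qed

lemma hyperplane_density_exists:
  obtains \<rho> K where "\<And>j0. \<alpha> $ j0 \<noteq> 0 \<Longrightarrow> hyperplane_density plane_measure \<alpha> j0 \<rho> K"
    "\<And>f. f \<in> borel_measurable borel \<Longrightarrow>
      (LINT x|distr (base_measure B r \<beta>) borel (\<lambda>x. R *v x + v). f x) = (LINT x|plane_measure. \<rho> x * f x :: real)"
proof -
  obtain \<rho> K where \<rho>: "\<And>u. \<rho> (param u) = base_density B r \<beta> u / total" "\<rho> \<in> borel_measurable borel" "\<And>x. 0 \<le> \<rho> x"
     "\<And>x. norm x > K \<Longrightarrow> \<rho> x = 0" "fdiff_bounded \<rho>"
    using plane_density_exists by blast
  have "(LINT x|plane_measure. \<rho> x) = (LINT u|base_lborel. base_density B r \<beta> u / total)"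
    unfolding plane_measure_def using \<rho>(2) by (subst integral_distr) (auto simp: \<rho>(1))
  also have "\<dots> = 1" using total_pos by (simp add: total_def[symmetric])
  finally have 1: "(LINT x|plane_measure. \<rho> x) = 1" .
  show thesis
  proof (rule that)
    show "hyperplane_density plane_measure \<alpha> j0 \<rho> K" if "\<alpha> $ j0 \<noteq> 0" for j0
      unfolding hyperplane_density_def hyperplane_density_axioms_def
      using hyperplane_measure_plane[OF that] \<rho> 1 by blast
  qed (rule integral_plane_measure[OF \<rho>(2) _ \<rho>(1)])
qed

end

subsection \<open>The counting function\<close>

text \<open>Only the finite box of vectors with every \<open>a $ j\<close> in \<open>S j\<close>
  contributes, so the sum is finite and distributivity applies.\<close>

lemma infsum_prod_vec:
  fixes F :: "'k::finite \<Rightarrow> int \<Rightarrow> real"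
  assumes fin: "\<And>j. finite (S j)" and supp: "\<And>j a. a \<notin> S j \<Longrightarrow> F j a = 0"
  shows "(\<Sum>\<^sub>\<infinity>a\<in>(UNIV :: (int ^ 'k) set). \<Prod>j\<in>UNIV. F j (a $ j)) = (\<Prod>j\<in>UNIV. \<Sum>a\<in>S j. F j a)"
proof -
  define V :: "('k \<Rightarrow> int) \<Rightarrow> int ^ 'k" where "V g = (\<chi> j. g j)" for g
  define T where "T = V ` (PiE UNIV S)"
  have inj: "inj_on V (PiE UNIV S)" by (auto simp: inj_on_def V_def vec_eq_iff fun_eq_iff)
  have finT: "finite T" unfolding T_def by (intro finite_imageI finite_PiE fin) auto
  have T: "a \<in> T" if "\<And>j. a $ j \<in> S j" for a
    unfolding T_def by (rule image_eqI[of _ _ "\<lambda>j. a $ j"]) (use that in \<open>auto simp: V_def\<close>)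
  have "(\<Sum>\<^sub>\<infinity>a\<in>(UNIV :: (int ^ 'k) set). \<Prod>j\<in>UNIV. F j (a $ j)) = (\<Sum>\<^sub>\<infinity>a\<in>T. \<Prod>j\<in>UNIV. F j (a $ j))"
  proof (rule infsum_cong_neutral)
    fix a assume "a \<in> UNIV - T"
    then obtain j where "a $ j \<notin> S j" using T by blast
    then show "(\<Prod>j\<in>UNIV. F j (a $ j)) = 0" using supp by (intro prod_zero) auto
  qed auto
  also have "\<dots> = (\<Sum>a\<in>T. \<Prod>j\<in>UNIV. F j (a $ j))" by (rule infsum_finite[OF finT])
  also have "\<dots> = (\<Sum>g\<in>PiE UNIV S. \<Prod>j\<in>UNIV. F j (g j))"
    unfolding T_def by (subst sum.reindex[OF inj]) (simp add: V_def)
  also have "\<dots> = (\<Prod>j\<in>UNIV. \<Sum>a\<in>S j. F j a)"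
    by (rule prod_sum_PiE[symmetric]) (auto simp: fin)
  finally show ?thesis .
qed

context
  fixes b :: "real \<Rightarrow> real" and \<delta> :: real
  assumes b: "smooth_bump b" and \<delta>: "0 < \<delta>" "\<delta> \<le> 1 / 2"
begin

lemma periodized_bump_measurable [measurable]: "periodic_bump b \<delta> \<in> borel_measurable borel"
proof (rule periodize_measurable)
  have [measurable]: "b \<in> borel_measurable borel" by (rule smooth_bump_props[OF b])
  show "(\<lambda>t. b (t / \<delta>)) \<in> borel_measurable borel" by measurable
qed (rule scaled_bump_eq_0[OF b \<delta>])

lemma periodized_bump_nonneg: "0 \<le> periodic_bump b \<delta> t"
  by (rule periodize_nonneg) (rule smooth_bump_props[OF b])

lemma periodized_bump_le: "periodic_bump b \<delta> t \<le> 3"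
  by (rule periodize_le_3) (auto intro: scaled_bump_eq_0[OF b \<delta>] smooth_bump_props[OF b])

lemma nn_integral_periodized_bump:
  "(\<integral>\<^sup>+ t. indicator {h..<h + real n} t * ennreal (periodic_bump b \<delta> t) \<partial>lborel)
    = ennreal (real n * (\<delta> * (LINT t|lborel. b t)))"
proof -
  have "integrable lborel (\<lambda>t. indicator {h..<h + real n} t *\<^sub>R periodic_bump b \<delta> t)"
    by (rule integrableI_bounded_set_indicator[where B = 3]) (auto simp: periodized_bump_nonneg periodized_bump_le)
  then have "(\<integral>\<^sup>+ t. ennreal (indicator {h..<h + real n} t *\<^sub>R periodic_bump b \<delta> t) \<partial>lborel)
      = ennreal (LINT t|lborel. indicator {h..<h + real n} t *\<^sub>R periodic_bump b \<delta> t)"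
    using periodized_bump_nonneg by (intro nn_integral_eq_integral) auto
  also have "(LINT t|lborel. indicator {h..<h + real n} t *\<^sub>R periodic_bump b \<delta> t) = real n * (\<delta> * (LINT t|lborel. b t))"
    using smooth_bump_scaled_integrable[OF b \<delta>(1)]
    by (subst integral_periodize[OF scaled_bump_eq_0[OF b \<delta>]]) (auto simp: smooth_bump_scaled_integral[OF \<delta>(1)])
  also have "(\<integral>\<^sup>+ t. ennreal (indicator {h..<h + real n} t *\<^sub>R periodic_bump b \<delta> t) \<partial>lborel)
      = (\<integral>\<^sup>+ t. indicator {h..<h + real n} t * ennreal (periodic_bump b \<delta> t) \<partial>lborel)"
    by (intro nn_integral_cong) (auto simp: indicator_def)
  finally show ?thesis .
qed

lemma nn_integral_periodized_bump_shift:
  "(\<integral>\<^sup>+ t. indicator {0..<1} t * ennreal (periodic_bump b \<delta> (h + t)) \<partial>lborel) = ennreal (\<delta> * (LINT t|lborel. b t))"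
proof -
  have "(\<integral>\<^sup>+ t. indicator {h..<h + real 1} t * ennreal (periodic_bump b \<delta> t) \<partial>lborel)
    = (\<integral>\<^sup>+ t. indicator {h..<h + real 1} (h + 1 * t) * ennreal (periodic_bump b \<delta> (h + 1 * t)) \<partial>lborel)"
    by (subst nn_integral_real_affine[where c = 1 and t = h]) auto
  also have "\<dots> = (\<integral>\<^sup>+ t. indicator {0..<1} t * ennreal (periodic_bump b \<delta> (h + t)) \<partial>lborel)"
    by (intro nn_integral_cong) (auto simp: indicator_def)
  finally show ?thesis using nn_integral_periodized_bump[of h 1] by simp
qed

lemma nn_integral_periodized_bump_scaled:
  assumes n: "n \<ge> 1"
  shows "(\<integral>\<^sup>+ t. indicator {0..1} t * ennreal (periodic_bump b \<delta> (real n * t - y)) \<partial>lborel) = ennreal (\<delta> * (LINT t|lborel. b t))"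
proof -
  let ?I = "\<integral>\<^sup>+ t. indicator {0..1} t * ennreal (periodic_bump b \<delta> (real n * t - y)) \<partial>lborel"
  have n0: "real n > 0" using n by simp
  have "(\<integral>\<^sup>+ t. indicator {- y..<- y + real n} t * ennreal (periodic_bump b \<delta> t) \<partial>lborel)
    = ennreal (real n) * (\<integral>\<^sup>+ t. indicator {- y..<- y + real n} (- y + real n * t) * ennreal (periodic_bump b \<delta> (- y + real n * t)) \<partial>lborel)"
    using n0 by (subst nn_integral_real_affine[where c = "real n" and t = "- y"]) auto
  also have "(\<integral>\<^sup>+ t. indicator {- y..<- y + real n} (- y + real n * t) * ennreal (periodic_bump b \<delta> (- y + real n * t)) \<partial>lborel) = ?I"
  proof (rule nn_integral_cong_AE)
    \<comment> \<open>The half-open window corresponds to the unit interval without its right end,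
      so the point 1 is discarded as a null set.\<close>
    show "AE t in lborel. indicator {- y..<- y + real n} (- y + real n * t) * ennreal (periodic_bump b \<delta> (- y + real n * t))
      = indicator {0..1} t * ennreal (periodic_bump b \<delta> (real n * t - y))"
      using AE_lborel_singleton[of "1::real"]
    proof eventually_elim
      case (elim t)
      then have "- y + real n * t \<in> {- y..<- y + real n} \<longleftrightarrow> t \<in> {0..1}"
        using n0 by (auto simp: zero_le_mult_iff mult_less_cancel_left1 intro: le_neq_trans)
      then show ?case by (auto simp: indicator_def add.commute)
    qed
  qed
  finally have "ennreal (real n) * ?I = ennreal (real n) * ennreal (\<delta> * (LINT t|lborel. b t))"
    unfolding nn_integral_periodized_bump using n0 by (subst ennreal_mult'[symmetric]) simp_all
  then show ?thesis using n0 by (subst (asm) ennreal_mult_cancel_left) auto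
qed

end

text \<open>For \<open>n \<ge> 1\<close> and admissible scales this is the exact Lebesgue integral
  of the counting function, not only its asymptotic value; see
  \<open>integral_smoothed_count\<close>.\<close>

abbreviation expected_count :: "('k::finite \<Rightarrow> real \<Rightarrow> real) \<Rightarrow> (nat \<Rightarrow> 'k \<Rightarrow> real) \<Rightarrow> nat \<Rightarrow> real" where
  "expected_count b d n \<equiv> \<Prod>j\<in>UNIV. real n * d n j * (LINT t|lborel. b j t)"

lemma measurable_frac_vec: "(\<lambda>x :: real ^ 'k::finite. \<chi> i. frac (x $ i)) \<in> borel_measurable borel"
proof -
  have "(\<lambda>x :: real ^ 'k. (\<chi> i. frac (x $ i)) \<bullet> axis i 1) \<in> borel_measurable borel" for i
    unfolding inner_axis frac_def by simp
  then show ?thesis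
    by (subst borel_measurable_euclidean_space) (auto simp: Basis_vec_def)
qed

section \<open>Product form of the counting function\<close>

context
  fixes b :: "'k::finite \<Rightarrow> real \<Rightarrow> real" and n :: nat and d :: "nat \<Rightarrow> 'k \<Rightarrow> real"
  assumes b: "\<And>j. smooth_bump (b j)" and n: "n \<ge> 1" and d: "\<And>j. 0 < d n j \<and> d n j \<le> 1 / (2 * real n)"
begin

lemma scale_bounds: "0 < real n * d n j" "real n * d n j \<le> 1 / 2"
  using d[of j] n by (auto simp: field_simps)

text \<open>Multiplying numerator and denominator by \<open>n\<close> turns the spacing
  \<open>1 / n\<close> into 1 and the scale into \<open>n * d n j\<close>, which is at most 1/2.
  Each scaled bump is then supported within distance 1 of its centre, and the sum over integer
  vectors factors.\<close>

lemma smoothed_count_eq: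
  "smoothed_count b y d n x = (\<Prod>j\<in>UNIV. periodic_bump (b j) (real n * d n j) (real n * x $ j - y $ j))"
proof -
  define S where "S j = {a::int. \<bar>(real n * x $ j - y $ j) - of_int a\<bar> \<le> 1}" for j
  have eq: "(x $ j - (real_of_int a + y $ j) / real n) / d n j = ((real n * x $ j - y $ j) - of_int a) / (real n * d n j)" for j and a :: int
    using n d[of j] by (simp add: field_simps)
  show ?thesis
    unfolding smoothed_count_def eq periodize_def S_def[symmetric]
  proof (rule infsum_prod_vec)
    show "finite (S j)" for j unfolding S_def by (rule finite_ints_near)
    show "b j ((real n * x $ j - y $ j - of_int a) / (real n * d n j)) = 0" if "a \<notin> S j" for j a
      using that by (intro scaled_bump_eq_0 b scale_bounds) (simp add: S_def)
  qed
qed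

lemma integral_smoothed_count:
  "(LINT x:cbox 0 1|lborel. smoothed_count b y d n x) = expected_count b d n"
proof -
  define \<psi> where "\<psi> j t = periodic_bump (b j) (real n * d n j) (real n * t - y $ j)" for j t
  note [measurable] = periodized_bump_measurable[OF b scale_bounds]
  have [measurable]: "\<psi> j \<in> borel_measurable borel" for j unfolding \<psi>_def by measurable
  have \<psi>0: "0 \<le> \<psi> j t" for j t unfolding \<psi>_def by (rule periodized_bump_nonneg[OF b scale_bounds])
  have pos: "0 < real n * d n j * (LINT t|lborel. b j t)" for j by (intro mult_pos_pos[of "real n * d n j"] scale_bounds smooth_bump_integral_pos b)
  have ind: "indicator (cbox 0 1) x = (\<Prod>j\<in>UNIV. indicator {0..1} (x $ j) :: real)" for x :: "real ^ 'k"
  proof (cases "x \<in> cbox 0 1")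
    case False
    then obtain j where "x $ j \<notin> {0..1}" by (auto simp: mem_box_cart)
    then have "indicator {0..1} (x $ j) = (0 :: real)" by (simp add: indicator_def)
    then have "(\<Prod>j\<in>UNIV. indicator {0..1} (x $ j) :: real) = 0" by (intro prod_zero) auto
    then show ?thesis using False by simp
  qed (auto simp: mem_box_cart indicator_def)
  let ?p = "\<lambda>x :: real ^ 'k. \<Prod>j\<in>UNIV. indicator {0..1} (x $ j) * \<psi> j (x $ j)"
  have eq: "indicator (cbox 0 1) x *\<^sub>R smoothed_count b y d n x = ?p x" for x
    by (simp add: ind smoothed_count_eq \<psi>_def prod.distrib)
  have "(LINT x:cbox 0 1|lborel. smoothed_count b y d n x)
      = enn2real (\<integral>\<^sup>+ x. ennreal (?p x) \<partial>lborel)"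
    unfolding set_lebesgue_integral_def eq
    by (rule integral_eq_nn_integral) (auto intro!: prod_nonneg mult_nonneg_nonneg \<psi>0)
  also have "(\<integral>\<^sup>+ x. ennreal (?p x) \<partial>lborel)
      = (\<integral>\<^sup>+ x. (\<Prod>j\<in>UNIV. indicator {0..1} (x $ j) * ennreal (\<psi> j (x $ j))) \<partial>(lborel :: (real ^ 'k) measure))"
  proof (intro nn_integral_cong)
    fix x :: "real ^ 'k"
    have "ennreal (?p x) = (\<Prod>j\<in>UNIV. ennreal (indicator {0..1} (x $ j) * \<psi> j (x $ j)))"
      by (intro prod_ennreal[symmetric]) (auto intro!: mult_nonneg_nonneg \<psi>0)
    also have "\<dots> = (\<Prod>j\<in>UNIV. indicator {0..1} (x $ j) * ennreal (\<psi> j (x $ j)))"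
      by (intro prod.cong) (auto simp: indicator_def)
    finally show "ennreal (?p x) = \<dots>" .
  qed
  also have "\<dots> = (\<Prod>j\<in>UNIV. \<integral>\<^sup>+ t. indicator {0..1} t * ennreal (\<psi> j t) \<partial>lborel)"
    by (rule nn_integral_prod_vec) measurable
  also have "\<dots> = (\<Prod>j\<in>UNIV. ennreal (real n * d n j * (LINT t|lborel. b j t)))"
    unfolding \<psi>_def by (simp only: nn_integral_periodized_bump_scaled[OF b scale_bounds n])
  also have "\<dots> = ennreal (expected_count b d n)"
    by (rule prod_ennreal) (use pos in \<open>auto intro: less_imp_le\<close>)
  finally show ?thesis
    using pos by (simp add: prod_nonneg less_imp_le)
qed

lemma measurable_smoothed_count:
  "smoothed_count b y d n \<in> borel_measurable borel"
proof -
  note [measurable] = periodized_bump_measurable[OF b scale_bounds]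
  show ?thesis unfolding smoothed_count_eq[abs_def] by measurable
qed

lemma smoothed_count_frac:
  fixes x :: "real ^ 'k"
  shows "smoothed_count b y d n (\<chi> i. frac (x $ i)) = smoothed_count b y d n x"
proof -
  have "periodize f (real n * frac t - s) = periodize f (real n * t - s)" for f :: "real \<Rightarrow> real" and t s
  proof -
    have "real n * frac t - s = (real n * t - s) + of_int (- (int n * \<lfloor>t\<rfloor>))"
      by (simp add: frac_def algebra_simps)
    then show ?thesis by (simp only: periodic_int[of "periodize f", OF periodize_periodic])
  qed
  then show ?thesis by (simp add: smoothed_count_eq)
qed

text \<open>Fractional parts always lie in the cube, so its indicator becomes 1, and periodicity of
  the counting function undoes the reduction.\<close>

lemma integral_reduce_mod_one:
  fixes \<mu> :: "(real ^ 'k) measure"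
  assumes [measurable_cong]: "sets \<mu> = sets borel"
  shows "(LINT x:cbox 0 1|reduce_mod_one \<mu>. smoothed_count b y d n x) = (LINT x|\<mu>. smoothed_count b y d n x)"
proof -
  note [measurable] = measurable_frac_vec measurable_smoothed_count
  have "(\<chi> i. frac (x $ i)) \<in> cbox 0 1" for x :: "real ^ 'k"
    by (auto simp: mem_box_cart less_imp_le[OF frac_lt_1])
  then show ?thesis
    unfolding set_lebesgue_integral_def reduce_mod_one_def
    by (subst integral_distr) (auto simp: smoothed_count_frac)
qed

text \<open>For the literal integral over the cube, without reduction modulo 1: when the cube
  carries the full mass, its indicator is 1 almost everywhere.\<close>

lemma integral_cbox_full_measure:
  fixes \<mu> :: "(real ^ 'k) measure"
  assumes sets [measurable_cong]: "sets \<mu> = sets borel" and "measure \<mu> (space \<mu>) = 1" "measure \<mu> (cbox 0 1) = 1"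
  shows "(LINT x:cbox 0 1|\<mu>. smoothed_count b y d n x) = (LINT x|\<mu>. smoothed_count b y d n x)"
proof -
  note [measurable] = measurable_smoothed_count
  \<comment> \<open>An infinite total mass would make \<open>measure\<close> equal to 0, so the
    value 1 implies finiteness.\<close>
  interpret finite_measure \<mu>
    using assms(2) by (intro finite_measureI) (auto simp: measure_def top.not_eq_extremum)
  have "cbox 0 1 \<in> sets \<mu>" using sets by simp
  then have "AE x in \<mu>. x \<in> cbox 0 1"
    using assms(2,3) finite_measure_compl[of "cbox 0 1"]
    by (intro AE_I[of _ _ "space \<mu> - cbox 0 1"]) (auto simp: emeasure_eq_measure)
  then show ?thesis
    unfolding set_lebesgue_integral_def
    by (intro integral_cong_AE) (auto elim!: eventually_mono)
qed

end

section \<open>Comparison of the two integrals\<close>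

lemma (in hyperplane_measure) periodic_weight_bumps:
  assumes b: "\<And>j. smooth_bump (b j)" and \<delta>: "\<And>j. 0 < \<delta> j" "\<And>j. \<delta> j \<le> 1 / 2"
  shows "periodic_weight (\<lambda>j t. periodic_bump (b j) (\<delta> j) (t - y $ j)) (\<lambda>j. \<delta> j * (LINT t|lborel. b j t))"
  unfolding periodic_weight_def
proof (intro allI conjI)
  fix i
  note [measurable] = periodized_bump_measurable[OF b \<delta>]
  show "(\<lambda>t. periodic_bump (b i) (\<delta> i) (t - y $ i)) \<in> borel_measurable borel" by measurable
  show "\<exists>B. \<forall>t. periodic_bump (b i) (\<delta> i) (t - y $ i) \<le> B" using periodized_bump_le[OF b \<delta>] by blast
  show "0 \<le> \<delta> i * (LINT t|lborel. b i t)" using \<delta>(1)[of i] smooth_bump_integral_pos[OF b] by (simp add: less_imp_le)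
  fix t
  show "0 \<le> periodic_bump (b i) (\<delta> i) (t - y $ i)" by (rule periodized_bump_nonneg[OF b \<delta>])
  show "periodic_bump (b i) (\<delta> i) (t + 1 - y $ i) = periodic_bump (b i) (\<delta> i) (t - y $ i)"
    using periodize_periodic[of _ "t - y $ i"] by (simp add: algebra_simps)
  show "(\<integral>\<^sup>+ s. indicator {0..<1} s * ennreal (periodic_bump (b i) (\<delta> i) (t + s - y $ i)) \<partial>lborel) = ennreal (\<delta> i * (LINT t|lborel. b i t))"
    using nn_integral_periodized_bump_shift[where b = "b i" and \<delta> = "\<delta> i" and h = "t - y $ i", OF b \<delta>] by (simp add: algebra_simps)
qed

lemma (in hyperplane_density) smoothed_count_estimate:
  assumes b: "\<And>j. smooth_bump (b j)" and w: "0 < w" "w < \<sigma>" and "c1 > 0" "c2 > 0"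
    and dioph: "\<And>q::int. q \<noteq> 0 \<Longrightarrow>
      far_from_ints (($) \<alpha>) j0 c1 w q"
  shows "\<exists>C>0. \<forall>n\<ge>1. (\<forall>j. 0 < d n j \<and> d n j \<le> 1 / (2 * real n)) \<longrightarrow> c2 * real n powr (- 1 - 1 / \<sigma>) \<le> d n j0 \<longrightarrow>
    \<bar>(LINT x|\<mu>. \<rho> x * smoothed_count b y d n x) - (expected_count b d n)\<bar>
      \<le> C / real n * (expected_count b d n)"
proof -
  obtain C where C: "C > 0" "\<And>\<psi> m n y \<delta>. periodic_weight \<psi> m \<Longrightarrow> n \<ge> 1 \<Longrightarrow> 0 < \<delta> \<Longrightarrow> \<delta> \<le> 1 / 2 \<Longrightarrow> c2 * real n powr (- 1 / \<sigma>) \<le> \<delta> \<Longrightarrow>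
    \<bar>(LINT x|\<mu>. \<rho> x * weight \<psi> n x * periodic_bump (b j0) \<delta> (real n * x $ j0 - y))
      - \<delta> * (LINT t|lborel. b j0 t) * mean m\<bar> \<le> C / real n * (\<delta> * (LINT t|lborel. b j0 t) * mean m)"
    using bump_count_estimate[OF b w assms(4,5) dioph] by blast
  have "\<bar>(LINT x|\<mu>. \<rho> x * smoothed_count b y d n x) - (expected_count b d n)\<bar>
      \<le> C / real n * (expected_count b d n)"
    if n: "n \<ge> 1" and d: "\<And>j. 0 < d n j \<and> d n j \<le> 1 / (2 * real n)" and dj0: "c2 * real n powr (- 1 - 1 / \<sigma>) \<le> d n j0" for n
  proof -
    define \<delta> where "\<delta> j = real n * d n j" for j
    have \<delta>: "0 < \<delta> j" "\<delta> j \<le> 1 / 2" for j using d[of j] n by (auto simp: field_simps \<delta>_def)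
    have "real n * (c2 * real n powr (- 1 - 1 / \<sigma>)) \<le> \<delta> j0"
      unfolding \<delta>_def using dj0 by (rule mult_left_mono) simp
    \<comment> \<open>Passing from \<open>d n j0\<close> to \<open>\<delta> j0 = n * d n j0\<close>
      removes the -1 from the exponent and leaves the scale bound of
      \<open>bump_count_estimate\<close>.\<close>
    moreover have "real n * real n powr (- 1 - 1 / \<sigma>) = real n powr (- 1 / \<sigma>)"
      using n by (simp add: powr_diff powr_minus field_simps)
    ultimately have \<delta>j0: "c2 * real n powr (- 1 / \<sigma>) \<le> \<delta> j0" by (simp add: mult.left_commute)
    define \<psi> where "\<psi> = (\<lambda>j t. periodic_bump (b j) (\<delta> j) (t - y $ j))"
    have wt: "periodic_weight \<psi> (\<lambda>j. \<delta> j * (LINT t|lborel. b j t))"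
      unfolding \<psi>_def by (rule periodic_weight_bumps[OF b \<delta>])
    have "smoothed_count b y d n x = weight \<psi> n x * periodic_bump (b j0) (\<delta> j0) (real n * x $ j0 - y $ j0)" for x
      unfolding smoothed_count_eq[where b = b and n = n and d = d, OF b n d] weight_def \<psi>_def \<delta>_def by (subst prod.remove[of UNIV j0]) auto
    moreover have "(expected_count b d n) = \<delta> j0 * (LINT t|lborel. b j0 t) * mean (\<lambda>j. \<delta> j * (LINT t|lborel. b j t))"
      unfolding \<delta>_def by (subst prod.remove[of UNIV j0]) auto
    ultimately show ?thesis using C(2)[OF wt n \<delta> \<delta>j0, of "y $ j0"] by (simp add: mult.assoc)
  qed
  then show ?thesis using C by blast
qed

lemma asymp_equiv_of_relative_error:
  fixes f g :: "nat \<Rightarrow> real"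
  assumes "\<forall>\<^sub>F n in sequentially. 0 < g n \<and> \<bar>f n - g n\<bar> \<le> C / real n * g n"
  shows "f \<sim>[sequentially] g"
proof (rule asymp_equivI')
  have "(\<lambda>n. f n / g n - 1) \<longlonglongrightarrow> 0"
  proof (rule Lim_null_comparison[OF _ lim_const_over_n[of C]])
    show "\<forall>\<^sub>F n in sequentially. norm (f n / g n - 1) \<le> C / real n"
      using assms
    proof eventually_elim
      case (elim n)
      then have "\<bar>f n / g n - 1\<bar> = \<bar>f n - g n\<bar> / g n" by (simp add: field_simps abs_divide[symmetric])
      also have "\<dots> \<le> C / real n" using elim by (simp add: pos_divide_le_eq)
      finally show ?case by simp
    qed
  qed
  then show "(\<lambda>n. f n / g n) \<longlonglongrightarrow> 1" by (rule LIM_zero_cancel)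
qed

theorem mainTheorem7:
  fixes \<alpha> y v :: "(real, 'k::{finite,linorder}) vec"
    and H :: "(real, 'k) vec set" and c varpi :: real and l :: nat
    and B r :: "'k \<Rightarrow> real" and \<beta> b :: "'k \<Rightarrow> real \<Rightarrow> real"
    and R :: "((real, 'k) vec, 'k) vec" and \<mu>0 :: "(real, 'k) vec measure"
    and d :: "nat \<Rightarrow> 'k \<Rightarrow> real" and \<omega> :: ereal
  assumes "CARD('k) \<ge> 2"
    and "1 \<le> l" "l \<le> CARD('k)"
    and "\<forall>j. pos j = 1 \<longrightarrow> \<alpha> $ j = 1"
    and "\<forall>j. 2 \<le> pos j \<and> pos j \<le> l \<longrightarrow> \<alpha> $ j \<noteq> 0"
    and "\<forall>j. l < pos j \<longrightarrow> \<alpha> $ j = 0"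
    and "H = {x. \<alpha> \<bullet> x = c}"
    and "\<omega> = simultaneous_exponent {j. 2 \<le> pos j} (\<lambda>j. \<alpha> $ j)"
    and "\<omega> < \<infinity>"
    and "\<forall>i\<in>base_coords. B i > 0 \<and> r i > 0 \<and> smooth_bump (\<beta> i)"
    and "rotation_matrix R"
    and "(\<lambda>x. R *v x) ` {x. \<forall>j. pos j = CARD('k) \<longrightarrow> x $ j = 0} = {x. \<alpha> \<bullet> x = 0}"
    and "(\<lambda>x. x + v) ` {x. \<alpha> \<bullet> x = 0} = H"
    and "\<mu>0 = distr (base_measure B r \<beta>) borel (\<lambda>x. R *v x + v)"
    and "\<forall>j. smooth_bump (b j)"
    and "\<forall>n\<ge>1. \<forall>j. 0 < d n j \<and> d n j \<le> 1 / (2 * real n)"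
    and "ereal varpi > \<omega>"
    and "(\<lambda>n. Max {d n j | j. pos j \<le> l}) \<in> \<Omega>(\<lambda>n. real n powr (- 1 - 1 / varpi))"
  shows "((\<lambda>n. LINT x:cbox 0 1|reduce_mod_one \<mu>0. smoothed_count b y d n x)
            \<sim>[sequentially] (\<lambda>n. LINT x:cbox 0 1|lborel. smoothed_count b y d n x)) \<and>
         (measure \<mu>0 (cbox 0 1) = 1 \<longrightarrow>
            (\<lambda>n. LINT x:cbox 0 1|\<mu>0. smoothed_count b y d n x)
            \<sim>[sequentially] (\<lambda>n. LINT x:cbox 0 1|lborel. smoothed_count b y d n x))"
proof -
  have k2: "CARD('k) \<ge> 2" and a1: "\<And>j. pos j = 1 \<Longrightarrow> \<alpha> $ j = 1" and a2: "\<And>j. 2 \<le> pos j \<Longrightarrow> pos j \<le> l \<Longrightarrow> \<alpha> $ j \<noteq> 0"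
    using assms(1,4,5) by blast+
  have b: "smooth_bump (b j)" for j using assms(15) by blast
  have d: "0 < d n j \<and> d n j \<le> 1 / (2 * real n)" if "n \<ge> 1" for n j
    using assms(16)[rule_format, OF that] .
  define p :: 'k where "p = Min UNIV"
  have p: "pos j = 1 \<longleftrightarrow> j = p" "pos j \<ge> 1" for j
  proof -
    have le: "p \<le> j" for j unfolding p_def by simp
    have sub: "{p, j} \<subseteq> {i. i \<le> j}" using le by auto
    have card_le: "card {p, j} \<le> pos j" unfolding pos_def by (rule card_mono[OF _ sub]) simp
    have "{i. i \<le> p} = {p}"
    proof (intro set_eqI iffI)
      fix i assume "i \<in> {i. i \<le> p}"
      then have "i \<le> p" by simp
      then have "i = p" using le by (rule order.antisym)
      then show "i \<in> {p}" by simp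
    qed simp
    then have pos_p: "pos p = 1" by (simp add: pos_def)
    show "pos j \<ge> 1" using card_le by (cases "j = p") auto
    show "pos j = 1 \<longleftrightarrow> j = p"
    proof
      assume "pos j = 1"
      then show "j = p" using card_le by (cases "j = p") auto
    qed (simp only: pos_p)
  qed
  define I where "I = {j :: 'k. 2 \<le> pos j}"
  have I: "I = UNIV - {p}"
  proof -
    have "2 \<le> pos j \<longleftrightarrow> j \<noteq> p" for j using p[of j] by linarith
    then show ?thesis by (auto simp: I_def)
  qed
  have I0: "I \<noteq> {}"
  proof
    assume "I = {}"
    then have "(UNIV :: 'k set) = {p}" using I by blast
    then have "CARD('k) = card {p}" by simp
    then show False using k2 by simp
  qed
  \<comment> \<open>The admissible pivots: \<open>\<alpha>\<close> vanishes at none of these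
    positions.\<close>
  define J where "J = {j :: 'k. pos j \<le> l}"
  have J: "\<alpha> $ j \<noteq> 0" if "j \<in> J" for j
    using that a1[of j] a2[of j] p(2)[of j] by (cases "pos j = 1") (auto simp: J_def)
  have J0: "p \<in> J" "finite J" using assms(2) p(1)[of p] by (auto simp: J_def)
  have "simultaneous_exponent I (\<lambda>j. \<alpha> $ j) < ereal varpi"
    using assms(17) unfolding assms(8) I_def .
  \<comment> \<open>The strict inequality leaves room for \<open>w\<close>: a uniform lower bound
    needs an exponent above \<open>\<omega>\<close>, while the choice of \<open>\<kappa>\<close>
    needs one below \<open>varpi\<close>.\<close>
  from ereal_dense2[OF this] obtain w where
    w': "simultaneous_exponent I (\<lambda>j. \<alpha> $ j) < ereal w" "ereal w < ereal varpi" by blast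
  have w: "simultaneous_exponent I (\<lambda>j. \<alpha> $ j) < ereal w" "w < varpi"
    by (rule w'(1), rule less_ereal.simps(1)[THEN iffD1, OF w'(2)])
  have w0: "0 < w" by (rule simultaneous_exponent_less_imp_pos[OF finite I0 w(1)])
  interpret rotated_base \<alpha> v B r \<beta> R
    by (rule rotated_base.intro[OF assms(1) _ assms(11,12)]) (rule assms(10)[rule_format])
  obtain \<rho> K where \<rho>': "\<And>j0. \<alpha> $ j0 \<noteq> 0 \<Longrightarrow> hyperplane_density plane_measure \<alpha> j0 \<rho> K"
    "\<And>f. f \<in> borel_measurable borel \<Longrightarrow>
      (LINT x|distr (base_measure B r \<beta>) borel (\<lambda>x. R *v x + v). f x) = (LINT x|plane_measure. \<rho> x * f x)"
    by (rule hyperplane_density_exists) (rule that)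
  note \<rho> = \<rho>'(1) \<rho>'(2)[folded assms(14)]
  obtain c2 where c2: "c2 > 0" "\<forall>\<^sub>F n in sequentially. c2 * real n powr (- 1 - 1 / varpi) \<le> \<bar>Max {d n j | j. pos j \<le> l}\<bar>"
    using assms(18) unfolding bigomega_def by auto
  define \<Lambda> where "\<Lambda> n = expected_count b d n" for n
  define F where "F n = (LINT x|\<mu>0. smoothed_count b y d n x)" for n
  have \<Lambda>_pos: "\<Lambda> n > 0" if "n \<ge> 1" for n
    unfolding \<Lambda>_def using d[OF that] that smooth_bump_integral_pos[OF b]
    by (intro prod_pos) (auto intro!: mult_pos_pos)
  have F_eq: "F n = (LINT x|plane_measure. \<rho> x * smoothed_count b y d n x)" if "n \<ge> 1" for n
    unfolding F_def by (rule \<rho>(2)[OF measurable_smoothed_count[where b = b and n = n and d = d, OF b that d[OF that]]])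
  \<comment> \<open>The index of the largest scale may vary with \<open>n\<close>. Constants are
    therefore obtained for every fixed pivot, with the lower bound on its scale as a condition on
    the individual \<open>n\<close>.\<close>
  have "\<forall>j0\<in>J. \<exists>C>0. \<forall>n\<ge>1. c2 * real n powr (- 1 - 1 / varpi) \<le> d n j0 \<longrightarrow> \<bar>F n - \<Lambda> n\<bar> \<le> C / real n * \<Lambda> n"
  proof
    fix j0 assume j0: "j0 \<in> J"
    interpret D: hyperplane_density plane_measure \<alpha> j0 \<rho> K by (rule \<rho>(1)[OF J[OF j0]])
    obtain c1 where c1: "c1 > 0" "\<And>q::int. q \<noteq> 0 \<Longrightarrow>
        far_from_ints (($) \<alpha>) j0 c1 w q"
      using exponent_bound_ratio[of "\<lambda>j. \<alpha> $ j" p j0 I w] a1[of p] p(1)[of p] J[OF j0] I I0 w(1) by auto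
    show "\<exists>C>0. \<forall>n\<ge>1. c2 * real n powr (- 1 - 1 / varpi) \<le> d n j0 \<longrightarrow> \<bar>F n - \<Lambda> n\<bar> \<le> C / real n * \<Lambda> n"
    proof -
      obtain C where "C > 0" and C: "\<And>n. n \<ge> 1 \<Longrightarrow> (\<forall>j. 0 < d n j \<and> d n j \<le> 1 / (2 * real n)) \<Longrightarrow>
          c2 * real n powr (- 1 - 1 / varpi) \<le> d n j0 \<Longrightarrow>
          \<bar>(LINT x|plane_measure. \<rho> x * smoothed_count b y d n x) - \<Lambda> n\<bar> \<le> C / real n * \<Lambda> n"
        using D.smoothed_count_estimate[where b = b and y = y and d = d, OF b w0 w(2) c1(1) c2(1) c1(2)]
        unfolding \<Lambda>_def by blast
      have "\<bar>F n - \<Lambda> n\<bar> \<le> C / real n * \<Lambda> n" if "n \<ge> 1" "c2 * real n powr (- 1 - 1 / varpi) \<le> d n j0" for n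
        unfolding F_eq[OF that(1)] by (rule C[OF that(1) _ that(2)]) (intro allI d that(1))
      then show ?thesis using \<open>C > 0\<close> by blast
    qed
  qed
  from bchoice[OF this] obtain C where C: "\<And>j0. j0 \<in> J \<Longrightarrow> C j0 > 0"
    "\<And>j0 n. j0 \<in> J \<Longrightarrow> n \<ge> 1 \<Longrightarrow> c2 * real n powr (- 1 - 1 / varpi) \<le> d n j0 \<Longrightarrow> \<bar>F n - \<Lambda> n\<bar> \<le> C j0 / real n * \<Lambda> n"
    by blast
  \<comment> \<open>For each large \<open>n\<close> some pivot attains the maximum, and the sum of
    the positive constants dominates whichever one is needed.\<close>
  have ev: "\<forall>\<^sub>F n in sequentially. 0 < \<Lambda> n \<and> \<bar>F n - \<Lambda> n\<bar> \<le> (\<Sum>j\<in>J. C j) / real n * \<Lambda> n"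
    using c2(2) eventually_ge_at_top[of 1]
  proof eventually_elim
    case (elim n)
    have set_eq: "{d n j | j. pos j \<le> l} = d n ` J" by (auto simp: J_def)
    have "Max (d n ` J) \<in> d n ` J" using J0 by (intro Max_in) auto
    then obtain j0 where j0: "j0 \<in> J" "Max (d n ` J) = d n j0" by auto
    have "c2 * real n powr (- 1 - 1 / varpi) \<le> d n j0"
      using elim d[of n j0] unfolding set_eq j0(2) by simp
    then have "\<bar>F n - \<Lambda> n\<bar> \<le> C j0 / real n * \<Lambda> n" using C(2) j0(1) elim(2) by blast
    also have "\<dots> \<le> (\<Sum>j\<in>J. C j) / real n * \<Lambda> n"
      using C(1) J0 j0(1) \<Lambda>_pos[OF elim(2)]
      by (intro mult_right_mono divide_right_mono member_le_sum) (auto intro: less_imp_le)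
    finally show ?case using \<Lambda>_pos[OF elim(2)] by simp
  qed
  let ?m = "\<lambda>n. LINT x:cbox 0 1|lborel. smoothed_count b y d n x"
  have equiv: "f \<sim>[sequentially] ?m" if "\<And>n. n \<ge> 1 \<Longrightarrow> f n = F n" for f
  proof (rule asymp_equiv_of_relative_error[of _ _ "\<Sum>j\<in>J. C j"])
    show "\<forall>\<^sub>F n in sequentially. 0 < ?m n \<and>
      \<bar>f n - ?m n\<bar> \<le> (\<Sum>j\<in>J. C j) / real n * ?m n"
      using ev eventually_ge_at_top[of 1]
    proof eventually_elim
      case (elim n)
      then show ?case by (simp add: integral_smoothed_count[where b = b and n = n and d = d, OF b elim(2) d[OF elim(2)]] that \<Lambda>_def)
    qed
  qed
  have sets: "sets \<mu>0 = sets borel" by (simp add: assms(14))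
  show ?thesis
  proof (intro conjI impI equiv)
    fix n :: nat assume n: "n \<ge> 1"
    show "(LINT x:cbox 0 1|reduce_mod_one \<mu>0. smoothed_count b y d n x) = F n"
      unfolding F_def by (rule integral_reduce_mod_one[where b = b and n = n and d = d, OF b n d[OF n] sets])
  next
    fix n :: nat assume one: "measure \<mu>0 (cbox 0 1) = 1" and n: "n \<ge> 1"
    \<comment> \<open>Any pivot gives access to the total mass of the density; \<open>p\<close>
      always belongs to \<open>J\<close> since \<open>1 \<le> l\<close>.\<close>
    interpret D: hyperplane_density plane_measure \<alpha> p \<rho> K by (rule \<rho>(1)[OF J[OF J0(1)]])
    have "measure \<mu>0 (space \<mu>0) = 1"
      using \<rho>(2)[of "\<lambda>x. 1"] D.density_integral by simp
    then show "(LINT x:cbox 0 1|\<mu>0. smoothed_count b y d n x) = F n"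
      unfolding F_def by (rule integral_cbox_full_measure[where b = b and n = n and d = d, OF b n d[OF n] sets _ one])
  qed
qed

end
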